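(* Consider the weight $4$ part $C^{\bullet}_{GF}(\mathfrak{ham}_4^0,Sp(4,\mathbb{R}))_4$ of the Gel'fand-Kalinin-Fuks cochain complex of $\mathfrak{ham}_4^0$ relative to $Sp(4,\mathbb{R})$. The dimensions of its cochain spaces in degrees $0,1,2,3,4$ are $0,0,0,1,3$ respectively, and the Betti numbers (dimensions of the cohomology groups) in degrees $0,1,2,3,4$ are $0,0,0,0,2$ respectively.
   Context: On $\mathbb{R}^4$ with coordinates $x_1,x_2,x_3,x_4$ use the Poisson bracket $\{f,g\}=\frac{\partial f}{\partial x_1}\frac{\partial g}{\partial x_4}+\frac{\partial f}{\partial x_2}\frac{\partial g}{\partial x_3}-\frac{\partial f}{\partial x_3}\frac{\partial g}{\partial x_2}-\frac{\partial f}{\partial x_4}\frac{\partial g}{\partial x_1}$. Let $\mathfrak{ham}_4^0$ be the Lie algebra of Hamiltonian vector fields with polynomial potentials vanishing at the origin, identified with the Lie algebra, under $\{\cdot,\cdot\}$, of real polynomials all of whose homogeneous components have degree $\ge 2$. Let $\mathfrak{S}_\ell$ be the dual space of the space of homogeneous polynomials of degree $\ell$. Nonzero elements of $\mathfrak{S}_\ell$ have weight $\ell-2$, and nonzero elements of $\mathfrak{S}_{\ell_1}\wedge\cdots\wedge\mathfrak{S}_{\ell_s}$ have weight $\sum_i(\ell_i-2)$. The degree $m$, weight $w$ cochain space is $$C^m_{GF}(\mathfrak{ham}_4^0)_w=\bigoplus \Lambda^{k_2}\mathfrak{S}_2\wedge\Lambda^{k_3}\mathfrak{S}_3\wedge\cdots\wedge\Lambda^{k_s}\mathfrak{S}_s,$$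 the sum being over all finite sequences of non-negative integers $(k_2,k_3,\dots)$ with $\sum_i k_i=m$ and $\sum_i k_i(i-2)=w$. The coboundary operator $d$ is the (degree $+1$) antiderivation determined on $1$-cochains by $(d z)(f,g)=-\langle z,\{f,g\}\rangle$; it preserves weight. The relative cochain space $C^m_{GF}(\mathfrak{ham}_4^0,Sp(4,\mathbb{R}))_w$ consists of those $\sigma\in C^m_{GF}(\mathfrak{ham}_4^0)_w$ with $i_{\hat J(\xi)}\sigma=0$ and $i_{\hat J(\xi)}d\sigma=0$ for all $\xi\in\mathfrak{sp}(4,\mathbb{R})$, where $J$ is the momentum mapping of the linear action of $Sp(4,\mathbb{R})$ on $\mathbb{R}^4$, so that $\hat J(\xi)$ ranges over all homogeneous quadratic polynomials, and $i$ denotes interior product. (Equivalently, it is the space of $Sp(4,\mathbb{R})$-invariant cochains in which $\mathfrak{S}_2$ does not appear.) These form a complex under $d$ for each fixed $w$; the Betti number in degree $m$ is the dimension of its degree $m$ cohomology. *)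

theory Defs
  imports
    Complex_Main
    "HOL-Library.Poly_Mapping"
    "HOL-Library.Function_Algebras"
    "HOL-Library.Numeral_Type"
begin

section \<open>Pointwise real vector space structures\<close>

instantiation "fun" :: (type, real_vector) real_vector
begin

definition scaleR_fun :: "real \<Rightarrow> ('a \<Rightarrow> 'b) \<Rightarrow> 'a \<Rightarrow> 'b"
  where "scaleR_fun c f = (\<lambda>x. c *\<^sub>R f x)"

instance
  by standard (simp_all add: scaleR_fun_def fun_eq_iff scaleR_add_right scaleR_add_left)

end

instantiation poly_mapping :: (type, real_vector) real_vector
begin

lift_definition scaleR_poly_mapping :: "real \<Rightarrow> ('a \<Rightarrow>\<^sub>0 'b) \<Rightarrow> 'a \<Rightarrow>\<^sub>0 'b"
  is "\<lambda>c p a. c *\<^sub>R p a"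
  by (erule finite_subset[rotated]) auto

instance
  by (standard; transfer) (simp_all add: fun_eq_iff scaleR_add_right scaleR_add_left)

end


section \<open>The Lie algebra of polynomial Hamiltonians\<close>

text \<open>
  An exponent vector is a finitely supported map on the index type \<open>4\<close>, whose elements are
  written \<open>1, 2, 3, 4\<close> (with \<open>4 = 0\<close> in that type), and a polynomial is a finitely supported
  map from exponent vectors to real coefficients.
\<close>

type_synonym poly4 = "(4 \<Rightarrow>\<^sub>0 nat) \<Rightarrow>\<^sub>0 real"

definition mdeg :: "(4 \<Rightarrow>\<^sub>0 nat) \<Rightarrow> nat"
  where "mdeg a = (\<Sum>i\<in>UNIV. Poly_Mapping.lookup a i)"

text \<open>
  In a term with exponent \<open>0\<close> at \<open>i\<close> the truncated subtraction is harmless, since the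
  coefficient vanishes.
\<close>

definition partial_deriv :: "4 \<Rightarrow> poly4 \<Rightarrow> poly4"
  where "partial_deriv i p =
    (\<Sum>a\<in>Poly_Mapping.keys p.
       Poly_Mapping.single (a - Poly_Mapping.single i 1)
         (real (Poly_Mapping.lookup a i) * Poly_Mapping.lookup p a))"

definition poisson :: "poly4 \<Rightarrow> poly4 \<Rightarrow> poly4"
  where "poisson f g =
      partial_deriv 1 f * partial_deriv 4 g + partial_deriv 2 f * partial_deriv 3 g
    - partial_deriv 3 f * partial_deriv 2 g - partial_deriv 4 f * partial_deriv 1 g"

lemma mdeg_add: "mdeg (a + b) = mdeg a + mdeg b"
  by (simp add: mdeg_def lookup_add sum.distrib)

lemma mdeg_minus_single: "mdeg a \<le> Suc (mdeg (a - Poly_Mapping.single i 1))"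
proof -
  have "mdeg a \<le> (\<Sum>j\<in>UNIV. Poly_Mapping.lookup (a - Poly_Mapping.single i 1) j + (if j = i then 1 else 0))"
    unfolding mdeg_def
    by (rule sum_mono) (auto simp: lookup_minus lookup_single when_def)
  then show ?thesis
    by (simp add: sum.distrib mdeg_def)
qed

lemma keys_partial_deriv:
  assumes "b \<in> Poly_Mapping.keys (partial_deriv i p)"
  shows "\<exists>a\<in>Poly_Mapping.keys p. mdeg a \<le> Suc (mdeg b)"
proof -
  from assms obtain a where a: "a \<in> Poly_Mapping.keys p"
    and "b \<in> Poly_Mapping.keys (Poly_Mapping.single (a - Poly_Mapping.single i 1)
         (real (Poly_Mapping.lookup a i) * Poly_Mapping.lookup p a))"
    unfolding partial_deriv_def using keys_sum by fast
  then have "b = a - Poly_Mapping.single i 1"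
    by (auto split: if_splits)
  with a mdeg_minus_single show ?thesis by blast
qed

lemma keys_partial_deriv_mult:
  assumes "\<forall>a\<in>Poly_Mapping.keys f. 2 \<le> mdeg a" "\<forall>a\<in>Poly_Mapping.keys g. 2 \<le> mdeg a"
    and "c \<in> Poly_Mapping.keys (partial_deriv i f * partial_deriv j g)"
  shows "2 \<le> mdeg c"
proof -
  from assms(3) obtain a b where "c = a + b" "a \<in> Poly_Mapping.keys (partial_deriv i f)"
      "b \<in> Poly_Mapping.keys (partial_deriv j g)"
    using keys_mult by fast
  then show ?thesis
    using assms(1,2) keys_partial_deriv[of a i f] keys_partial_deriv[of b j g]
    by (fastforce simp: mdeg_add)
qed

lemma poisson_closed:
  assumes "\<forall>a\<in>Poly_Mapping.keys f. 2 \<le> mdeg a" "\<forall>a\<in>Poly_Mapping.keys g. 2 \<le> mdeg a"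
  shows "\<forall>a\<in>Poly_Mapping.keys (poisson f g). 2 \<le> mdeg a"
proof
  fix c assume "c \<in> Poly_Mapping.keys (poisson f g)"
  then have "\<exists>i j. c \<in> Poly_Mapping.keys (partial_deriv i f * partial_deriv j g)"
    unfolding poisson_def in_keys_iff lookup_add lookup_minus by (metis add_0 diff_zero)
  then show "2 \<le> mdeg c" using keys_partial_deriv_mult[OF assms] by blast
qed

typedef ham = "{p :: poly4. \<forall>a\<in>Poly_Mapping.keys p. 2 \<le> mdeg a}"
  morphisms potential Ham
  by (rule exI[of _ 0]) simp

setup_lifting type_definition_ham

instantiation ham :: real_vector
begin

lift_definition zero_ham :: ham is 0 by simp
lift_definition plus_ham :: "ham \<Rightarrow> ham \<Rightarrow> ham" is "(+)"
  using keys_add by fast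
lift_definition uminus_ham :: "ham \<Rightarrow> ham" is uminus
  by (simp add: in_keys_iff)
lift_definition minus_ham :: "ham \<Rightarrow> ham \<Rightarrow> ham" is "(-)"
  using keys_diff by (metis (no_types, lifting) Un_iff in_keys_iff lookup_minus diff_zero)
lift_definition scaleR_ham :: "real \<Rightarrow> ham \<Rightarrow> ham" is "(*\<^sub>R)"
  by (simp add: in_keys_iff scaleR_poly_mapping.rep_eq)

instance
  by (standard; transfer) (simp_all add: algebra_simps)

end

lift_definition bracket :: "ham \<Rightarrow> ham \<Rightarrow> ham" is poisson
  using poisson_closed by blast

definition homogeneous :: "nat \<Rightarrow> ham set"
  where "homogeneous l = {f. \<forall>a\<in>Poly_Mapping.keys (potential f). mdeg a = l}"


section \<open>Cochains\<close>

text \<open>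
  A cochain is a function on lists of elements of the Lie algebra; one of degree \<open>m\<close> is
  supported on lists of length \<open>m\<close>, so cochains of all degrees share one real vector space.
\<close>

type_synonym cochain = "ham list \<Rightarrow> real"

text \<open>
  The dual of the space of homogeneous polynomials of degree \<open>l\<close>, each functional being extended
  by \<open>0\<close> to the other homogeneous components.
\<close>

definition dual_space :: "nat \<Rightarrow> (ham \<Rightarrow> real) set"
  where "dual_space l =
    {z. linear z \<and> (\<forall>k f. k \<noteq> l \<longrightarrow> f \<in> homogeneous k \<longrightarrow> z f = 0)}"

definition one_cochain :: "(ham \<Rightarrow> real) \<Rightarrow> cochain"
  where "one_cochain z fs = (case fs of [f] \<Rightarrow> z f | _ \<Rightarrow> 0)"

definition unit_cochain :: cochain
  where "unit_cochain fs = (if fs = [] then 1 else 0)"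

definition interior :: "ham \<Rightarrow> cochain \<Rightarrow> cochain"
  where "interior f \<sigma> = (\<lambda>fs. \<sigma> (f # fs))"

text \<open>The sign \<open>(-1)\<^sup>p\<close> on cochains of degree \<open>p\<close>.\<close>

definition grade_sign :: "cochain \<Rightarrow> cochain"
  where "grade_sign \<sigma> = (\<lambda>fs. (- 1) ^ length fs * \<sigma> fs)"

text \<open>
  The exterior product, as the signed sum over all shuffles: each argument in turn is handed
  either to \<open>\<alpha>\<close> or, with the sign for passing the remaining arguments of \<open>\<alpha>\<close>, to \<open>\<beta>\<close>.
  In particular \<open>z\<^sub>1 \<and> \<dots> \<and> z\<^sub>m\<close> evaluates on \<open>f\<^sub>1, \<dots>, f\<^sub>m\<close> to the determinant of
  \<open>z\<^sub>i f\<^sub>j\<close>, without a factor \<open>1 / m!\<close>.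
\<close>

fun wedge :: "cochain \<Rightarrow> cochain \<Rightarrow> cochain"
  where
    "wedge \<alpha> \<beta> [] = \<alpha> [] * \<beta> []"
  | "wedge \<alpha> \<beta> (f # fs) =
       wedge (interior f \<alpha>) \<beta> fs + wedge (grade_sign \<alpha>) (interior f \<beta>) fs"

definition wedge_list :: "(ham \<Rightarrow> real) list \<Rightarrow> cochain"
  where "wedge_list zs = foldr (\<lambda>z. wedge (one_cochain z)) zs unit_cochain"

text \<open>
  \<open>exterior_component k\<close> is \<open>\<Lambda>\<^bsup>k 2\<^esup> S\<^sub>2 \<and> \<Lambda>\<^bsup>k 3\<^esup> S\<^sub>3 \<and> \<dots>\<close> with \<open>S\<^sub>l = dual_space l\<close>; the order of the
  factors only affects signs.
\<close>

definition exterior_component :: "(nat \<Rightarrow> nat) \<Rightarrow> cochain set"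
  where "exterior_component k =
    span {wedge_list zs | zs ls.
            list_all2 (\<lambda>z l. z \<in> dual_space l) zs ls \<and> (\<forall>l. count_list ls l = k l)}"

definition cochains :: "nat \<Rightarrow> nat \<Rightarrow> cochain set"
  where "cochains m w =
    span (\<Union>k\<in>{k. k 0 = 0 \<and> k 1 = 0 \<and> finite {i. k i \<noteq> 0} \<and>
                  (\<Sum>i | k i \<noteq> 0. k i) = m \<and> (\<Sum>i | k i \<noteq> 0. k i * (i - 2)) = w}.
            exterior_component k)"

text \<open>
  The Chevalley-Eilenberg formula.  Lemmas \<open>coboundary_one_cochain\<close> and \<open>coboundary_wedge\<close>
  below show that it is the antiderivation determined by \<open>(d z)(f, g) = - \<langle>z, {f, g}\<rangle>\<close>.
\<close>

definition coboundary :: "cochain \<Rightarrow> cochain"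
  where "coboundary \<sigma> fs =
    (\<Sum>j<length fs. \<Sum>i<j.
       (- 1) ^ (i + j) * \<sigma> (bracket (fs ! i) (fs ! j) # nths fs (- {i, j})))"


subsection \<open>The coboundary operator is an antiderivation\<close>

lemma coboundary_one_cochain:
  "coboundary (one_cochain z) fs = (case fs of [f, g] \<Rightarrow> - z (bracket f g) | _ \<Rightarrow> 0)"
proof -
  consider "fs = []" | f where "fs = [f]" | f g where "fs = [f, g]"
    | f g h hs where "fs = f # g # h # hs"
    by (metis neq_Nil_conv)
  then show ?thesis
  proof cases
    case (3 f g)
    have "nths [f, g] (- {0, Suc 0}) = []"
      by (simp add: nths_Cons)
    then show ?thesis
      by (simp add: 3 coboundary_def one_cochain_def lessThan_Suc)
  next
    case (4 f g h hs)
    have "nths fs (- {i, j}) \<noteq> []" if "i < j" for i j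
    proof -
      have "3 \<le> length fs" by (simp add: 4)
      then have "card ({..<3::nat} - {i, j}) \<le> card {k. k < length fs \<and> k \<in> - {i, j}}"
        by (intro card_mono) auto
      moreover have "card ({..<3::nat} - {i, j}) \<ge> card {..<3::nat} - card {i, j}"
        by (rule diff_card_le_card_Diff) simp
      moreover have "card {i, j} = 2" using that by simp
      ultimately have "0 < card {k. k < length fs \<and> k \<in> - {i, j}}"
        by (simp only: card_lessThan)
      then show ?thesis
        by (metis length_nths list.size(3) less_irrefl)
    qed
    then have "one_cochain z (x # nths fs (- {i, j})) = 0" if "i < j" for i j x
      using that by (auto simp: one_cochain_def split: list.split)
    then show ?thesis
      by (simp add: coboundary_def 4)
  qed (simp_all add: coboundary_def)
qed

definition alternating :: "cochain \<Rightarrow> bool"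
  where "alternating \<sigma> \<longleftrightarrow> (\<forall>us f g vs. \<sigma> (us @ f # g # vs) = - \<sigma> (us @ g # f # vs))"

lemma alternatingD: "alternating \<sigma> \<Longrightarrow> \<sigma> (us @ f # g # vs) = - \<sigma> (us @ g # f # vs)"
  unfolding alternating_def by blast

lemma alternating_interior:
  assumes "alternating \<sigma>"
  shows "alternating (interior f \<sigma>)"
  unfolding alternating_def interior_def
  by (intro allI, rule alternatingD[OF assms, of "f # us" for us, simplified])

lemma alternating_grade_sign:
  assumes "alternating \<sigma>"
  shows "alternating (grade_sign \<sigma>)"
  unfolding alternating_def grade_sign_def
  by (intro allI, subst alternatingD[OF assms]) simp

lemma alternating_one_cochain: "alternating (one_cochain z)"
  by (auto simp: alternating_def one_cochain_def append_eq_Cons_conv split: list.split)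

lemma alternating_unit_cochain: "alternating unit_cochain"
  by (simp add: alternating_def unit_cochain_def)

lemma interior_simps:
  "interior f (\<alpha> + \<beta>) = interior f \<alpha> + interior f \<beta>"
  "interior f (- \<alpha>) = - interior f \<alpha>"
  "interior f (grade_sign \<alpha>) = - grade_sign (interior f \<alpha>)"
  by (auto simp: interior_def grade_sign_def fun_eq_iff)

lemma grade_sign_simps:
  "grade_sign (\<alpha> + \<beta>) = grade_sign \<alpha> + grade_sign \<beta>"
  "grade_sign (- \<alpha>) = - grade_sign \<alpha>"
  "grade_sign (grade_sign \<alpha>) = \<alpha>"
  by (simp_all add: grade_sign_def fun_eq_iff distrib_left mult.assoc[symmetric]
    power_add[symmetric])

lemma wedge_uminus_left: "wedge (- \<alpha>) \<beta> fs = - wedge \<alpha> \<beta> fs"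
  by (induction fs arbitrary: \<alpha> \<beta>) (simp_all add: interior_simps grade_sign_simps)

lemma wedge_uminus_right: "wedge \<alpha> (- \<beta>) fs = - wedge \<alpha> \<beta> fs"
  by (induction fs arbitrary: \<alpha> \<beta>) (simp_all add: interior_simps grade_sign_simps)

lemma wedge_add_left: "wedge (\<alpha> + \<alpha>') \<beta> fs = wedge \<alpha> \<beta> fs + wedge \<alpha>' \<beta> fs"
  by (induction fs arbitrary: \<alpha> \<alpha>' \<beta>)
    (simp_all add: interior_simps grade_sign_simps algebra_simps)

lemma wedge_add_right: "wedge \<alpha> (\<beta> + \<beta>') fs = wedge \<alpha> \<beta> fs + wedge \<alpha> \<beta>' fs"
  by (induction fs arbitrary: \<alpha> \<beta> \<beta>')
    (simp_all add: interior_simps grade_sign_simps algebra_simps)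

lemma wedge_diff_left: "wedge (\<alpha> - \<alpha>') \<beta> fs = wedge \<alpha> \<beta> fs - wedge \<alpha>' \<beta> fs"
  using wedge_add_left[of \<alpha> "- \<alpha>'"] by (simp add: wedge_uminus_left)

lemma wedge_diff_right: "wedge \<alpha> (\<beta> - \<beta>') fs = wedge \<alpha> \<beta> fs - wedge \<alpha> \<beta>' fs"
  using wedge_add_right[of \<alpha> \<beta> "- \<beta>'"] by (simp add: wedge_uminus_right)

lemmas wedge_linear = wedge_uminus_left wedge_uminus_right wedge_add_left wedge_add_right

lemma interior_wedge:
  "interior f (wedge \<alpha> \<beta>) = wedge (interior f \<alpha>) \<beta> + wedge (grade_sign \<alpha>) (interior f \<beta>)"
  by (simp add: interior_def fun_eq_iff)

lemma alternating_interior_swap: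
  "alternating \<sigma> \<Longrightarrow> interior f (interior g \<sigma>) = - interior g (interior f \<sigma>)"
  using alternatingD[of \<sigma> "[]" g f] unfolding interior_def fun_eq_iff fun_Compl_def
  by (metis append_Nil)

lemma alternating_wedge:
  assumes "alternating \<alpha>" "alternating \<beta>"
  shows "alternating (wedge \<alpha> \<beta>)"
proof -
  have "wedge \<alpha> \<beta> (us @ f # g # vs) = - wedge \<alpha> \<beta> (us @ g # f # vs)" for us f g vs
    using assms
  proof (induction us arbitrary: \<alpha> \<beta>)
    case Nil
    then show ?case
      using alternating_interior_swap[of \<alpha> f g] alternating_interior_swap[of \<beta> f g]
      by (simp add: interior_simps grade_sign_simps wedge_linear)
  next
    case (Cons u us)
    then show ?case
      by (simp add: alternating_interior alternating_grade_sign)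
  qed
  then show ?thesis unfolding alternating_def by blast
qed

lemma alternating_wedge_list: "alternating (wedge_list zs)"
  unfolding wedge_list_def
  by (induction zs) (simp_all add: alternating_unit_cochain alternating_wedge alternating_one_cochain)

lemma alternating_span:
  assumes "\<And>\<sigma>. \<sigma> \<in> A \<Longrightarrow> alternating \<sigma>" "\<sigma> \<in> span A"
  shows "alternating \<sigma>"
proof -
  have "subspace (Collect alternating)"
  proof (rule subspaceI)
    show "0 \<in> Collect alternating" by (simp add: alternating_def)
  next
    fix \<sigma> \<tau> :: cochain assume "\<sigma> \<in> Collect alternating" "\<tau> \<in> Collect alternating"
    then have \<sigma>: "alternating \<sigma>" and \<tau>: "alternating \<tau>" by simp_all
    have "(\<sigma> + \<tau>) (us @ f # g # vs) = - (\<sigma> + \<tau>) (us @ g # f # vs)" for us f g vs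
      using alternatingD[OF \<sigma>, of us f g vs] alternatingD[OF \<tau>, of us f g vs]
      unfolding plus_fun_def by linarith
    then show "\<sigma> + \<tau> \<in> Collect alternating"
      unfolding mem_Collect_eq alternating_def by blast
  next
    fix c and \<sigma> :: cochain assume "\<sigma> \<in> Collect alternating"
    then have \<sigma>: "alternating \<sigma>" by simp
    have "(c *\<^sub>R \<sigma>) (us @ f # g # vs) = - (c *\<^sub>R \<sigma>) (us @ g # f # vs)" for us f g vs
      by (simp only: scaleR_fun_def alternatingD[OF \<sigma>, of us f g vs] scaleR_minus_right)
    then show "c *\<^sub>R \<sigma> \<in> Collect alternating"
      unfolding mem_Collect_eq alternating_def by blast
  qed
  then show ?thesis
    using assms span_minimal[of A "Collect alternating"] by auto
qed

lemma alternating_exterior_component: "\<sigma> \<in> exterior_component k \<Longrightarrow> alternating \<sigma>"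
  unfolding exterior_component_def
  by (erule alternating_span[rotated]) (auto simp: alternating_wedge_list)

lemma alternating_cochains: "\<sigma> \<in> cochains m w \<Longrightarrow> alternating \<sigma>"
  unfolding cochains_def
  by (erule alternating_span[rotated]) (auto simp: alternating_exterior_component)

lemma coboundary_uminus: "coboundary (- \<sigma>) = - coboundary \<sigma>"
  by (simp add: fun_eq_iff coboundary_def sum_negf)

lemma coboundary_add: "coboundary (\<sigma> + \<tau>) = coboundary \<sigma> + coboundary \<tau>"
  by (simp add: fun_eq_iff coboundary_def sum.distrib algebra_simps)

lemma coboundary_scaleR: "coboundary (c *\<^sub>R \<sigma>) = c *\<^sub>R coboundary \<sigma>"
  by (simp add: fun_eq_iff coboundary_def scaleR_fun_def sum_distrib_left mult.left_commute)

lemma nths_Compl_singleton: "nths fs (- {k}) = take k fs @ drop (Suc k) fs"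
proof (induction fs arbitrary: k)
  case (Cons f fs)
  show ?case
  proof (cases k)
    case 0
    then show ?thesis by (simp add: nths_Cons nths_all)
  next
    case (Suc i)
    have "{j. Suc j \<in> - {Suc i}} = - {i}" by auto
    then show ?thesis unfolding Suc nths_Cons by (simp only: Cons.IH) simp
  qed
qed simp

lemma alternating_move:
  assumes "alternating \<sigma>"
  shows "\<sigma> (x # us @ vs) = (- 1) ^ length us * \<sigma> (us @ x # vs)"
proof (induction us arbitrary: vs rule: rev_induct)
  case (snoc u us)
  have "\<sigma> (us @ x # u # vs) = - \<sigma> (us @ u # x # vs)"
    by (rule alternatingD[OF assms])
  then show ?case using snoc[of "u # vs"] by simp
qed simp

lemma coboundary_grade_sign: "coboundary (grade_sign \<sigma>) = - grade_sign (coboundary \<sigma>)"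
proof
  fix fs :: "ham list"
  have len: "length (nths fs (- {i, j})) + 2 = length fs" if "i < j" "j < length fs" for i j
  proof -
    have "{k. k < length fs \<and> k \<in> - {i, j}} = {..<length fs} - {i, j}" by auto
    then show ?thesis using that by (simp add: length_nths card_Diff_subset)
  qed
  have "coboundary (grade_sign \<sigma>) fs = (\<Sum>j<length fs. \<Sum>i<j. - ((- 1) ^ length fs *
    ((- 1) ^ (i + j) * \<sigma> (bracket (fs ! i) (fs ! j) # nths fs (- {i, j})))))"
    unfolding coboundary_def
  proof (intro sum.cong refl)
    fix i j assume "j \<in> {..<length fs}" "i \<in> {..<j}"
    then have "length fs = Suc (Suc (length (nths fs (- {i, j}))))" using len[of i j] by simp
    then have "(- 1) ^ length fs = ((- 1) ^ length (nths fs (- {i, j})) :: real)" by simp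
    then show "(- 1) ^ (i + j) * grade_sign \<sigma> (bracket (fs ! i) (fs ! j) # nths fs (- {i, j})) =
      - ((- 1) ^ length fs * ((- 1) ^ (i + j) * \<sigma> (bracket (fs ! i) (fs ! j) # nths fs (- {i, j}))))"
      by (simp add: grade_sign_def)
  qed
  also have "\<dots> = (- grade_sign (coboundary \<sigma>)) fs"
    by (simp add: grade_sign_def coboundary_def sum_negf sum_distrib_left)
  finally show "coboundary (grade_sign \<sigma>) fs = (- grade_sign (coboundary \<sigma>)) fs" .
qed

definition lie_sum :: "ham \<Rightarrow> cochain \<Rightarrow> cochain"
  where "lie_sum f \<sigma> fs = (\<Sum>k<length fs. \<sigma> (fs[k := bracket f (fs ! k)]))"

lemma lie_sum_Cons:
  "lie_sum f \<sigma> (g # gs) = \<sigma> (bracket f g # gs) + lie_sum f (interior g \<sigma>) gs"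
  by (simp add: lie_sum_def interior_def sum.lessThan_Suc_shift del: sum.lessThan_Suc)

lemma lie_sum_grade_sign: "lie_sum f (grade_sign \<sigma>) = grade_sign (lie_sum f \<sigma>)"
  by (simp add: fun_eq_iff lie_sum_def grade_sign_def sum_distrib_left)

lemma lie_sum_add: "lie_sum f (\<sigma> + \<tau>) = lie_sum f \<sigma> + lie_sum f \<tau>"
  by (simp add: fun_eq_iff lie_sum_def sum.distrib)

lemma interior_lie_sum:
  "interior g (lie_sum f \<sigma>) = interior (bracket f g) \<sigma> + lie_sum f (interior g \<sigma>)"
  unfolding interior_def fun_eq_iff plus_fun_def lie_sum_Cons by simp

lemma lie_sum_wedge:
  "lie_sum f (wedge \<alpha> \<beta>) fs = wedge (lie_sum f \<alpha>) \<beta> fs + wedge \<alpha> (lie_sum f \<beta>) fs"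
proof (induction fs arbitrary: \<alpha> \<beta>)
  case Nil
  show ?case by (simp add: lie_sum_def)
next
  case (Cons g gs)
  show ?case
    by (simp add: lie_sum_Cons interior_wedge lie_sum_add Cons.IH lie_sum_grade_sign
      interior_lie_sum wedge_linear)
qed

lemma coboundary_Cons:
  assumes "alternating \<sigma>"
  shows "coboundary \<sigma> (f # fs) = - lie_sum f \<sigma> fs - coboundary (interior f \<sigma>) fs"
proof -
  let ?n = "length fs"
  have nths0: "nths (f # fs) (- {0, Suc j}) = nths fs (- {j})" for j
  proof -
    have "{k. Suc k \<in> - {0, Suc j}} = - {j}" by auto
    then show ?thesis by (simp add: nths_Cons)
  qed
  have nthsS: "nths (f # fs) (- {Suc i, Suc j}) = f # nths fs (- {i, j})" for i j
  proof -
    have "{k. Suc k \<in> - {Suc i, Suc j}} = - {i, j}" by auto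
    then show ?thesis by (simp add: nths_Cons)
  qed
  have swap: "\<sigma> (x # f # gs) = - \<sigma> (f # x # gs)" for x gs
    using alternatingD[OF assms, of "[]" x f gs] by (simp only: append_Nil)
  have move: "(- 1) ^ j * \<sigma> (x # nths fs (- {j})) = \<sigma> (fs[j := x])" if "j < ?n" for j x
    using that alternating_move[OF assms, of x "take j fs" "drop (Suc j) fs"]
    by (simp add: nths_Compl_singleton upd_conv_take_nth_drop flip: mult.assoc power_add)
  have "coboundary \<sigma> (f # fs) =
    (\<Sum>j<?n. - ((- 1) ^ j * \<sigma> (bracket f (fs ! j) # nths fs (- {j}))) +
      (\<Sum>i<j. (- 1) ^ (i + j) * \<sigma> (bracket (fs ! i) (fs ! j) # f # nths fs (- {i, j}))))"
    unfolding coboundary_def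
    by (simp add: sum.lessThan_Suc_shift nths0 nthsS del: sum.lessThan_Suc)
  also have "\<dots> = - lie_sum f \<sigma> fs - coboundary (interior f \<sigma>) fs"
    by (simp add: sum_subtractf sum_negf move swap coboundary_def interior_def lie_sum_def)
  finally show ?thesis .
qed

lemma interior_coboundary:
  "alternating \<sigma> \<Longrightarrow>
    interior f (coboundary \<sigma>) = - lie_sum f \<sigma> - coboundary (interior f \<sigma>)"
  unfolding interior_def fun_eq_iff by (simp add: coboundary_Cons interior_def)

text \<open>For \<open>\<alpha>\<close> of degree \<open>p\<close>, \<open>grade_sign \<alpha>\<close> is \<open>(-1)\<^sup>p \<alpha>\<close>.\<close>

lemma coboundary_wedge:
  assumes "alternating \<alpha>" "alternating \<beta>"
  shows "coboundary (wedge \<alpha> \<beta>) =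
    wedge (coboundary \<alpha>) \<beta> + wedge (grade_sign \<alpha>) (coboundary \<beta>)"
proof
  fix fs :: "ham list"
  from assms show "coboundary (wedge \<alpha> \<beta>) fs =
    (wedge (coboundary \<alpha>) \<beta> + wedge (grade_sign \<alpha>) (coboundary \<beta>)) fs"
  proof (induction fs arbitrary: \<alpha> \<beta>)
    case Nil
    show ?case by (simp add: coboundary_def)
  next
    case (Cons f fs)
    show ?case
      using Cons.prems
      by (simp add: coboundary_Cons alternating_wedge interior_wedge coboundary_add
        Cons.IH alternating_interior alternating_grade_sign lie_sum_wedge interior_coboundary
        interior_simps grade_sign_simps coboundary_grade_sign wedge_linear wedge_diff_left
        wedge_diff_right wedge_uminus_left[unfolded fun_Compl_def])
  qed
qed


section \<open>Cochains relative to the symplectic group\<close>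

text \<open>
  The momentum map of the linear symplectic action sends the symplectic Lie algebra onto the
  homogeneous quadratic polynomials, so the interior products are taken with exactly these.
\<close>

definition relative_cochains :: "nat \<Rightarrow> nat \<Rightarrow> cochain set"
  where "relative_cochains m w =
    {\<sigma> \<in> cochains m w. \<forall>q \<in> homogeneous 2. interior q \<sigma> = 0 \<and> interior q (coboundary \<sigma>) = 0}"

definition relative_cocycles :: "nat \<Rightarrow> nat \<Rightarrow> cochain set"
  where "relative_cocycles m w = {\<sigma> \<in> relative_cochains m w. coboundary \<sigma> = 0}"

definition relative_coboundaries :: "nat \<Rightarrow> nat \<Rightarrow> cochain set"
  where "relative_coboundaries m w =
    (case m of 0 \<Rightarrow> {0} | Suc n \<Rightarrow> coboundary ` relative_cochains n w)"

text \<open>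
  \<open>has_dim V n\<close> and \<open>has_quotient_dim V W n\<close> include finite-dimensionality, which \<open>dim\<close> does not
  detect.  In the latter, \<open>H\<close> is a set of representatives of a basis of \<open>V / W\<close>.
\<close>

definition has_dim :: "'a::real_vector set \<Rightarrow> nat \<Rightarrow> bool"
  where "has_dim V n \<longleftrightarrow> (\<exists>B. finite B \<and> independent B \<and> span B = V \<and> card B = n)"

definition has_quotient_dim :: "'a::real_vector set \<Rightarrow> 'a set \<Rightarrow> nat \<Rightarrow> bool"
  where "has_quotient_dim V W n \<longleftrightarrow>
    subspace V \<and> subspace W \<and> W \<subseteq> V \<and>
    (\<exists>H. finite H \<and> card H = n \<and> H \<subseteq> V \<and>
      (\<forall>v\<in>V. \<exists>!c. (\<forall>h. h \<notin> H \<longrightarrow> c h = 0) \<and> v - (\<Sum>h\<in>H. c h *\<^sub>R h) \<in> W))"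

definition has_betti_number :: "nat \<Rightarrow> nat \<Rightarrow> nat \<Rightarrow> bool"
  where "has_betti_number m w b \<longleftrightarrow>
    has_quotient_dim (relative_cocycles m w) (relative_coboundaries m w) b"

end

theory Submission
  imports Defs "HOL-Library.FuncSet"
begin

text \<open>
  Write \<open>V\<^sub>l\<close> for the homogeneous polynomials of degree \<open>l\<close>.  A relative cochain of weight \<open>4\<close> is an
  alternating form, invariant under the quadratic Hamiltonians, that sees only arguments of degree
  at least \<open>3\<close>.  Each argument of degree \<open>l\<close> carries weight \<open>l - 2 \<ge> 1\<close>, so the only types are \<open>V\<^sub>6\<close> in
  degree one, \<open>V\<^sub>3, V\<^sub>5\<close> and \<open>V\<^sub>4, V\<^sub>4\<close> in degree two, \<open>V\<^sub>3, V\<^sub>3, V\<^sub>4\<close> in degree three and four cubics in degree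
  four.  In degree five nothing is left, so every relative \<open>4\<close>-cochain is a cocycle.

  To work with functions instead of spans of wedge products, \<open>cochains_iff_form\<close> identifies the
  cochains with the multilinear alternating functions that are graded by total degree.  Cartan's
  formula then turns the relative condition into invariance (\<open>relative_cochains_iff\<close>), and the Jacobi
  identity shows that the coboundary preserves it.

  The dimensions are bounded above by evaluating at powers.  Since \<open>x\<^sub>1\<^sup>k\<close> generates \<open>V\<^sub>k\<close> under the
  symplectic Lie algebra and \<open>x\<^sub>4\<^sup>l\<close> generates \<open>V\<^sub>l\<close> under the stabiliser of \<open>x\<^sub>1\<close>, an invariant form is
  determined by its restriction to \<open>x\<^sub>1\<^sup>k, x\<^sub>4\<^sup>l\<close> in the first two slots.  For \<open>k = l\<close> the
  restriction, as a form in the remaining arguments, is still invariant under \<open>x\<^sub>1 x\<^sub>4\<close> and the copy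
  of \<open>sl\<^sub>2\<close> spanned by \<open>x\<^sub>2\<^sup>2, x\<^sub>2 x\<^sub>3, x\<^sub>3\<^sup>2\<close>.  In degrees one and two the values at powers vanish.  In
  degree three a single value is left, at \<open>x\<^sub>1\<^sup>3, x\<^sub>4\<^sup>3, x\<^sub>1\<^sup>2 x\<^sub>4\<^sup>2\<close>.  In degree four there are five values,
  subject to two relations that come from the rest of the stabiliser of \<open>x\<^sub>1\<close>
  (\<open>relative_cochain_4_4_eq_0\<close>).

  The bounds \<open>1\<close> and \<open>3\<close> are attained by forms from classical invariant theory.  The contraction of
  two cubics and a quartic along the graph with edge multiplicities \<open>1, 2, 2\<close> gives a form
  \<open>degree3_generator\<close>.  Its coboundary, the square of the symplectic form on \<open>V\<^sub>3\<close> and the third power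
  of Cayley's Omega process span degree four (\<open>three_coordinates_4_4\<close>).  Because that coboundary is
  nonzero, degree three has no nonzero cocycles, and in degree four a two-dimensional quotient remains.
\<close>

section \<open>Derivations and the Poisson bracket on polynomials\<close>

lemma UNIV_four: "(UNIV :: 4 set) = {1, 2, 3, 4}"
proof -
  have "card {1, 2, 3, 4 :: 4} = card (UNIV :: 4 set)" by simp
  then show ?thesis by (metis card_subset_eq finite subset_UNIV)
qed

lemma four_cases: "(i :: 4) = 1 \<or> i = 2 \<or> i = 3 \<or> i = 4"
  using UNIV_four by blast

lemma lookup_scaleR [simp]:
  "Poly_Mapping.lookup (c *\<^sub>R p) a = c * Poly_Mapping.lookup (p :: 'a \<Rightarrow>\<^sub>0 real) a"
  by (simp add: scaleR_poly_mapping.rep_eq)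

lemma scaleR_eq_mult: "c *\<^sub>R p = Poly_Mapping.single 0 c * (p :: poly4)"
proof -
  have "c *\<^sub>R p = Poly_Mapping.map ((*) c) p"
    by (intro poly_mapping_eqI) (simp add: map.rep_eq when_def)
  then show ?thesis by (simp add: mult_map_scale_conv_mult)
qed

lemma mult_scaleR_poly4 [simp]:
  "(c *\<^sub>R p) * q = c *\<^sub>R (p * (q :: poly4))" "p * (c *\<^sub>R q) = c *\<^sub>R (p * (q :: poly4))"
  by (simp_all add: scaleR_eq_mult ac_simps)

lemma scaleR_single [simp]:
  "c *\<^sub>R Poly_Mapping.single a r = Poly_Mapping.single a (c * r :: real)"
  by (intro poly_mapping_eqI) (simp add: lookup_single when_def)

lemma poly_sum_monomials:
  "(p :: 'a \<Rightarrow>\<^sub>0 real) =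
    (\<Sum>a\<in>Poly_Mapping.keys p. Poly_Mapping.single a (Poly_Mapping.lookup p a))"
proof (intro poly_mapping_eqI)
  fix b
  show "Poly_Mapping.lookup p b =
    Poly_Mapping.lookup (\<Sum>a\<in>Poly_Mapping.keys p. Poly_Mapping.single a (Poly_Mapping.lookup p a)) b"
    by (cases "b \<in> Poly_Mapping.keys p")
      (simp_all add: lookup_sum lookup_single when_def in_keys_iff)
qed

lemma poly_induct [case_names single add]:
  assumes "\<And>a c. P (Poly_Mapping.single a c)" "\<And>p q. P p \<Longrightarrow> P q \<Longrightarrow> P (p + q)"
  shows "P (p :: 'a \<Rightarrow>\<^sub>0 real)"
proof -
  have "P (\<Sum>a\<in>A. Poly_Mapping.single a (Poly_Mapping.lookup p a))" if "finite A" for A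
    using that
  proof (induction A)
    case empty
    then show ?case using assms(1)[of _ 0] by simp
  next
    case (insert a A)
    then show ?case using assms by simp
  qed
  then show ?thesis by (subst poly_sum_monomials) simp
qed

lemma lookup_partial_deriv:
  "Poly_Mapping.lookup (partial_deriv i p) b =
    real (Suc (Poly_Mapping.lookup b i)) * Poly_Mapping.lookup p (b + Poly_Mapping.single i 1)"
proof -
  have *: "Poly_Mapping.lookup (Poly_Mapping.single (a - Poly_Mapping.single i 1)
        (real (Poly_Mapping.lookup a i) * Poly_Mapping.lookup p a)) b =
      (if a = b + Poly_Mapping.single i 1
       then real (Suc (Poly_Mapping.lookup b i)) * Poly_Mapping.lookup p a else 0)" for a
  proof (cases "a = b + Poly_Mapping.single i 1")
    case True
    then show ?thesis by (simp add: lookup_add)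
  next
    case False
    have "Poly_Mapping.lookup a i = 0" if "a - Poly_Mapping.single i 1 = b"
    proof (rule ccontr)
      assume "Poly_Mapping.lookup a i \<noteq> 0"
      then have "a = a - Poly_Mapping.single i 1 + Poly_Mapping.single i 1"
        by (intro poly_mapping_eqI) (auto simp: lookup_add lookup_minus lookup_single when_def)
      with that False show False by simp
    qed
    then show ?thesis using False by (auto simp: lookup_single when_def)
  qed
  show ?thesis
    unfolding partial_deriv_def lookup_sum *
    by (cases "b + Poly_Mapping.single i 1 \<in> Poly_Mapping.keys p") (simp_all add: in_keys_iff)
qed

lemma partial_deriv_linear [simp]:
  "partial_deriv i (p + q) = partial_deriv i p + partial_deriv i q"
  "partial_deriv i (p - q) = partial_deriv i p - partial_deriv i q"
  "partial_deriv i (- p) = - partial_deriv i p"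
  "partial_deriv i (c *\<^sub>R p) = c *\<^sub>R partial_deriv i p"
  "partial_deriv i 0 = 0"
  by (intro poly_mapping_eqI; simp add: lookup_partial_deriv lookup_add lookup_minus algebra_simps)+

lemma partial_deriv_single:
  "partial_deriv i (Poly_Mapping.single a c) =
    Poly_Mapping.single (a - Poly_Mapping.single i 1) (real (Poly_Mapping.lookup a i) * c)"
  by (cases "c = 0") (simp_all add: partial_deriv_def)

lemma partial_deriv_mult:
  "partial_deriv i (p * q) = partial_deriv i p * q + p * partial_deriv i q"
proof (induction p rule: poly_induct)
  case (single a c)
  show ?case
  proof (induction q rule: poly_induct)
    case (single b d)
    have 1: "a - Poly_Mapping.single i 1 + b = a + b - Poly_Mapping.single i 1"
      if "Poly_Mapping.lookup a i \<noteq> 0" for a b :: "4 \<Rightarrow>\<^sub>0 nat"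
    proof (intro poly_mapping_eqI)
      fix k
      show "Poly_Mapping.lookup (a - Poly_Mapping.single i 1 + b) k =
        Poly_Mapping.lookup (a + b - Poly_Mapping.single i 1) k"
        using that by (cases "k = i") (simp_all add: lookup_add lookup_minus lookup_single)
    qed
    have 2: "a + (b - Poly_Mapping.single i 1) = a + b - Poly_Mapping.single i 1"
      if "Poly_Mapping.lookup b i \<noteq> 0"
      using 1[OF that, of a] by (simp add: add.commute)
    show ?case
      using 1[of a b] 2
      by (cases "Poly_Mapping.lookup a i = 0"; cases "Poly_Mapping.lookup b i = 0")
        (simp_all add: mult_single partial_deriv_single lookup_add distrib_right
          mult.assoc mult.left_commute[of c] single_add)
  next
    case (add q r)
    then show ?case by (simp add: algebra_simps)
  qed
next
  case (add p r)
  then show ?case by (simp add: algebra_simps)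
qed

lemma partial_deriv_commute:
  "partial_deriv i (partial_deriv j p) = partial_deriv j (partial_deriv i p)"
  by (intro poly_mapping_eqI)
    (auto simp: lookup_partial_deriv lookup_add lookup_single when_def algebra_simps)

lemma poisson_linear [simp]:
  "poisson (f + f') g = poisson f g + poisson f' g"
  "poisson f (g + g') = poisson f g + poisson f g'"
  "poisson (c *\<^sub>R f) g = c *\<^sub>R poisson f g"
  "poisson f (c *\<^sub>R g) = c *\<^sub>R poisson f g"
  "poisson 0 g = 0" "poisson f 0 = 0"
  by (simp_all add: poisson_def algebra_simps)

lemma poisson_antisym: "poisson f g = - poisson g f"
  by (simp add: poisson_def algebra_simps)

lemma partial_deriv_poisson:
  "partial_deriv i (poisson f g) = poisson (partial_deriv i f) g + poisson f (partial_deriv i g)"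
  unfolding poisson_def partial_deriv_linear partial_deriv_mult
    partial_deriv_commute[of i 1] partial_deriv_commute[of i 2]
    partial_deriv_commute[of i 3] partial_deriv_commute[of i 4]
  by (simp add: algebra_simps)

lemma poisson_mult_right: "poisson f (g * h) = poisson f g * h + g * poisson f h"
  unfolding poisson_def partial_deriv_mult by (simp add: algebra_simps)

lemma poisson_diff_right: "poisson f (g - h) = poisson f g - poisson f h"
  by (simp add: poisson_def algebra_simps)

text \<open>
  The Jacobi identity, in the form that \<open>{q, _}\<close> is a derivation of the bracket.  Writing the
  outer \<open>{q, _}\<close> as a derivation of the products in \<open>{f, g}\<close> leaves only the brackets with
  partial derivatives, and those of \<open>q\<close> cancel in pairs.
\<close>

lemma poisson_jacobi:
  "poisson q (poisson f g) = poisson (poisson q f) g + poisson f (poisson q g)"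
proof -
  have 1: "poisson q (poisson f g) =
      poisson q (partial_deriv 1 f) * partial_deriv 4 g + partial_deriv 1 f * poisson q (partial_deriv 4 g)
    + (poisson q (partial_deriv 2 f) * partial_deriv 3 g + partial_deriv 2 f * poisson q (partial_deriv 3 g))
    - (poisson q (partial_deriv 3 f) * partial_deriv 2 g + partial_deriv 3 f * poisson q (partial_deriv 2 g))
    - (poisson q (partial_deriv 4 f) * partial_deriv 1 g + partial_deriv 4 f * poisson q (partial_deriv 1 g))"
    unfolding poisson_def[of f g] by (simp add: poisson_diff_right poisson_mult_right)
  have 2: "poisson (poisson q f) g =
      partial_deriv 1 (poisson q f) * partial_deriv 4 g + partial_deriv 2 (poisson q f) * partial_deriv 3 g
    - partial_deriv 3 (poisson q f) * partial_deriv 2 g - partial_deriv 4 (poisson q f) * partial_deriv 1 g"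
    by (simp add: poisson_def)
  have 3: "poisson f (poisson q g) =
      partial_deriv 1 f * partial_deriv 4 (poisson q g) + partial_deriv 2 f * partial_deriv 3 (poisson q g)
    - partial_deriv 3 f * partial_deriv 2 (poisson q g) - partial_deriv 4 f * partial_deriv 1 (poisson q g)"
    by (simp add: poisson_def)
  have 4: "0 = poisson (partial_deriv 1 q) f * partial_deriv 4 g + poisson (partial_deriv 2 q) f * partial_deriv 3 g
    - poisson (partial_deriv 3 q) f * partial_deriv 2 g - poisson (partial_deriv 4 q) f * partial_deriv 1 g
    + (partial_deriv 1 f * poisson (partial_deriv 4 q) g + partial_deriv 2 f * poisson (partial_deriv 3 q) g
    - partial_deriv 3 f * poisson (partial_deriv 2 q) g - partial_deriv 4 f * poisson (partial_deriv 1 q) g)"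
    unfolding poisson_def
      partial_deriv_commute[of 2 1] partial_deriv_commute[of 3 1] partial_deriv_commute[of 3 2]
      partial_deriv_commute[of 4 1] partial_deriv_commute[of 4 2] partial_deriv_commute[of 4 3]
    by (simp add: algebra_simps)
  show ?thesis
    unfolding 1 2 3 partial_deriv_poisson using 4 by (simp add: algebra_simps)
qed

section \<open>Homogeneous Hamiltonians and monomials\<close>

lemma linear_potential: "linear potential"
  by (rule linearI) (simp_all add: plus_ham.rep_eq scaleR_ham.rep_eq)

lemma linear_bracket_right: "linear (bracket f)"
  by (rule linearI) (simp_all add: bracket.rep_eq plus_ham.rep_eq scaleR_ham.rep_eq flip: potential_inject)

lemma linear_bracket_left: "linear (\<lambda>f. bracket f g)"
  by (rule linearI) (simp_all add: bracket.rep_eq plus_ham.rep_eq scaleR_ham.rep_eq flip: potential_inject)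

lemma bracket_antisym: "bracket f g = - bracket g f"
  using poisson_antisym[of "potential f" "potential g"]
  by (metis bracket.rep_eq uminus_ham.rep_eq potential_inject)

lemma bracket_jacobi: "bracket q (bracket f g) = bracket (bracket q f) g + bracket f (bracket q g)"
  using poisson_jacobi[of "potential q" "potential f" "potential g"]
  by (metis bracket.rep_eq plus_ham.rep_eq potential_inject)

lemma mdeg_single [simp]: "mdeg (Poly_Mapping.single i n) = n"
  by (simp add: mdeg_def lookup_single when_def)

definition homogeneous_poly :: "nat \<Rightarrow> poly4 \<Rightarrow> bool"
  where "homogeneous_poly l p \<longleftrightarrow> (\<forall>a\<in>Poly_Mapping.keys p. mdeg a = l)"

lemma homogeneous_poly_partial_deriv:
  assumes "homogeneous_poly l p"
  shows "homogeneous_poly (l - 1) (partial_deriv i p)"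
  unfolding homogeneous_poly_def
proof
  fix b assume "b \<in> Poly_Mapping.keys (partial_deriv i p)"
  then have "b + Poly_Mapping.single i 1 \<in> Poly_Mapping.keys p"
    by (simp add: in_keys_iff lookup_partial_deriv)
  then have "mdeg (b + Poly_Mapping.single i 1) = l"
    using assms by (simp add: homogeneous_poly_def)
  then show "mdeg b = l - 1"
    by (auto simp: mdeg_add)
qed

lemma homogeneous_poly_0_partial_deriv:
  assumes "homogeneous_poly 0 p"
  shows "partial_deriv i p = 0"
proof -
  have "Poly_Mapping.keys (partial_deriv i p) = {}"
  proof (rule ccontr)
    assume "Poly_Mapping.keys (partial_deriv i p) \<noteq> {}"
    then obtain b where "b \<in> Poly_Mapping.keys (partial_deriv i p)" by blast
    then have "b + Poly_Mapping.single i 1 \<in> Poly_Mapping.keys p"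
      by (simp add: in_keys_iff lookup_partial_deriv)
    then have "mdeg (b + Poly_Mapping.single i 1) = 0"
      using assms by (simp add: homogeneous_poly_def)
    then show False
      by (auto simp: mdeg_add)
  qed
  then show ?thesis by simp
qed

lemma homogeneous_poly_add:
  "homogeneous_poly l p \<Longrightarrow> homogeneous_poly l q \<Longrightarrow> homogeneous_poly l (p + q)"
  using keys_add[of p q] unfolding homogeneous_poly_def by blast

lemma homogeneous_poly_diff:
  "homogeneous_poly l p \<Longrightarrow> homogeneous_poly l q \<Longrightarrow> homogeneous_poly l (p - q)"
  using keys_diff[of p q] unfolding homogeneous_poly_def by blast

lemma homogeneous_poly_mult:
  "homogeneous_poly k p \<Longrightarrow> homogeneous_poly l q \<Longrightarrow> homogeneous_poly (k + l) (p * q)"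
  using keys_mult[of p q] unfolding homogeneous_poly_def by (fastforce simp: mdeg_add)

lemma homogeneous_poly_poisson:
  assumes "homogeneous_poly k f" "homogeneous_poly l g" "1 \<le> k" "1 \<le> l"
  shows "homogeneous_poly (k + l - 2) (poisson f g)"
proof -
  have "k + l - 2 = (k - 1) + (l - 1)" using assms by simp
  then show ?thesis
    unfolding poisson_def
    by (simp only:) (intro homogeneous_poly_add homogeneous_poly_diff homogeneous_poly_mult
        homogeneous_poly_partial_deriv assms(1,2))
qed

lemma homogeneous_iff: "f \<in> homogeneous l \<longleftrightarrow> homogeneous_poly l (potential f)"
  by (simp add: homogeneous_def homogeneous_poly_def)

lemma homogeneous_below_2:
  assumes "f \<in> homogeneous l" "l < 2"
  shows "f = 0"
proof -
  have "Poly_Mapping.keys (potential f) = {}"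
    using assms potential[of f] by (fastforce simp: homogeneous_def)
  then show ?thesis by (simp add: zero_ham.rep_eq flip: potential_inject)
qed

lemma subspace_homogeneous: "subspace (homogeneous l)"
proof (rule subspaceI)
  show "0 \<in> homogeneous l" by (simp add: homogeneous_def zero_ham.rep_eq)
  show "f + g \<in> homogeneous l" if "f \<in> homogeneous l" "g \<in> homogeneous l" for f g
    using that by (simp add: homogeneous_iff plus_ham.rep_eq homogeneous_poly_add)
  show "c *\<^sub>R f \<in> homogeneous l" if "f \<in> homogeneous l" for c f
    using that by (simp add: homogeneous_def scaleR_ham.rep_eq in_keys_iff)
qed

lemma bracket_homogeneous:
  assumes "f \<in> homogeneous k" "g \<in> homogeneous l"
  shows "bracket f g \<in> homogeneous (k + l - 2)"
proof (cases "k < 2 \<or> l < 2")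
  case True
  then have "f = 0 \<or> g = 0" using assms homogeneous_below_2 by blast
  then have "bracket f g = 0"
    using linear_0[OF linear_bracket_left] linear_0[OF linear_bracket_right] by auto
  then show ?thesis using subspace_0[OF subspace_homogeneous] by simp
next
  case False
  then show ?thesis
    using assms homogeneous_poly_poisson by (simp add: homogeneous_iff bracket.rep_eq)
qed

lemma bracket_quadratic:
  "q \<in> homogeneous 2 \<Longrightarrow> f \<in> homogeneous l \<Longrightarrow> bracket q f \<in> homogeneous l"
  using bracket_homogeneous[of q 2 f l] by simp

text \<open>
  Defined on all exponent vectors, so that a bracket of two monomials can be written by adding and
  subtracting exponents; the terms that fall below degree \<open>2\<close> always have coefficient \<open>0\<close>.
\<close>

lift_definition monom :: "(4 \<Rightarrow>\<^sub>0 nat) \<Rightarrow> ham"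
  is "\<lambda>a. if 2 \<le> mdeg a then Poly_Mapping.single a 1 else 0"
  by (auto split: if_splits)

definition coefficient :: "(4 \<Rightarrow>\<^sub>0 nat) \<Rightarrow> ham \<Rightarrow> real"
  where "coefficient a f = Poly_Mapping.lookup (potential f) a"

lemma linear_coefficient: "linear (coefficient a)"
  by (rule linearI) (simp_all add: coefficient_def plus_ham.rep_eq scaleR_ham.rep_eq lookup_add)

lemma monom_homogeneous: "monom a \<in> homogeneous (mdeg a)"
  by (simp add: homogeneous_def monom.rep_eq)

lemma ham_sum_monomials:
  "f = (\<Sum>a\<in>Poly_Mapping.keys (potential f). coefficient a f *\<^sub>R monom a)"
proof -
  have "potential (coefficient a f *\<^sub>R monom a) = Poly_Mapping.single a (Poly_Mapping.lookup (potential f) a)"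
    if "a \<in> Poly_Mapping.keys (potential f)" for a
    using that potential[of f] by (simp add: scaleR_ham.rep_eq monom.rep_eq coefficient_def)
  then have "potential (\<Sum>a\<in>Poly_Mapping.keys (potential f). coefficient a f *\<^sub>R monom a) =
    (\<Sum>a\<in>Poly_Mapping.keys (potential f). Poly_Mapping.single a (Poly_Mapping.lookup (potential f) a))"
    by (simp add: linear_sum[OF linear_potential])
  then show ?thesis by (metis poly_sum_monomials potential_inject)
qed

lemma homogeneous_span_monomials: "homogeneous l \<subseteq> span (monom ` {a. mdeg a = l})"
proof
  fix f assume f: "f \<in> homogeneous l"
  have "(\<Sum>a\<in>Poly_Mapping.keys (potential f). coefficient a f *\<^sub>R monom a)
      \<in> span (monom ` {a. mdeg a = l})"
    using f by (intro span_sum span_scale span_base) (auto simp: homogeneous_def)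
  then show "f \<in> span (monom ` {a. mdeg a = l})" by (simp flip: ham_sum_monomials)
qed

section \<open>Cochains as graded alternating forms\<close>

definition multilinear :: "cochain \<Rightarrow> bool"
  where "multilinear \<sigma> \<longleftrightarrow> (\<forall>us vs. linear (\<lambda>f. \<sigma> (us @ f # vs)))"

text \<open>
  The total degree \<open>s\<close> is an integer so that inserting an argument of degree \<open>l\<close> simply
  changes it to \<open>s - l\<close>.  A form with \<open>m\<close> arguments of total degree \<open>s\<close> has weight \<open>s - 2 * m\<close>.
\<close>

definition graded :: "int \<Rightarrow> cochain \<Rightarrow> bool"
  where "graded s \<sigma> \<longleftrightarrow>
    (\<forall>fs ls. list_all2 (\<lambda>f l. f \<in> homogeneous l) fs ls \<longrightarrow> int (sum_list ls) \<noteq> s \<longrightarrow> \<sigma> fs = 0)"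

definition form :: "nat \<Rightarrow> int \<Rightarrow> cochain \<Rightarrow> bool"
  where "form m s \<sigma> \<longleftrightarrow>
    alternating \<sigma> \<and> multilinear \<sigma> \<and> graded s \<sigma> \<and> (\<forall>fs. length fs \<noteq> m \<longrightarrow> \<sigma> fs = 0)"

lemma multilinear_linear: "multilinear \<sigma> \<Longrightarrow> linear (\<lambda>f. \<sigma> (us @ f # vs))"
  by (simp add: multilinear_def)

lemma multilinear_linear_Cons: "multilinear \<sigma> \<Longrightarrow> linear (\<lambda>f. \<sigma> (f # vs))"
  using multilinear_linear[of \<sigma> "[]"] by simp

lemma multilinear_interior: "multilinear \<sigma> \<Longrightarrow> multilinear (interior f \<sigma>)"
  using multilinear_linear[of \<sigma> "f # us" for us] by (simp add: multilinear_def interior_def)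

lemma gradedD:
  "graded s \<sigma> \<Longrightarrow> list_all2 (\<lambda>f l. f \<in> homogeneous l) fs ls \<Longrightarrow> int (sum_list ls) \<noteq> s \<Longrightarrow> \<sigma> fs = 0"
  unfolding graded_def by blast

lemma graded_interior:
  assumes "graded s \<sigma>" "f \<in> homogeneous l"
  shows "graded (s - int l) (interior f \<sigma>)"
  unfolding graded_def
proof (intro allI impI)
  fix fs ls assume "list_all2 (\<lambda>f l. f \<in> homogeneous l) fs ls" "int (sum_list ls) \<noteq> s - int l"
  then show "interior f \<sigma> fs = 0"
    using gradedD[OF assms(1), of "f # fs" "l # ls"] assms(2) by (simp add: interior_def)
qed

lemma form_interior:
  assumes "form (Suc m) s \<sigma>" "f \<in> homogeneous l"
  shows "form m (s - int l) (interior f \<sigma>)"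
proof -
  have "interior f \<sigma> fs = 0" if "length fs \<noteq> m" for fs
    using assms(1) that by (simp add: form_def interior_def)
  then show ?thesis
    using assms unfolding form_def
    by (blast intro: alternating_interior multilinear_interior graded_interior)
qed

lemma multilinear_zero: "multilinear 0"
  by (simp add: multilinear_def linear_zero)

lemma subspace_form: "subspace (Collect (form m s))"
proof (rule subspaceI)
  show "0 \<in> Collect (form m s)"
    by (simp add: form_def alternating_def graded_def multilinear_zero)
  fix \<sigma> \<tau> and c :: real assume "\<sigma> \<in> Collect (form m s)"
  then have \<sigma>: "alternating \<sigma>" "multilinear \<sigma>" "graded s \<sigma>" "\<forall>fs. length fs \<noteq> m \<longrightarrow> \<sigma> fs = 0"
    by (simp_all add: form_def)
  have "alternating (c *\<^sub>R \<sigma>)"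
    unfolding alternating_def scaleR_fun_def
    by (intro allI, subst alternatingD[OF \<sigma>(1)]) simp
  moreover have "multilinear (c *\<^sub>R \<sigma>)"
    using \<sigma>(2) linear_compose_scale_right[of _ c]
    unfolding multilinear_def scaleR_fun_def by blast
  moreover have "graded s (c *\<^sub>R \<sigma>)"
    using \<sigma>(3) by (simp add: graded_def scaleR_fun_def)
  ultimately show "c *\<^sub>R \<sigma> \<in> Collect (form m s)"
    using \<sigma>(4) by (simp add: form_def) (simp add: scaleR_fun_def)
  assume "\<tau> \<in> Collect (form m s)"
  then have \<tau>: "alternating \<tau>" "multilinear \<tau>" "graded s \<tau>" "\<forall>fs. length fs \<noteq> m \<longrightarrow> \<tau> fs = 0"
    by (simp_all add: form_def)
  have "(\<sigma> + \<tau>) (us @ f # g # vs) = - (\<sigma> + \<tau>) (us @ g # f # vs)" for us f g vs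
    using alternatingD[OF \<sigma>(1), of us f g vs] alternatingD[OF \<tau>(1), of us f g vs]
    unfolding plus_fun_def by linarith
  then have "alternating (\<sigma> + \<tau>)" unfolding alternating_def by blast
  moreover have "multilinear (\<sigma> + \<tau>)"
    using \<sigma>(2) \<tau>(2) by (simp add: multilinear_def linear_compose_add)
  moreover have "graded s (\<sigma> + \<tau>)"
    using \<sigma>(3) \<tau>(3) by (simp add: graded_def)
  ultimately show "\<sigma> + \<tau> \<in> Collect (form m s)"
    using \<sigma>(4) \<tau>(4) by (simp add: form_def)
qed

lemma linear_eq_sum_monomials:
  assumes "linear (L :: ham \<Rightarrow> real)"
  shows "L f = (\<Sum>a\<in>Poly_Mapping.keys (potential f). coefficient a f * L (monom a))"
proof -
  have "L f = L (\<Sum>a\<in>Poly_Mapping.keys (potential f). coefficient a f *\<^sub>R monom a)"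
    by (simp flip: ham_sum_monomials)
  then show ?thesis by (simp add: linear_sum[OF assms] linear_scale[OF assms])
qed

text \<open>
  Monomials span, and the first argument can be expanded while the others are handled by induction
  through the interior product.
\<close>

lemma multilinear_monomials_eq_0:
  assumes "multilinear \<sigma>" "\<And>as. length as = length fs \<Longrightarrow> \<sigma> (map monom as) = 0"
  shows "\<sigma> fs = 0"
  using assms
proof (induction fs arbitrary: \<sigma>)
  case Nil
  then show ?case using Nil.prems(2)[of "[]"] by simp
next
  case (Cons f fs)
  have 0: "\<sigma> (monom a # fs) = 0" for a
  proof -
    have "interior (monom a) \<sigma> fs = 0"
      using Cons.prems(2)[of "a # as" for as]
      by (intro Cons.IH[of "interior (monom a) \<sigma>"] multilinear_interior[OF Cons.prems(1)])
        (simp add: interior_def)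
    then show ?thesis by (simp add: interior_def)
  qed
  have "\<sigma> (f # fs) = (\<Sum>a\<in>Poly_Mapping.keys (potential f). coefficient a f * \<sigma> (monom a # fs))"
    by (rule linear_eq_sum_monomials[OF multilinear_linear_Cons[OF Cons.prems(1)]])
  then show ?case using 0 by simp
qed

lemma list_all2_monom: "list_all2 (\<lambda>f l. f \<in> homogeneous l) (map monom as) (map mdeg as)"
  by (simp add: list_all2_conv_all_nth monom_homogeneous)

lemma wedge_scaleR_left: "wedge (c *\<^sub>R \<alpha>) \<beta> fs = c * wedge \<alpha> \<beta> fs"
proof (induction fs arbitrary: \<alpha> \<beta>)
  case (Cons f fs)
  have "interior f (c *\<^sub>R \<alpha>) = c *\<^sub>R interior f \<alpha>" "grade_sign (c *\<^sub>R \<alpha>) = c *\<^sub>R grade_sign \<alpha>"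
    by (simp_all add: interior_def grade_sign_def scaleR_fun_def fun_eq_iff)
  then show ?case by (simp add: Cons.IH algebra_simps)
qed (simp add: scaleR_fun_def)

lemma wedge_scaleR_right: "wedge \<alpha> (c *\<^sub>R \<beta>) fs = c * wedge \<alpha> \<beta> fs"
proof (induction fs arbitrary: \<alpha> \<beta>)
  case (Cons f fs)
  have "interior f (c *\<^sub>R \<beta>) = c *\<^sub>R interior f \<beta>"
    by (simp add: interior_def scaleR_fun_def fun_eq_iff)
  then show ?case by (simp add: Cons.IH algebra_simps)
qed (simp add: scaleR_fun_def)

lemma wedge_zero [simp]: "wedge 0 \<beta> fs = 0" "wedge \<alpha> 0 fs = 0"
  using wedge_scaleR_left[of 0 0] wedge_scaleR_right[of _ 0 0] by simp_all

lemma wedge_unit_left: "wedge unit_cochain \<beta> fs = \<beta> fs"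
proof (induction fs arbitrary: \<beta>)
  case Nil
  show ?case by (simp add: unit_cochain_def)
next
  case (Cons f fs)
  have "interior f unit_cochain = 0" "grade_sign unit_cochain = unit_cochain"
    by (auto simp: interior_def grade_sign_def unit_cochain_def fun_eq_iff)
  then show ?case by (simp add: Cons.IH) (simp add: interior_def)
qed

lemma wedge_one_cochain_Nil [simp]: "wedge (one_cochain z) \<beta> [] = 0"
  by (simp add: one_cochain_def)

declare wedge.simps(1) [simp del]

text \<open>
  Expansion of the shuffle product along its first factor.  The later
  inductions on argument lists use this recursion.
\<close>

lemma wedge_one_cochain_Cons:
  "wedge (one_cochain z) \<beta> (f # fs) = z f * \<beta> fs - wedge (one_cochain z) (interior f \<beta>) fs"
proof -
  have "interior f (one_cochain z) = z f *\<^sub>R unit_cochain"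
    by (auto simp: interior_def one_cochain_def unit_cochain_def scaleR_fun_def fun_eq_iff
        split: list.split)
  moreover have "grade_sign (one_cochain z) = - one_cochain z"
    by (auto simp: grade_sign_def one_cochain_def fun_eq_iff split: list.split)
  ultimately show ?thesis by (simp add: wedge_scaleR_left wedge_unit_left wedge_linear)
qed

declare wedge.simps(2) [simp del]

lemma multilinear_wedge_one_cochain:
  assumes "linear z" "multilinear \<beta>"
  shows "multilinear (wedge (one_cochain z) \<beta>)"
proof -
  have "linear (\<lambda>f. wedge (one_cochain z) \<beta> (us @ f # vs))" for us vs
    using assms(2)
  proof (induction us arbitrary: \<beta>)
    case Nil
    have "interior (f + g) \<beta> = interior f \<beta> + interior g \<beta>" "interior (c *\<^sub>R f) \<beta> = c *\<^sub>R interior f \<beta>" for f g c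
      using linear_add[OF multilinear_linear_Cons[OF Nil]] linear_scale[OF multilinear_linear_Cons[OF Nil]]
      by (auto simp: interior_def fun_eq_iff scaleR_fun_def)
    then show ?case
      using linear_add[OF assms(1)] linear_scale[OF assms(1)]
      by (intro linearI) (simp_all add: wedge_one_cochain_Cons wedge_linear wedge_scaleR_right algebra_simps)
  next
    case (Cons u us)
    have "linear (\<lambda>f. z u * \<beta> (us @ f # vs) - wedge (one_cochain z) (interior u \<beta>) (us @ f # vs))"
      using linear_compose_scale_right[OF multilinear_linear[OF Cons.prems], of "z u"]
      by (intro linear_compose_sub Cons.IH[OF multilinear_interior[OF Cons.prems]]) simp
    then show ?case by (simp add: wedge_one_cochain_Cons)
  qed
  then show ?thesis by (simp add: multilinear_def)
qed

lemma graded_wedge_one_cochain: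
  assumes "z \<in> dual_space l" "graded s \<beta>"
  shows "graded (s + int l) (wedge (one_cochain z) \<beta>)"
  unfolding graded_def
proof (intro allI impI)
  fix fs ls
  assume "list_all2 (\<lambda>f l. f \<in> homogeneous l) fs ls" "int (sum_list ls) \<noteq> s + int l"
  then show "wedge (one_cochain z) \<beta> fs = 0"
    using assms(2)
  proof (induction fs ls arbitrary: s \<beta> rule: list_all2_induct)
    case Nil
    show ?case by simp
  next
    case (Cons f fs k ks)
    have "z f * \<beta> fs = 0"
      using assms(1) Cons gradedD[OF Cons.prems(2), of fs ks] by (cases "k = l") (auto simp: dual_space_def)
    moreover have "wedge (one_cochain z) (interior f \<beta>) fs = 0"
      using Cons.prems Cons.hyps by (intro Cons.IH[of "s - int k"] graded_interior) auto
    ultimately show ?case by (simp add: wedge_one_cochain_Cons)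
  qed
qed

lemma form_wedge_one_cochain:
  assumes "z \<in> dual_space l" "form m s \<beta>"
  shows "form (Suc m) (s + int l) (wedge (one_cochain z) \<beta>)"
proof -
  have "wedge (one_cochain z) \<beta> fs = 0"
    if "length fs \<noteq> Suc m" "\<forall>fs. length fs \<noteq> m \<longrightarrow> \<beta> fs = 0" for fs m \<beta>
    using that
  proof (induction fs arbitrary: m \<beta>)
    case (Cons f fs)
    have "wedge (one_cochain z) (interior f \<beta>) fs = 0"
    proof (cases m)
      case 0
      then have "interior f \<beta> = 0" using Cons.prems by (simp add: interior_def fun_eq_iff)
      then show ?thesis by simp
    next
      case (Suc n)
      then show ?thesis using Cons.prems by (intro Cons.IH[of n]) (auto simp: interior_def)
    qed
    then show ?case using Cons.prems by (simp add: wedge_one_cochain_Cons)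
  qed simp
  then show ?thesis
    using assms
    by (auto simp: form_def dual_space_def[of l] alternating_wedge alternating_one_cochain
        multilinear_wedge_one_cochain graded_wedge_one_cochain)
qed

lemma wedge_list_Cons: "wedge_list (z # zs) = wedge (one_cochain z) (wedge_list zs)"
  by (simp add: wedge_list_def)

lemma form_wedge_list:
  assumes "list_all2 (\<lambda>z l. z \<in> dual_space l) zs ls"
  shows "form (length ls) (int (sum_list ls)) (wedge_list zs)"
  using assms
proof (induction zs ls rule: list_all2_induct)
  case Nil
  have "linear (\<lambda>f. unit_cochain (us @ f # vs))" for us vs
    by (simp add: unit_cochain_def linear_zero)
  moreover have "graded 0 unit_cochain"
    by (auto simp: graded_def unit_cochain_def)
  ultimately show ?case
    by (simp add: form_def wedge_list_def alternating_unit_cochain multilinear_def)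
      (simp add: unit_cochain_def)
next
  case (Cons z zs l ls)
  then show ?case
    using form_wedge_one_cochain[of z l "length ls" "int (sum_list ls)" "wedge_list zs"]
    by (simp add: wedge_list_Cons add.commute)
qed

lemma sum_count_list:
  fixes ls :: "nat list"
  assumes "\<And>l. count_list ls l = k l"
  shows "{i. k i \<noteq> 0} = set ls" "(\<Sum>i | k i \<noteq> 0. k i) = length ls"
    "(\<Sum>i | k i \<noteq> 0. k i * i) = sum_list ls"
proof -
  show *: "{i. k i \<noteq> 0} = set ls"
    using assms count_list_0_iff[of ls] by auto
  show "(\<Sum>i | k i \<noteq> 0. k i) = length ls"
    unfolding * using sum_count_set[of ls "set ls"] assms by simp
  show "(\<Sum>i | k i \<noteq> 0. k i * i) = sum_list ls"
    unfolding * using sum_list_map_eq_sum_count[of "\<lambda>i. i" ls] assms by simp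
qed

text \<open>
  An argument of degree \<open>i\<close> has weight \<open>i - 2\<close>.  The truncated subtraction is exact because
  degrees \<open>0\<close> and \<open>1\<close> do not occur.
\<close>

lemma sum_weights:
  fixes k :: "nat \<Rightarrow> nat"
  assumes "k 0 = 0" "k 1 = 0"
  shows "(\<Sum>i | k i \<noteq> 0. k i * (i - 2)) + 2 * (\<Sum>i | k i \<noteq> 0. k i) = (\<Sum>i | k i \<noteq> 0. k i * i)"
  unfolding sum_distrib_left sum.distrib[symmetric]
proof (intro sum.cong refl)
  fix i assume "i \<in> {i. k i \<noteq> 0}"
  then have "k i \<noteq> 0" by simp
  then have "i \<noteq> 0" "i \<noteq> 1" using assms by metis+
  then obtain j where "i = j + 2" by (metis One_nat_def add_2_eq_Suc' not0_implies_Suc)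
  then show "k i * (i - 2) + 2 * k i = k i * i" by simp
qed

lemma form_cochains:
  assumes "\<sigma> \<in> cochains m w"
  shows "form m (int (w + 2 * m)) \<sigma>"
proof -
  have "exterior_component k \<subseteq> Collect (form m (int (w + 2 * m)))"
    if "k 0 = 0" "k 1 = 0" "(\<Sum>i | k i \<noteq> 0. k i) = m" "(\<Sum>i | k i \<noteq> 0. k i * (i - 2)) = w" for k
    unfolding exterior_component_def
  proof (rule span_minimal[OF _ subspace_form], clarify)
    fix zs ls
    assume zs: "list_all2 (\<lambda>z l. z \<in> dual_space l) zs ls" and k: "\<forall>l. count_list ls l = k l"
    have "length ls = m" "sum_list ls = w + 2 * m"
      using that sum_count_list[of ls k] k sum_weights[of k] by simp_all
    then show "form m (int (w + 2 * m)) (wedge_list zs)"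
      using form_wedge_list[OF zs] by simp
  qed
  then have "cochains m w \<subseteq> Collect (form m (int (w + 2 * m)))"
    unfolding cochains_def by (intro span_minimal[OF _ subspace_form]) blast
  then show ?thesis using assms by blast
qed

lemma wedge_list_in_cochains:
  assumes "list_all2 (\<lambda>z l. z \<in> dual_space l) zs ls" "\<forall>l\<in>set ls. 2 \<le> l"
    "length ls = m" "sum_list ls = w + 2 * m"
  shows "wedge_list zs \<in> cochains m w"
proof -
  let ?k = "count_list ls"
  have k: "?k 0 = 0" "?k 1 = 0" using assms(2) by (force simp: count_list_0_iff)+
  moreover have "finite {i. ?k i \<noteq> 0}" by (simp only: sum_count_list(1)[OF refl] finite_set)
  moreover have "(\<Sum>i | ?k i \<noteq> 0. ?k i) = m" using sum_count_list(2) assms(3) by blast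
  moreover have "(\<Sum>i | ?k i \<noteq> 0. ?k i * (i - 2)) = w"
    using sum_weights[OF k] sum_count_list(2,3)[of ls ?k] assms(3,4) by simp
  moreover have "wedge_list zs \<in> exterior_component ?k"
    unfolding exterior_component_def using assms(1) by (intro span_base) blast
  ultimately show ?thesis unfolding cochains_def by (intro span_base) blast
qed

text \<open>
  Euler's identity for the derivation \<open>\<Sum>\<^sub>b z\<^sub>b \<wedge> i\<^sub>b\<close>, which counts the arguments of a form.
  The hypothesis says that \<open>\<sigma>\<close> only sees the components of its arguments along the \<open>monom b\<close>.
\<close>

lemma euler_identity:
  assumes "alternating \<sigma>"
    and "\<And>f fs. \<sigma> (f # fs) = (\<Sum>b\<in>B. coefficient b f * \<sigma> (monom b # fs))"
  shows "(\<Sum>b\<in>B. wedge (one_cochain (coefficient b)) (interior (monom b) \<sigma>) fs) = real (length fs) * \<sigma> fs"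
  using assms
proof (induction fs arbitrary: \<sigma>)
  case Nil
  show ?case by simp
next
  case (Cons f fs)
  have swap: "\<sigma> (f # g # hs) = - \<sigma> (g # f # hs)" for g hs
    using alternatingD[OF Cons.prems(1), of "[]" f g hs] by simp
  have "interior f \<sigma> (g # hs) = (\<Sum>b\<in>B. coefficient b g * interior f \<sigma> (monom b # hs))" for g hs
    unfolding interior_def swap Cons.prems(2)[of g] by (simp add: sum_negf)
  note IH = Cons.IH[OF alternating_interior[OF Cons.prems(1)] this]
  have "interior f (interior (monom b) \<sigma>) = - interior (monom b) (interior f \<sigma>)" for b
    by (rule alternating_interior_swap[OF Cons.prems(1)])
  then have "(\<Sum>b\<in>B. wedge (one_cochain (coefficient b)) (interior (monom b) \<sigma>) (f # fs)) =
    (\<Sum>b\<in>B. coefficient b f * \<sigma> (monom b # fs)) +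
    (\<Sum>b\<in>B. wedge (one_cochain (coefficient b)) (interior (monom b) (interior f \<sigma>)) fs)"
    by (simp add: wedge_one_cochain_Cons wedge_linear sum.distrib) (simp add: interior_def)
  then show ?case
    unfolding IH Cons.prems(2)[symmetric] by (simp add: interior_def algebra_simps)
qed

lemma finite_mdeg_le: "finite {a. mdeg a \<le> n}"
proof -
  have "Poly_Mapping.lookup a i \<le> n" if "mdeg a \<le> n" for a i
    using that member_le_sum[of i UNIV "Poly_Mapping.lookup a"] by (simp add: mdeg_def)
  then have "Poly_Mapping.lookup ` {a. mdeg a \<le> n} \<subseteq> PiE UNIV (\<lambda>_. {..n})"
    by (simp add: image_subset_iff PiE_iff)
  moreover have "inj_on Poly_Mapping.lookup {a. mdeg a \<le> n}"
    by (intro inj_onI) (rule poly_mapping_eqI, simp)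
  moreover have "finite (PiE (UNIV :: 4 set) (\<lambda>_. {..n}))" by (intro finite_PiE) simp_all
  ultimately show ?thesis using inj_on_finite by blast
qed

lemma coefficient_dual_space: "coefficient a \<in> dual_space (mdeg a)"
proof -
  have "coefficient a f = 0" if "k \<noteq> mdeg a" "f \<in> homogeneous k" for k f
  proof (rule ccontr)
    assume "coefficient a f \<noteq> 0"
    then have "a \<in> Poly_Mapping.keys (potential f)" by (simp add: coefficient_def in_keys_iff)
    then have "mdeg a = k" using that(2) by (simp add: homogeneous_def)
    then show False using that(1) by simp
  qed
  then show ?thesis using linear_coefficient unfolding dual_space_def by blast
qed

lemma form_eq_0_if_degree_too_large:
  assumes "form m s \<sigma>" "s < 0"
  shows "\<sigma> fs = 0"
proof (rule multilinear_monomials_eq_0)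
  show "multilinear \<sigma>" using assms by (simp add: form_def)
  fix as :: "(4 \<Rightarrow>\<^sub>0 nat) list"
  show "\<sigma> (map monom as) = 0"
    using assms gradedD[OF _ list_all2_monom, of s \<sigma> as] by (simp add: form_def)
qed

lemma span_wedge_one_cochain:
  assumes "\<sigma> \<in> span A" "\<And>\<tau>. \<tau> \<in> A \<Longrightarrow> wedge \<alpha> \<tau> \<in> span A'"
  shows "wedge \<alpha> \<sigma> \<in> span A'"
  using assms(1)
proof (induction rule: span_induct_alt)
  case base
  have "wedge \<alpha> 0 = 0" by (simp add: fun_eq_iff)
  then show ?case by (simp only: span_zero)
next
  case (step c \<tau> \<rho>)
  have "wedge \<alpha> (c *\<^sub>R \<tau> + \<rho>) = c *\<^sub>R wedge \<alpha> \<tau> + wedge \<alpha> \<rho>"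
    by (rule ext) (simp add: wedge_add_right wedge_scaleR_right, simp add: scaleR_fun_def)
  then show ?case using step assms(2) by (metis span_add span_scale)
qed

text \<open>
  Conversely every graded alternating form is a combination of wedge products of coordinate
  functionals.  Dividing Euler's identity by the number of arguments expresses it through
  products of a functional with a form in one argument less.
\<close>

lemma form_in_span:
  assumes "form m s \<sigma>"
  shows "\<sigma> \<in> span {wedge_list zs | zs ls. list_all2 (\<lambda>z l. z \<in> dual_space l) zs ls \<and>
    (\<forall>l\<in>set ls. 2 \<le> l) \<and> length ls = m \<and> int (sum_list ls) = s}" (is "_ \<in> span (?W m s)")
  using assms
proof (induction m arbitrary: s \<sigma>)
  case 0
  have \<sigma>: "\<sigma> = \<sigma> [] *\<^sub>R unit_cochain"
  proof
    fix fs
    show "\<sigma> fs = (\<sigma> [] *\<^sub>R unit_cochain) fs"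
      using 0 by (cases fs) (simp_all add: form_def unit_cochain_def scaleR_fun_def)
  qed
  show ?case
  proof (cases "s = 0")
    case True
    have "unit_cochain \<in> ?W 0 s"
      using True
      by (intro CollectI exI[of _ "[]"] conjI) (simp_all add: wedge_list_def)
    then show ?thesis by (subst \<sigma>) (intro span_scale span_base)
  next
    case False
    then have "\<sigma> [] = 0" using 0 gradedD[of s \<sigma> "[]" "[]"] by (simp add: form_def)
    then have "\<sigma> = 0" by (subst \<sigma>) simp
    then show ?thesis by (simp only: span_zero)
  qed
next
  case (Suc m)
  define B where "B = {a. 2 \<le> mdeg a \<and> int (mdeg a) \<le> s}"
  have fin: "finite B"
    by (rule finite_subset[OF _ finite_mdeg_le[of "nat s"]]) (auto simp: B_def)
  have out: "coefficient a f * \<sigma> (monom a # fs) = 0" if "a \<notin> B" for a f fs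
  proof (cases "2 \<le> mdeg a")
    case True
    then have "s - int (mdeg a) < 0" using that by (simp add: B_def)
    then show ?thesis
      using form_eq_0_if_degree_too_large[OF form_interior[OF Suc.prems monom_homogeneous]]
      by (simp add: interior_def)
  next
    case False
    then show ?thesis using potential[of f] by (auto simp: coefficient_def in_keys_iff)
  qed
  have expand: "\<sigma> (f # fs) = (\<Sum>b\<in>B. coefficient b f * \<sigma> (monom b # fs))" for f fs
  proof -
    let ?K = "Poly_Mapping.keys (potential f)"
    have "linear (\<lambda>f. \<sigma> (f # fs))"
      using Suc.prems by (simp add: form_def multilinear_linear_Cons)
    then have "\<sigma> (f # fs) = (\<Sum>b\<in>?K. coefficient b f * \<sigma> (monom b # fs))"
      by (rule linear_eq_sum_monomials)
    also have "\<dots> = (\<Sum>b\<in>?K \<union> B. coefficient b f * \<sigma> (monom b # fs))"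
      using fin by (intro sum.mono_neutral_left) (auto simp: coefficient_def in_keys_iff)
    also have "\<dots> = (\<Sum>b\<in>B. coefficient b f * \<sigma> (monom b # fs))"
      using fin out by (intro sum.mono_neutral_right) auto
    finally show ?thesis .
  qed
  have euler: "real (length fs) * \<sigma> fs =
      (\<Sum>b\<in>B. wedge (one_cochain (coefficient b)) (interior (monom b) \<sigma>) fs)" for fs
    using Suc.prems by (intro euler_identity[symmetric] expand) (simp add: form_def)
  have "\<sigma> = (1 / real (Suc m)) *\<^sub>R
      (\<Sum>b\<in>B. wedge (one_cochain (coefficient b)) (interior (monom b) \<sigma>))"
  proof
    fix fs
    have sum_apply: "(\<Sum>b\<in>B. F b) fs = (\<Sum>b\<in>B. F b fs)" for F :: "_ \<Rightarrow> cochain"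
      using fin by (induction B) simp_all
    show "\<sigma> fs = ((1 / real (Suc m)) *\<^sub>R
      (\<Sum>b\<in>B. wedge (one_cochain (coefficient b)) (interior (monom b) \<sigma>))) fs"
    proof (cases "length fs = Suc m")
      case True
      then show ?thesis using euler[of fs] by (simp add: scaleR_fun_def sum_apply field_simps)
    next
      case False
      have "form (Suc m) (s - int (mdeg b) + int (mdeg b))
          (wedge (one_cochain (coefficient b)) (interior (monom b) \<sigma>))" for b
        using Suc.prems by (intro form_wedge_one_cochain form_interior coefficient_dual_space monom_homogeneous)
      then show ?thesis using False Suc.prems
        by (simp add: scaleR_fun_def sum_apply form_def)
    qed
  qed
  also have "\<dots> \<in> span (?W (Suc m) s)"
  proof (intro span_scale span_sum)
    fix b assume b: "b \<in> B"
    have "interior (monom b) \<sigma> \<in> span (?W m (s - int (mdeg b)))"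
      using Suc.prems by (intro Suc.IH form_interior monom_homogeneous)
    moreover have "wedge (one_cochain (coefficient b)) \<tau> \<in> span (?W (Suc m) s)"
      if "\<tau> \<in> ?W m (s - int (mdeg b))" for \<tau>
    proof -
      from that obtain zs ls where \<tau>: "\<tau> = wedge_list zs" and zs: "list_all2 (\<lambda>z l. z \<in> dual_space l) zs ls"
        "\<forall>l\<in>set ls. 2 \<le> l" "length ls = m" "int (sum_list ls) = s - int (mdeg b)" by blast
      show ?thesis
        unfolding \<tau> wedge_list_Cons[symmetric] using zs b
        by (intro span_base CollectI exI[of _ "coefficient b # zs"] exI[of _ "mdeg b # ls"])
          (auto simp: coefficient_dual_space B_def)
    qed
    ultimately show "wedge (one_cochain (coefficient b)) (interior (monom b) \<sigma>) \<in> span (?W (Suc m) s)"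
      by (rule span_wedge_one_cochain)
  qed
  finally show ?case .
qed

text \<open>
  This replaces spans of wedge products by conditions on functions, which can be checked for an
  explicitly given form and restricted, argument by argument, to subspaces.
\<close>

theorem cochains_iff_form: "\<sigma> \<in> cochains m w \<longleftrightarrow> form m (int (w + 2 * m)) \<sigma>"
proof
  assume "form m (int (w + 2 * m)) \<sigma>"
  then have "\<sigma> \<in> span {wedge_list zs | zs ls. list_all2 (\<lambda>z l. z \<in> dual_space l) zs ls \<and>
    (\<forall>l\<in>set ls. 2 \<le> l) \<and> length ls = m \<and> int (sum_list ls) = int (w + 2 * m)}" (is "_ \<in> span ?W")
    by (rule form_in_span)
  moreover have "?W \<subseteq> cochains m w" using wedge_list_in_cochains by force
  ultimately show "\<sigma> \<in> cochains m w"
    using span_minimal[of ?W "cochains m w"] by (auto simp: cochains_def)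
qed (rule form_cochains)

section \<open>The relative complex in terms of graded forms\<close>

lemma interior_linear:
  assumes "multilinear \<sigma>"
  shows "interior (f + g) \<sigma> = interior f \<sigma> + interior g \<sigma>"
    and "interior (c *\<^sub>R f) \<sigma> = c *\<^sub>R interior f \<sigma>"
  using linear_add[OF multilinear_linear_Cons[OF assms]] linear_scale[OF multilinear_linear_Cons[OF assms]]
  by (auto simp: interior_def fun_eq_iff scaleR_fun_def)

lemma lie_sum_Nil [simp]: "lie_sum f \<sigma> [] = 0"
  by (simp add: lie_sum_def)

lemma coboundary_Nil [simp]: "coboundary \<sigma> [] = 0"
  by (simp add: coboundary_def)

lemma lie_sum_uminus: "lie_sum f (- \<sigma>) = - lie_sum f \<sigma>"
  by (simp add: fun_eq_iff lie_sum_def sum_negf)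

lemma lie_sum_scaleR: "lie_sum f (c *\<^sub>R \<sigma>) = c *\<^sub>R lie_sum f \<sigma>"
  by (simp add: fun_eq_iff lie_sum_def scaleR_fun_def sum_distrib_left)

lemma lie_sum_zero [simp]: "lie_sum f 0 = 0"
  by (simp add: fun_eq_iff lie_sum_def)

lemma coboundary_zero [simp]: "coboundary 0 = 0"
  by (simp add: fun_eq_iff coboundary_def)

lemma alternating_lie_sum:
  assumes "alternating \<sigma>"
  shows "alternating (lie_sum u \<sigma>)"
proof -
  have "lie_sum u \<sigma> (us @ f # g # vs) = - lie_sum u \<sigma> (us @ g # f # vs)" for us f g vs
    using assms
  proof (induction us arbitrary: \<sigma>)
    case Nil
    have 1: "\<sigma> (bracket u f # g # vs) = - \<sigma> (g # bracket u f # vs)"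
      using alternatingD[OF Nil, of "[]" "bracket u f" g vs] by simp
    have 2: "\<sigma> (f # bracket u g # vs) = - \<sigma> (bracket u g # f # vs)"
      using alternatingD[OF Nil, of "[]" f "bracket u g" vs] by simp
    have 3: "lie_sum u (interior g (interior f \<sigma>)) vs = - lie_sum u (interior f (interior g \<sigma>)) vs"
      by (simp only: alternating_interior_swap[OF Nil, of g f] lie_sum_uminus) simp
    have "interior f \<sigma> (bracket u g # vs) = \<sigma> (f # bracket u g # vs)"
      "interior g \<sigma> (bracket u f # vs) = \<sigma> (g # bracket u f # vs)" by (simp_all add: interior_def)
    then show ?case using 1 2 3 by (simp add: lie_sum_Cons)
  next
    case (Cons v us)
    have "\<sigma> (bracket u v # us @ f # g # vs) = - \<sigma> (bracket u v # us @ g # f # vs)"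
      using alternatingD[OF Cons.prems, of "bracket u v # us" f g vs] by simp
    then show ?case
      using Cons.IH[OF alternating_interior[OF Cons.prems, of v]] by (simp add: lie_sum_Cons)
  qed
  then show ?thesis unfolding alternating_def by blast
qed

lemma alternating_coboundary:
  assumes "alternating \<sigma>" "multilinear \<sigma>"
  shows "alternating (coboundary \<sigma>)"
proof -
  have "coboundary \<sigma> (us @ f # g # vs) = - coboundary \<sigma> (us @ g # f # vs)" for us f g vs
    using assms
  proof (induction us arbitrary: \<sigma>)
    case Nil
    note alt = Nil(1)
    have 1: "\<sigma> (bracket f g # vs) = - \<sigma> (bracket g f # vs)"
      unfolding bracket_antisym[of f g] by (rule linear_neg[OF multilinear_linear_Cons[OF Nil(2)]])
    have 2: "coboundary (interior g (interior f \<sigma>)) vs = - coboundary (interior f (interior g \<sigma>)) vs"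
      by (simp only: alternating_interior_swap[OF alt, of g f] coboundary_uminus) simp
    show ?case
      using 1 2 by (simp add: coboundary_Cons[OF alt] coboundary_Cons[OF alternating_interior[OF alt]] lie_sum_Cons)
  next
    case (Cons v us)
    have "lie_sum v \<sigma> (us @ f # g # vs) = - lie_sum v \<sigma> (us @ g # f # vs)"
      by (rule alternatingD[OF alternating_lie_sum[OF Cons.prems(1)]])
    then show ?case
      using Cons.IH[OF alternating_interior[OF Cons.prems(1), of v] multilinear_interior[OF Cons.prems(2), of v]]
      by (simp add: coboundary_Cons[OF Cons.prems(1)])
  qed
  then show ?thesis unfolding alternating_def by blast
qed

lemma multilinear_lie_sum:
  assumes "multilinear \<sigma>"
  shows "multilinear (lie_sum u \<sigma>)"
proof -
  have "linear (\<lambda>f. lie_sum u \<sigma> (us @ f # vs))" for us vs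
    using assms
  proof (induction us arbitrary: \<sigma>)
    case Nil
    have "linear (\<lambda>f. \<sigma> (bracket u f # vs))"
      using linear_compose[OF linear_bracket_right multilinear_linear_Cons[OF Nil]] by (simp add: o_def)
    moreover have "linear (\<lambda>f. lie_sum u (interior f \<sigma>) vs)"
      by (rule linearI)
        (simp_all add: interior_linear[OF Nil] lie_sum_add lie_sum_scaleR, simp add: scaleR_fun_def)
    ultimately show ?case by (simp add: lie_sum_Cons linear_compose_add)
  next
    case (Cons v us)
    have "linear (\<lambda>f. \<sigma> ((bracket u v # us) @ f # vs))"
      by (rule multilinear_linear[OF Cons.prems])
    then show ?case
      using Cons.IH[OF multilinear_interior[OF Cons.prems, of v]]
      by (simp add: lie_sum_Cons linear_compose_add)
  qed
  then show ?thesis by (simp add: multilinear_def)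
qed

lemma linear_lie_sum_left:
  assumes "multilinear \<sigma>"
  shows "linear (\<lambda>u. lie_sum u \<sigma> fs)"
  using assms
proof (induction fs arbitrary: \<sigma>)
  case Nil
  show ?case by (simp add: linear_zero)
next
  case (Cons f fs)
  have "linear (\<lambda>u. \<sigma> (bracket u f # fs))"
    using linear_compose[OF linear_bracket_left multilinear_linear_Cons[OF Cons.prems]] by (simp add: o_def)
  then show ?case
    using Cons.IH[OF multilinear_interior[OF Cons.prems]] by (simp add: lie_sum_Cons linear_compose_add)
qed

lemma multilinear_coboundary:
  assumes "alternating \<sigma>" "multilinear \<sigma>"
  shows "multilinear (coboundary \<sigma>)"
proof -
  have "linear (\<lambda>f. coboundary \<sigma> (us @ f # vs))" for us vs
    using assms
  proof (induction us arbitrary: \<sigma>)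
    case Nil
    have "linear (\<lambda>f. coboundary (interior f \<sigma>) vs)"
      by (rule linearI)
        (simp_all add: interior_linear[OF Nil(2)] coboundary_add coboundary_scaleR, simp add: scaleR_fun_def)
    then show ?case
      using linear_lie_sum_left[OF Nil(2), of vs]
      by (simp add: coboundary_Cons[OF Nil(1)] linear_compose_sub linear_compose_neg)
  next
    case (Cons v us)
    show ?case
      using multilinear_linear[OF multilinear_lie_sum[OF Cons.prems(2), of v], of us vs]
        Cons.IH[OF alternating_interior[OF Cons.prems(1), of v] multilinear_interior[OF Cons.prems(2), of v]]
      by (simp add: coboundary_Cons[OF Cons.prems(1)] linear_compose_sub linear_compose_neg)
  qed
  then show ?thesis by (simp add: multilinear_def)
qed

lemma graded_lie_sum:
  assumes "multilinear \<sigma>" "graded s \<sigma>" "u \<in> homogeneous k"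
  shows "graded (s + 2 - int k) (lie_sum u \<sigma>)"
  unfolding graded_def
proof (intro allI impI)
  fix fs ls
  assume fs: "list_all2 (\<lambda>f l. f \<in> homogeneous l) fs ls" and s: "int (sum_list ls) \<noteq> s + 2 - int k"
  have "\<sigma> (fs[i := bracket u (fs ! i)]) = 0" if i: "i < length fs" for i
  proof (cases "k + ls ! i < 2")
    case True
    then have "u = 0" using homogeneous_below_2[OF assms(3)] by simp
    then have "bracket u (fs ! i) = 0" using linear_0[OF linear_bracket_left] by simp
    then show ?thesis
      using linear_0[OF multilinear_linear[OF assms(1)]] i by (simp add: upd_conv_take_nth_drop)
  next
    case False
    have len: "length fs = length ls" using fs list_all2_lengthD by blast
    have "bracket u (fs ! i) \<in> homogeneous (k + ls ! i - 2)"
      using assms(3) list_all2_nthD[OF fs i] by (rule bracket_homogeneous)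
    then have "list_all2 (\<lambda>f l. f \<in> homogeneous l) (fs[i := bracket u (fs ! i)]) (ls[i := k + ls ! i - 2])"
      by (rule list_all2_update_cong[OF fs])
    moreover have "ls ! i \<le> sum_list ls" using i len by (simp add: elem_le_sum_list)
    then have "int (sum_list (ls[i := k + ls ! i - 2])) \<noteq> s"
      using i len s False by (simp add: sum_list_update)
    ultimately show ?thesis by (rule gradedD[OF assms(2)])
  qed
  then show "lie_sum u \<sigma> fs = 0" by (simp add: lie_sum_def)
qed

text \<open>
  The bracket has degree \<open>-2\<close>, so the arguments of \<open>d \<sigma>\<close> need total degree two more than those of
  \<open>\<sigma>\<close>.  As there is also one argument more, the weight does not change.
\<close>

lemma graded_coboundary:
  assumes "alternating \<sigma>" "multilinear \<sigma>" "graded s \<sigma>"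
  shows "graded (s + 2) (coboundary \<sigma>)"
  unfolding graded_def
proof (intro allI impI)
  fix fs ls
  assume "list_all2 (\<lambda>f l. f \<in> homogeneous l) fs ls" "int (sum_list ls) \<noteq> s + 2"
  then show "coboundary \<sigma> fs = 0"
    using assms
  proof (induction fs ls arbitrary: s \<sigma> rule: list_all2_induct)
    case Nil
    show ?case by simp
  next
    case (Cons f fs k ks)
    have "lie_sum f \<sigma> fs = 0"
      using Cons.prems(1) by (intro gradedD[OF graded_lie_sum[OF Cons.prems(3,4) Cons.hyps(1)] Cons.hyps(2)]) simp
    moreover have "coboundary (interior f \<sigma>) fs = 0"
      using Cons.prems(1) by (intro Cons.IH[of "s - int k"] alternating_interior multilinear_interior
          graded_interior Cons.prems(2-4) Cons.hyps(1)) simp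
    ultimately show ?case by (simp add: coboundary_Cons[OF Cons.prems(2)])
  qed
qed

lemma coboundary_eq_0_if_length:
  assumes "alternating \<sigma>" "\<And>fs. length fs \<noteq> m \<Longrightarrow> \<sigma> fs = 0" "length fs \<noteq> Suc m"
  shows "coboundary \<sigma> fs = 0"
  using assms
proof (induction fs arbitrary: m \<sigma>)
  case Nil
  show ?case by simp
next
  case (Cons f fs)
  have "lie_sum f \<sigma> fs = 0" using Cons.prems(2,3) by (simp add: lie_sum_def)
  moreover have "coboundary (interior f \<sigma>) fs = 0"
  proof (cases m)
    case 0
    then have "interior f \<sigma> = 0" using Cons.prems(2) by (simp add: interior_def fun_eq_iff)
    then show ?thesis by simp
  next
    case (Suc n)
    show ?thesis
    proof (rule Cons.IH[of _ n])
      show "alternating (interior f \<sigma>)" by (rule alternating_interior[OF Cons.prems(1)])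
      show "interior f \<sigma> gs = 0" if "length gs \<noteq> n" for gs
        using that Suc Cons.prems(2) by (simp add: interior_def)
      show "length fs \<noteq> Suc n" using Cons.prems(3) Suc by simp
    qed
  qed
  ultimately show ?case by (simp add: coboundary_Cons[OF Cons.prems(1)])
qed

lemma form_coboundary:
  assumes "form m s \<sigma>"
  shows "form (Suc m) (s + 2) (coboundary \<sigma>)"
proof -
  have "coboundary \<sigma> fs = 0" if "length fs \<noteq> Suc m" for fs
    using coboundary_eq_0_if_length[of \<sigma> m fs] assms that unfolding form_def by blast
  then show ?thesis
    using assms unfolding form_def
    by (blast intro: alternating_coboundary multilinear_coboundary graded_coboundary)
qed

text \<open>
  The adjoint action is a representation: this is the Jacobi identity in each argument.
\<close>

lemma lie_sum_commutator:
  assumes "multilinear \<sigma>"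
  shows "lie_sum f (lie_sum q \<sigma>) fs = lie_sum q (lie_sum f \<sigma>) fs + lie_sum (bracket q f) \<sigma> fs"
  using assms
proof (induction fs arbitrary: \<sigma>)
  case Nil
  show ?case by simp
next
  case (Cons g fs)
  have "\<sigma> (bracket q (bracket f g) # fs) =
      \<sigma> (bracket (bracket q f) g # fs) + \<sigma> (bracket f (bracket q g) # fs)"
    unfolding bracket_jacobi[of q f g] by (rule linear_add[OF multilinear_linear_Cons[OF Cons.prems]])
  moreover have "interior g (lie_sum h \<sigma>) = interior (bracket h g) \<sigma> + lie_sum h (interior g \<sigma>)" for h
    by (rule interior_lie_sum)
  ultimately show ?case
    by (simp add: lie_sum_Cons lie_sum_add Cons.IH[OF multilinear_interior[OF Cons.prems]])
qed

text \<open>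
  In the induction on the arguments, the two sides reduce to expressions that differ by the commutator
  of the actions of \<open>q\<close> and of the first argument, and the previous lemma evaluates it.
\<close>

lemma lie_sum_coboundary:
  assumes "alternating \<sigma>" "multilinear \<sigma>"
  shows "lie_sum q (coboundary \<sigma>) fs = coboundary (lie_sum q \<sigma>) fs"
  using assms
proof (induction fs arbitrary: \<sigma>)
  case Nil
  show ?case by simp
next
  case (Cons f fs)
  note alt = Cons.prems(1) and lin = Cons.prems(2)
  have "lie_sum q (coboundary \<sigma>) (f # fs) =
    - lie_sum (bracket q f) \<sigma> fs - coboundary (interior (bracket q f) \<sigma>) fs
    - lie_sum q (lie_sum f \<sigma>) fs - lie_sum q (coboundary (interior f \<sigma>)) fs"
  proof -
    have "interior f (coboundary \<sigma>) = - lie_sum f \<sigma> + - coboundary (interior f \<sigma>)"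
      unfolding interior_coboundary[OF alt] by simp
    then have "lie_sum q (interior f (coboundary \<sigma>)) =
        - lie_sum q (lie_sum f \<sigma>) + - lie_sum q (coboundary (interior f \<sigma>))"
      by (simp only: lie_sum_add lie_sum_uminus)
    then show ?thesis by (simp add: lie_sum_Cons coboundary_Cons[OF alt])
  qed
  moreover have "coboundary (lie_sum q \<sigma>) (f # fs) =
    - lie_sum f (lie_sum q \<sigma>) fs - coboundary (interior (bracket q f) \<sigma>) fs
    - coboundary (lie_sum q (interior f \<sigma>)) fs"
    by (simp add: coboundary_Cons[OF alternating_lie_sum[OF alt]] interior_lie_sum coboundary_add)
  moreover have "lie_sum q (coboundary (interior f \<sigma>)) fs = coboundary (lie_sum q (interior f \<sigma>)) fs"
    by (rule Cons.IH[OF alternating_interior[OF alt] multilinear_interior[OF lin]])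
  ultimately show ?case using lie_sum_commutator[OF lin, of f q fs] by simp
qed

text \<open>
  Cartan's formula turns the condition on \<open>i\<^sub>q (d \<sigma>)\<close> into invariance under the quadratic
  Hamiltonians, that is, under the symplectic Lie algebra.
\<close>

lemma relative_cochains_iff:
  "\<sigma> \<in> relative_cochains m w \<longleftrightarrow>
    form m (int (w + 2 * m)) \<sigma> \<and> (\<forall>q\<in>homogeneous 2. interior q \<sigma> = 0 \<and> lie_sum q \<sigma> = 0)"
proof -
  have "interior q (coboundary \<sigma>) = 0 \<longleftrightarrow> lie_sum q \<sigma> = 0"
    if "alternating \<sigma>" "interior q \<sigma> = 0" for q
    unfolding interior_coboundary[OF that(1)] that(2) by simp
  then show ?thesis
    unfolding relative_cochains_def cochains_iff_form form_def by blast
qed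

lemma subspace_relative_cochains: "subspace (relative_cochains m w)"
proof (rule subspaceI)
  show "0 \<in> relative_cochains m w"
    using subspace_0[OF subspace_form[of m "int (w + 2 * m)"]]
    by (simp add: relative_cochains_iff) (simp add: interior_def fun_eq_iff)
  show "\<sigma> + \<tau> \<in> relative_cochains m w" if "\<sigma> \<in> relative_cochains m w" "\<tau> \<in> relative_cochains m w" for \<sigma> \<tau>
    using that subspace_add[OF subspace_form[of m "int (w + 2 * m)"], of \<sigma> \<tau>]
    by (simp add: relative_cochains_iff interior_simps lie_sum_add)
  fix c and \<sigma> :: cochain assume "\<sigma> \<in> relative_cochains m w"
  moreover have "interior q (c *\<^sub>R \<sigma>) = c *\<^sub>R interior q \<sigma>" for q
    by (simp add: interior_def scaleR_fun_def)
  ultimately show "c *\<^sub>R \<sigma> \<in> relative_cochains m w"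
    using subspace_scale[OF subspace_form[of m "int (w + 2 * m)"], of \<sigma> c]
    by (simp add: relative_cochains_iff lie_sum_scaleR)
qed

text \<open>
  The condition on \<open>i\<^sub>q (d (d \<sigma>))\<close> in the definition follows, by Cartan's formula, from the invariance
  of \<open>d \<sigma>\<close>.
\<close>

lemma coboundary_relative_cochain:
  assumes "\<sigma> \<in> relative_cochains m w"
  shows "coboundary \<sigma> \<in> relative_cochains (Suc m) w"
proof -
  have \<sigma>: "form m (int (w + 2 * m)) \<sigma>" using assms by (simp add: relative_cochains_iff)
  then have "form (Suc m) (int (w + 2 * Suc m)) (coboundary \<sigma>)"
    using form_coboundary[OF \<sigma>] by (simp add: algebra_simps)
  moreover have "interior q (coboundary \<sigma>) = 0 \<and> lie_sum q (coboundary \<sigma>) = 0" if "q \<in> homogeneous 2" for q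
  proof
    show "interior q (coboundary \<sigma>) = 0" using assms that by (simp add: relative_cochains_def)
    have "lie_sum q \<sigma> = 0" using assms that by (simp add: relative_cochains_iff)
    moreover have "lie_sum q (coboundary \<sigma>) = coboundary (lie_sum q \<sigma>)"
      using \<sigma> lie_sum_coboundary unfolding form_def by blast
    ultimately show "lie_sum q (coboundary \<sigma>) = 0" by simp
  qed
  ultimately show ?thesis unfolding relative_cochains_iff by blast
qed

lemma relative_cochain_quadratic_eq_0:
  assumes "\<sigma> \<in> relative_cochains m w" "q \<in> homogeneous 2"
  shows "\<sigma> (us @ q # vs) = 0"
proof -
  have "alternating \<sigma>" using assms(1) by (simp add: relative_cochains_iff form_def)
  then have "\<sigma> (q # us @ vs) = (- 1) ^ length us * \<sigma> (us @ q # vs)" by (rule alternating_move)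
  moreover have "interior q \<sigma> (us @ vs) = 0"
    using assms by (simp add: relative_cochains_iff)
  ultimately show ?thesis by (simp add: interior_def)
qed

text \<open>
  By multilinearity, weight and vanishing on quadratic arguments, a relative cochain is determined
  by its values on monomials of degree at least \<open>3\<close> with the right total degree.
\<close>

lemma relative_cochain_eqI:
  assumes "\<sigma> \<in> relative_cochains m w"
    and "\<And>as. length as = m \<Longrightarrow> \<forall>a\<in>set as. 3 \<le> mdeg a \<Longrightarrow> sum_list (map mdeg as) = w + 2 * m \<Longrightarrow>
      \<sigma> (map monom as) = 0"
  shows "\<sigma> = 0"
proof
  fix fs
  have \<sigma>: "form m (int (w + 2 * m)) \<sigma>" using assms(1) by (simp add: relative_cochains_iff)
  show "\<sigma> fs = (0 :: cochain) fs"
  proof (cases "length fs = m")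
    case True
    have "\<sigma> (map monom as) = 0" if len: "length as = length fs" for as
    proof (cases "sum_list (map mdeg as) = w + 2 * m")
      case sum: True
      show ?thesis
      proof (cases "\<forall>a\<in>set as. 3 \<le> mdeg a")
        case False
        then obtain a bs cs where as: "as = bs @ a # cs" and a: "mdeg a < 3"
          by (metis not_le split_list)
        consider "mdeg a < 2" | "mdeg a = 2" using a by linarith
        then have "monom a \<in> homogeneous 2"
        proof cases
          case 1
          then have "monom a = 0" by (rule homogeneous_below_2[OF monom_homogeneous])
          then show ?thesis using subspace_0[OF subspace_homogeneous] by simp
        next
          case 2
          then show ?thesis using monom_homogeneous[of a] by simp
        qed
        then show ?thesis
          using relative_cochain_quadratic_eq_0[OF assms(1)] by (simp add: as)
      qed (use assms(2) True len sum in blast)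
    next
      case False
      then have "int (sum_list (map mdeg as)) \<noteq> int (w + 2 * m)" by linarith
      then show ?thesis
        using \<sigma> gradedD[OF _ list_all2_monom] unfolding form_def by blast
    qed
    moreover have "multilinear \<sigma>" using \<sigma> by (simp add: form_def)
    ultimately have "\<sigma> fs = 0" using multilinear_monomials_eq_0 by blast
    then show ?thesis by simp
  next
    case False
    then show ?thesis using \<sigma> by (simp add: form_def)
  qed
qed

text \<open>
  Every argument that is not quadratic has weight at least \<open>1\<close>.
\<close>

lemma relative_cochain_eq_0_if_degree_exceeds_weight:
  assumes "\<sigma> \<in> relative_cochains m w" "w < m"
  shows "\<sigma> = 0"
proof (rule relative_cochain_eqI[OF assms(1)])
  fix as :: "(4 \<Rightarrow>\<^sub>0 nat) list"
  assume "length as = m" "\<forall>a\<in>set as. 3 \<le> mdeg a" "sum_list (map mdeg as) = w + 2 * m"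
  moreover have "(\<forall>a\<in>set as. 3 \<le> mdeg a) \<Longrightarrow> 3 * length as \<le> sum_list (map mdeg as)"
    by (induction as) auto
  ultimately show "\<sigma> (map monom as) = 0" using assms(2) by simp
qed

section \<open>Brackets of monomials\<close>

definition expo :: "nat \<Rightarrow> nat \<Rightarrow> nat \<Rightarrow> nat \<Rightarrow> (4 \<Rightarrow>\<^sub>0 nat)"
  where "expo a b c d = Poly_Mapping.single 1 a + Poly_Mapping.single 2 b
    + Poly_Mapping.single 3 c + Poly_Mapping.single 4 d"

abbreviation mon :: "nat \<Rightarrow> nat \<Rightarrow> nat \<Rightarrow> nat \<Rightarrow> ham"
  where "mon a b c d \<equiv> monom (expo a b c d)"

lemma four_distinct [simp]:
  "(1 :: 4) \<noteq> 2" "(1 :: 4) \<noteq> 3" "(1 :: 4) \<noteq> 4" "(2 :: 4) \<noteq> 1" "(2 :: 4) \<noteq> 3" "(2 :: 4) \<noteq> 4"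
  "(3 :: 4) \<noteq> 1" "(3 :: 4) \<noteq> 2" "(3 :: 4) \<noteq> 4" "(4 :: 4) \<noteq> 1" "(4 :: 4) \<noteq> 2" "(4 :: 4) \<noteq> 3"
proof -
  have "card {1, 2, 3, 4 :: 4} = 4" using UNIV_four by (metis card_bit0 card_num1 mult_2 numeral_Bit0 one_add_one)
  then show "(1 :: 4) \<noteq> 2" "(1 :: 4) \<noteq> 3" "(1 :: 4) \<noteq> 4" "(2 :: 4) \<noteq> 1" "(2 :: 4) \<noteq> 3" "(2 :: 4) \<noteq> 4"
    "(3 :: 4) \<noteq> 1" "(3 :: 4) \<noteq> 2" "(3 :: 4) \<noteq> 4" "(4 :: 4) \<noteq> 1" "(4 :: 4) \<noteq> 2" "(4 :: 4) \<noteq> 3"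
    by (auto simp: card_insert_if split: if_splits)
qed

lemma lookup_expo [simp]:
  "Poly_Mapping.lookup (expo a b c d) 1 = a" "Poly_Mapping.lookup (expo a b c d) 2 = b"
  "Poly_Mapping.lookup (expo a b c d) 3 = c" "Poly_Mapping.lookup (expo a b c d) 4 = d"
  by (simp_all add: expo_def lookup_add lookup_single when_def)

lemma expo_eqI:
  assumes "Poly_Mapping.lookup e 1 = a" "Poly_Mapping.lookup e 2 = b"
    "Poly_Mapping.lookup e 3 = c" "Poly_Mapping.lookup e 4 = d"
  shows "e = expo a b c d"
proof (rule poly_mapping_eqI)
  fix i
  show "Poly_Mapping.lookup e i = Poly_Mapping.lookup (expo a b c d) i"
    using four_cases[of i] assms by (elim disjE) (simp_all only: lookup_expo)
qed

lemma expo_exhaust: obtains a b c d where "e = expo a b c d"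
  using expo_eqI by blast

lemma mdeg_expo [simp]: "mdeg (expo a b c d) = a + b + c + d"
  by (simp add: expo_def mdeg_add)

lemma expo_add [simp]: "expo a b c d + expo a' b' c' d' = expo (a + a') (b + b') (c + c') (d + d')"
  by (rule expo_eqI) (simp_all add: lookup_add)

lemma partial_deriv_expo [simp]:
  "partial_deriv 1 (Poly_Mapping.single (expo a b c d) r) = Poly_Mapping.single (expo (a - 1) b c d) (real a * r)"
  "partial_deriv 2 (Poly_Mapping.single (expo a b c d) r) = Poly_Mapping.single (expo a (b - 1) c d) (real b * r)"
  "partial_deriv 3 (Poly_Mapping.single (expo a b c d) r) = Poly_Mapping.single (expo a b (c - 1) d) (real c * r)"
  "partial_deriv 4 (Poly_Mapping.single (expo a b c d) r) = Poly_Mapping.single (expo a b c (d - 1)) (real d * r)"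
proof -
  have "expo a b c d - Poly_Mapping.single 1 1 = expo (a - 1) b c d"
    "expo a b c d - Poly_Mapping.single 2 1 = expo a (b - 1) c d"
    "expo a b c d - Poly_Mapping.single 3 1 = expo a b (c - 1) d"
    "expo a b c d - Poly_Mapping.single 4 1 = expo a b c (d - 1)"
    by (rule expo_eqI; simp add: lookup_minus lookup_single when_def)+
  then show
    "partial_deriv 1 (Poly_Mapping.single (expo a b c d) r) = Poly_Mapping.single (expo (a - 1) b c d) (real a * r)"
    "partial_deriv 2 (Poly_Mapping.single (expo a b c d) r) = Poly_Mapping.single (expo a (b - 1) c d) (real b * r)"
    "partial_deriv 3 (Poly_Mapping.single (expo a b c d) r) = Poly_Mapping.single (expo a b (c - 1) d) (real c * r)"
    "partial_deriv 4 (Poly_Mapping.single (expo a b c d) r) = Poly_Mapping.single (expo a b c (d - 1)) (real d * r)"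
    by (simp_all only: partial_deriv_single lookup_expo)
qed

lemma potential_mon [simp]:
  "2 \<le> a + b + c + d \<Longrightarrow> potential (mon a b c d) = Poly_Mapping.single (expo a b c d) 1"
  by (simp add: monom.rep_eq)

text \<open>
  In a truncated exponent such as \<open>a + a' - 1\<close> the subtraction is exact whenever the coefficient in
  front of the monomial is nonzero.
\<close>

lemma bracket_mon:
  assumes "2 \<le> a + b + c + d" "2 \<le> a' + b' + c' + d'"
  shows "bracket (mon a b c d) (mon a' b' c' d') =
    (real a * real d' - real d * real a') *\<^sub>R mon (a + a' - 1) (b + b') (c + c') (d + d' - 1) +
    (real b * real c' - real c * real b') *\<^sub>R mon (a + a') (b + b' - 1) (c + c' - 1) (d + d')"
proof -
  let ?S = "\<lambda>a b c d r. Poly_Mapping.single (expo a b c d) r :: poly4"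
  have S: "?S (a - 1 + a') u v (d + (d' - 1)) (real a * real d') = ?S (a + a' - 1) u v (d + d' - 1) (real a * real d')"
      "?S u (b - 1 + b') (c + (c' - 1)) v (real b * real c') = ?S u (b + b' - 1) (c + c' - 1) v (real b * real c')"
    for u v a b c d a' b' c' d'
    by (cases a; cases d'; simp) (cases b; cases c'; simp)
  have "poisson (?S a b c d 1) (?S a' b' c' d' 1) =
    ?S (a - 1 + a') (b + b') (c + c') (d + (d' - 1)) (real a * real d')
    + ?S (a + a') (b - 1 + b') (c + (c' - 1)) (d + d') (real b * real c')
    - ?S (a' + a) (b' - 1 + b) (c' + (c - 1)) (d' + d) (real b' * real c)
    - ?S (a' - 1 + a) (b' + b) (c' + c) (d' + (d - 1)) (real a' * real d)"
    by (simp add: poisson_def mult_single add.commute mult.commute)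
  also have "\<dots> = ?S (a + a' - 1) (b + b') (c + c') (d + d' - 1) (real a * real d' - real d * real a')
    + ?S (a + a') (b + b' - 1) (c + c' - 1) (d + d') (real b * real c' - real c * real b')"
    unfolding S by (simp add: single_diff add.commute mult.commute)
  also have "\<dots> = (real a * real d' - real d * real a') *\<^sub>R potential (mon (a + a' - 1) (b + b') (c + c') (d + d' - 1))
    + (real b * real c' - real c * real b') *\<^sub>R potential (mon (a + a') (b + b' - 1) (c + c' - 1) (d + d'))"
  proof -
    have "2 \<le> (a + a' - 1) + (b + b') + (c + c') + (d + d' - 1)" if "real a * real d' - real d * real a' \<noteq> 0"
    proof -
      have "a \<noteq> 0 \<and> d' \<noteq> 0 \<or> d \<noteq> 0 \<and> a' \<noteq> 0" using that by auto
      then show ?thesis using assms by linarith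
    qed
    moreover have "2 \<le> (a + a') + (b + b' - 1) + (c + c' - 1) + (d + d')" if "real b * real c' - real c * real b' \<noteq> 0"
    proof -
      have "b \<noteq> 0 \<and> c' \<noteq> 0 \<or> c \<noteq> 0 \<and> b' \<noteq> 0" using that by auto
      then show ?thesis using assms by linarith
    qed
    ultimately show ?thesis
      by (cases "real a * real d' - real d * real a' = 0"; cases "real b * real c' - real c * real b' = 0") simp_all
  qed
  finally show ?thesis
    using assms by (simp add: bracket.rep_eq plus_ham.rep_eq scaleR_ham.rep_eq flip: potential_inject)
qed

lemma mon_homogeneous: "a + b + c + d = l \<Longrightarrow> mon a b c d \<in> homogeneous l"
  using monom_homogeneous[of "expo a b c d"] by simp

section \<open>Invariant forms are determined by few values\<close>

lemma homogeneous_subset_if_monomials: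
  assumes "subspace U" "\<And>a b c d. a + b + c + d = l \<Longrightarrow> mon a b c d \<in> U"
  shows "homogeneous l \<subseteq> U"
proof -
  have "monom e \<in> U" if "mdeg e = l" for e
    using assms(2) that by (cases e rule: expo_exhaust) simp
  then show ?thesis
    using homogeneous_span_monomials[of l] span_minimal[OF _ assms(1), of "monom ` {a. mdeg a = l}"] by blast
qed

lemma subspace_scaleR_cancel: "subspace U \<Longrightarrow> c *\<^sub>R x \<in> U \<Longrightarrow> c \<noteq> 0 \<Longrightarrow> (x :: ham) \<in> U"
  using subspace_scale[of U "c *\<^sub>R x" "1 / c"] by simp

text \<open>
  Bracketing with \<open>x\<^sub>2 x\<^sub>4\<close>, \<open>x\<^sub>3\<^sup>2\<close> and \<open>x\<^sub>4\<^sup>2\<close> replaces one factor \<open>x\<^sub>1\<close> by \<open>x\<^sub>2\<close>, \<open>x\<^sub>2\<close> by \<open>x\<^sub>3\<close> and \<open>x\<^sub>1\<close>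
  by \<open>x\<^sub>4\<close>.  In this order each step is a single term, so a power of \<open>x\<^sub>1\<close> generates everything.
\<close>

lemma homogeneous_generated_by_power_x1:
  assumes U: "subspace U" and l: "2 \<le> l" and x1: "mon l 0 0 0 \<in> U"
    and closed: "\<And>f. f \<in> U \<Longrightarrow> bracket (mon 0 1 0 1) f \<in> U"
      "\<And>f. f \<in> U \<Longrightarrow> bracket (mon 0 0 2 0) f \<in> U" "\<And>f. f \<in> U \<Longrightarrow> bracket (mon 0 0 0 2) f \<in> U"
  shows "homogeneous l \<subseteq> U"
proof (rule homogeneous_subset_if_monomials[OF U])
  have 1: "mon a b 0 0 \<in> U" if "a + b = l" for a b
    using that
  proof (induction b arbitrary: a)
    case 0
    then show ?case using x1 by simp
  next
    case (Suc b)
    have "bracket (mon 0 1 0 1) (mon (Suc a) b 0 0) \<in> U" using Suc by (intro closed) simp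
    then have "(- real (Suc a)) *\<^sub>R mon a (Suc b) 0 0 \<in> U"
      using Suc.prems l by (simp add: bracket_mon)
    then show ?case by (rule subspace_scaleR_cancel[OF U]) simp
  qed
  have 2: "mon a b c 0 \<in> U" if "a + b + c = l" for a b c
    using that
  proof (induction c arbitrary: b)
    case 0
    then show ?case using 1 by simp
  next
    case (Suc c)
    have "bracket (mon 0 0 2 0) (mon a (Suc b) c 0) \<in> U" using Suc by (intro closed) simp
    then have "(- 2 * real (Suc b)) *\<^sub>R mon a b (Suc c) 0 \<in> U"
      using Suc.prems l by (simp add: bracket_mon)
    then show ?case by (rule subspace_scaleR_cancel[OF U]) simp
  qed
  show "mon a b c d \<in> U" if "a + b + c + d = l" for a b c d
    using that
  proof (induction d arbitrary: a)
    case 0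
    then show ?case using 2 by simp
  next
    case (Suc d)
    have "bracket (mon 0 0 0 2) (mon (Suc a) b c d) \<in> U" using Suc by (intro closed) simp
    then have "(- 2 * real (Suc a)) *\<^sub>R mon a b c (Suc d) \<in> U"
      using Suc.prems l by (simp add: bracket_mon)
    then show ?case by (rule subspace_scaleR_cancel[OF U]) simp
  qed
qed

text \<open>The same with \<open>x\<^sub>4\<close> for \<open>x\<^sub>1\<close>, now using only quadratic Hamiltonians that commute with \<open>x\<^sub>1\<close>.\<close>

lemma homogeneous_generated_by_power_x4:
  assumes U: "subspace U" and l: "2 \<le> l" and x4: "mon 0 0 0 l \<in> U"
    and closed: "\<And>f. f \<in> U \<Longrightarrow> bracket (mon 1 1 0 0) f \<in> U"
      "\<And>f. f \<in> U \<Longrightarrow> bracket (mon 0 0 2 0) f \<in> U" "\<And>f. f \<in> U \<Longrightarrow> bracket (mon 2 0 0 0) f \<in> U"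
  shows "homogeneous l \<subseteq> U"
proof (rule homogeneous_subset_if_monomials[OF U])
  have 1: "mon 0 b 0 d \<in> U" if "b + d = l" for b d
    using that
  proof (induction b arbitrary: d)
    case 0
    then show ?case using x4 by simp
  next
    case (Suc b)
    have "bracket (mon 1 1 0 0) (mon 0 b 0 (Suc d)) \<in> U" using Suc by (intro closed) simp
    then have "real (Suc d) *\<^sub>R mon 0 (Suc b) 0 d \<in> U"
      using Suc.prems l by (simp add: bracket_mon)
    then show ?case by (rule subspace_scaleR_cancel[OF U]) simp
  qed
  have 2: "mon 0 b c d \<in> U" if "b + c + d = l" for b c d
    using that
  proof (induction c arbitrary: b)
    case 0
    then show ?case using 1 by simp
  next
    case (Suc c)
    have "bracket (mon 0 0 2 0) (mon 0 (Suc b) c d) \<in> U" using Suc by (intro closed) simp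
    then have "(- 2 * real (Suc b)) *\<^sub>R mon 0 b (Suc c) d \<in> U"
      using Suc.prems l by (simp add: bracket_mon)
    then show ?case by (rule subspace_scaleR_cancel[OF U]) simp
  qed
  show "mon a b c d \<in> U" if "a + b + c + d = l" for a b c d
    using that
  proof (induction a arbitrary: d)
    case 0
    then show ?case using 2 by simp
  next
    case (Suc a)
    have "bracket (mon 2 0 0 0) (mon a b c (Suc d)) \<in> U" using Suc by (intro closed) simp
    then have "(2 * real (Suc d)) *\<^sub>R mon (Suc a) b c d \<in> U"
      using Suc.prems l by (simp add: bracket_mon)
    then show ?case by (rule subspace_scaleR_cancel[OF U]) simp
  qed
qed

text \<open>
  The first arguments that kill \<open>\<tau>\<close>, the others being homogeneous of prescribed degrees.  Bracketing with
  quadratics preserves those degrees, so this is a submodule for the invariance algebra of \<open>\<tau>\<close>, and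
  it can be shown to be everything by exhibiting a generator.
\<close>

definition annihilator :: "cochain \<Rightarrow> nat list \<Rightarrow> ham set"
  where "annihilator \<tau> ls =
    {f. \<forall>fs. list_all2 (\<lambda>g l. g \<in> homogeneous l) fs ls \<longrightarrow> \<tau> (f # fs) = 0}"

lemma subspace_annihilator:
  assumes "multilinear \<tau>"
  shows "subspace (annihilator \<tau> ls)"
proof -
  note lin = multilinear_linear_Cons[OF assms]
  show ?thesis
    unfolding annihilator_def
    by (rule subspaceI) (simp_all add: linear_0[OF lin] linear_add[OF lin] linear_scale[OF lin])
qed

lemma annihilator_closed:
  assumes "lie_sum q \<tau> = 0" "q \<in> homogeneous 2" "f \<in> annihilator \<tau> ls"
  shows "bracket q f \<in> annihilator \<tau> ls"
  unfolding annihilator_def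
proof (intro CollectI allI impI)
  fix fs assume fs: "list_all2 (\<lambda>g l. g \<in> homogeneous l) fs ls"
  have "\<tau> (f # fs[k := bracket q (fs ! k)]) = 0" if k: "k < length fs" for k
  proof -
    have "list_all2 (\<lambda>g l. g \<in> homogeneous l) (fs[k := bracket q (fs ! k)]) (ls[k := ls ! k])"
      using fs k list_all2_nthD[OF fs k] assms(2) by (intro list_all2_update_cong bracket_quadratic)
    then show ?thesis using assms(3) by (simp add: annihilator_def)
  qed
  then have "lie_sum q (interior f \<tau>) fs = 0" by (simp add: lie_sum_def interior_def)
  moreover have "lie_sum q \<tau> (f # fs) = 0" using assms(1) by simp
  ultimately show "\<tau> (bracket q f # fs) = 0" by (simp add: lie_sum_Cons)
qed

text \<open>
  Fixing an argument keeps the invariance under those \<open>q\<close> that commute with it.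
\<close>

lemma lie_sum_interior_stable:
  assumes "lie_sum q \<sigma> = 0"
  shows "lie_sum q (interior f \<sigma>) = - interior (bracket q f) \<sigma>"
proof -
  have "interior (bracket q f) \<sigma> + lie_sum q (interior f \<sigma>) = interior f (lie_sum q \<sigma>)"
    by (simp add: interior_lie_sum)
  also have "\<dots> = 0" using assms by (simp add: interior_def fun_eq_iff)
  finally show ?thesis by (simp add: eq_neg_iff_add_eq_0 add.commute)
qed

lemma interior_zero [simp]: "multilinear \<sigma> \<Longrightarrow> interior 0 \<sigma> = 0"
  using linear_0[OF multilinear_linear_Cons] by (auto simp: interior_def fun_eq_iff)

lemma relative_cochain_first_power:
  assumes \<sigma>: "\<sigma> \<in> relative_cochains m w" and l: "2 \<le> l"
    and zero: "\<And>fs. list_all2 (\<lambda>g l. g \<in> homogeneous l) fs ls \<Longrightarrow> \<sigma> (mon l 0 0 0 # fs) = 0"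
    and "f \<in> homogeneous l" "list_all2 (\<lambda>g l. g \<in> homogeneous l) fs ls"
  shows "\<sigma> (f # fs) = 0"
proof -
  have lin: "multilinear \<sigma>" and inv: "\<And>q. q \<in> homogeneous 2 \<Longrightarrow> lie_sum q \<sigma> = 0"
    using \<sigma> by (simp_all add: relative_cochains_iff form_def)
  have "homogeneous l \<subseteq> annihilator \<sigma> ls"
  proof (rule homogeneous_generated_by_power_x1[OF subspace_annihilator[OF lin] l])
    show "mon l 0 0 0 \<in> annihilator \<sigma> ls" using zero by (simp add: annihilator_def)
  qed (auto intro!: annihilator_closed inv mon_homogeneous)
  then show ?thesis using assms(4,5) by (auto simp: annihilator_def)
qed

text \<open>
  An invariant form vanishes as soon as it does with the first two arguments equal to powers of \<open>x\<^sub>1\<close>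
  and \<open>x\<^sub>4\<close>: the first generates its homogeneous component, and the second does so under the
  stabiliser of the first.
\<close>

lemma relative_cochain_first_two_powers:
  assumes \<sigma>: "\<sigma> \<in> relative_cochains m w" and kl: "2 \<le> k" "2 \<le> l"
    and zero: "\<And>fs. list_all2 (\<lambda>g l. g \<in> homogeneous l) fs ls \<Longrightarrow> \<sigma> (mon k 0 0 0 # mon 0 0 0 l # fs) = 0"
    and "f \<in> homogeneous k" "g \<in> homogeneous l" "list_all2 (\<lambda>g l. g \<in> homogeneous l) fs ls"
  shows "\<sigma> (f # g # fs) = 0"
proof (rule relative_cochain_first_power[OF \<sigma> kl(1), of "l # ls"])
  have lin: "multilinear \<sigma>" and inv: "\<And>q. q \<in> homogeneous 2 \<Longrightarrow> lie_sum q \<sigma> = 0"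
    using \<sigma> by (simp_all add: relative_cochains_iff form_def)
  let ?\<tau> = "interior (mon k 0 0 0) \<sigma>"
  have stable: "lie_sum q ?\<tau> = 0" if "q \<in> homogeneous 2" "bracket q (mon k 0 0 0) = 0" for q
    using lie_sum_interior_stable[OF inv[OF that(1)], of "mon k 0 0 0"] that(2) lin by simp
  have hom: "homogeneous l \<subseteq> annihilator ?\<tau> ls"
  proof (rule homogeneous_generated_by_power_x4[OF subspace_annihilator[OF multilinear_interior[OF lin]] kl(2)])
    show "mon 0 0 0 l \<in> annihilator ?\<tau> ls" using zero by (simp add: annihilator_def interior_def)
  qed (use kl in \<open>auto intro!: annihilator_closed stable mon_homogeneous simp: bracket_mon\<close>)
  fix hs assume "list_all2 (\<lambda>g l. g \<in> homogeneous l) hs (l # ls)"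
  then show "\<sigma> (mon k 0 0 0 # hs) = 0"
    using hom by (auto simp: list_all2_Cons2 annihilator_def interior_def)
qed (use assms(5-7) in simp_all)

lemma multilinear_simps:
  assumes "multilinear \<sigma>"
  shows "\<sigma> ((f + g) # vs) = \<sigma> (f # vs) + \<sigma> (g # vs)" "\<sigma> ((r *\<^sub>R f) # vs) = r * \<sigma> (f # vs)"
    "\<sigma> ((f - g) # vs) = \<sigma> (f # vs) - \<sigma> (g # vs)"
    "\<sigma> ((- f) # vs) = - \<sigma> (f # vs)" "\<sigma> (0 # vs) = 0"
    "\<sigma> (a # (f + g) # vs) = \<sigma> (a # f # vs) + \<sigma> (a # g # vs)" "\<sigma> (a # (r *\<^sub>R f) # vs) = r * \<sigma> (a # f # vs)"
    "\<sigma> (a # (f - g) # vs) = \<sigma> (a # f # vs) - \<sigma> (a # g # vs)"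
    "\<sigma> (a # (- f) # vs) = - \<sigma> (a # f # vs)" "\<sigma> (a # 0 # vs) = 0"
    "\<sigma> (a # b # (f + g) # vs) = \<sigma> (a # b # f # vs) + \<sigma> (a # b # g # vs)"
    "\<sigma> (a # b # (r *\<^sub>R f) # vs) = r * \<sigma> (a # b # f # vs)"
    "\<sigma> (a # b # (f - g) # vs) = \<sigma> (a # b # f # vs) - \<sigma> (a # b # g # vs)"
    "\<sigma> (a # b # (- f) # vs) = - \<sigma> (a # b # f # vs)" "\<sigma> (a # b # 0 # vs) = 0"
    "\<sigma> (a # b # c # (f + g) # vs) = \<sigma> (a # b # c # f # vs) + \<sigma> (a # b # c # g # vs)"
    "\<sigma> (a # b # c # (r *\<^sub>R f) # vs) = r * \<sigma> (a # b # c # f # vs)"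
    "\<sigma> (a # b # c # (f - g) # vs) = \<sigma> (a # b # c # f # vs) - \<sigma> (a # b # c # g # vs)"
    "\<sigma> (a # b # c # (- f) # vs) = - \<sigma> (a # b # c # f # vs)" "\<sigma> (a # b # c # 0 # vs) = 0"
proof -
  have L: "linear (\<lambda>f. \<sigma> (f # vs))" "linear (\<lambda>f. \<sigma> (a # f # vs))"
    "linear (\<lambda>f. \<sigma> (a # b # f # vs))" "linear (\<lambda>f. \<sigma> (a # b # c # f # vs))"
    using multilinear_linear[OF assms, of "[]" vs] multilinear_linear[OF assms, of "[a]" vs]
      multilinear_linear[OF assms, of "[a, b]" vs] multilinear_linear[OF assms, of "[a, b, c]" vs] by simp_all
  show "\<sigma> ((f + g) # vs) = \<sigma> (f # vs) + \<sigma> (g # vs)" "\<sigma> ((r *\<^sub>R f) # vs) = r * \<sigma> (f # vs)"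
    "\<sigma> ((f - g) # vs) = \<sigma> (f # vs) - \<sigma> (g # vs)"
    "\<sigma> ((- f) # vs) = - \<sigma> (f # vs)" "\<sigma> (0 # vs) = 0"
    "\<sigma> (a # (f + g) # vs) = \<sigma> (a # f # vs) + \<sigma> (a # g # vs)" "\<sigma> (a # (r *\<^sub>R f) # vs) = r * \<sigma> (a # f # vs)"
    "\<sigma> (a # (f - g) # vs) = \<sigma> (a # f # vs) - \<sigma> (a # g # vs)"
    "\<sigma> (a # (- f) # vs) = - \<sigma> (a # f # vs)" "\<sigma> (a # 0 # vs) = 0"
    "\<sigma> (a # b # (f + g) # vs) = \<sigma> (a # b # f # vs) + \<sigma> (a # b # g # vs)"
    "\<sigma> (a # b # (r *\<^sub>R f) # vs) = r * \<sigma> (a # b # f # vs)"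
    "\<sigma> (a # b # (f - g) # vs) = \<sigma> (a # b # f # vs) - \<sigma> (a # b # g # vs)"
    "\<sigma> (a # b # (- f) # vs) = - \<sigma> (a # b # f # vs)" "\<sigma> (a # b # 0 # vs) = 0"
    "\<sigma> (a # b # c # (f + g) # vs) = \<sigma> (a # b # c # f # vs) + \<sigma> (a # b # c # g # vs)"
    "\<sigma> (a # b # c # (r *\<^sub>R f) # vs) = r * \<sigma> (a # b # c # f # vs)"
    "\<sigma> (a # b # c # (f - g) # vs) = \<sigma> (a # b # c # f # vs) - \<sigma> (a # b # c # g # vs)"
    "\<sigma> (a # b # c # (- f) # vs) = - \<sigma> (a # b # c # f # vs)" "\<sigma> (a # b # c # 0 # vs) = 0"
    using linear_add[OF L(1)] linear_scale[OF L(1)] linear_diff[OF L(1)] linear_neg[OF L(1)] linear_0[OF L(1)]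
      linear_add[OF L(2)] linear_scale[OF L(2)] linear_diff[OF L(2)] linear_neg[OF L(2)] linear_0[OF L(2)]
      linear_add[OF L(3)] linear_scale[OF L(3)] linear_diff[OF L(3)] linear_neg[OF L(3)] linear_0[OF L(3)]
      linear_add[OF L(4)] linear_scale[OF L(4)] linear_diff[OF L(4)] linear_neg[OF L(4)] linear_0[OF L(4)]
    by simp_all
qed

lemma relative_cochain_invariant:
  assumes "\<sigma> \<in> relative_cochains m w" "a + b + c + d = 2"
  shows "lie_sum (mon a b c d) \<sigma> fs = 0"
  using assms mon_homogeneous[of a b c d 2] by (simp add: relative_cochains_iff)

text \<open>
  The powers \<open>x\<^sub>1\<^sup>k\<close> and \<open>x\<^sub>4\<^sup>k\<close> are fixed by the quadratic Hamiltonians in \<open>x\<^sub>2, x\<^sub>3\<close> and have opposite weights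
  for \<open>x\<^sub>1 x\<^sub>4\<close>, so the form in the remaining arguments is still invariant under these.
\<close>

lemma relative_cochain_residual_invariance:
  assumes \<sigma>: "\<sigma> \<in> relative_cochains m w" and k: "2 \<le> k"
  defines "\<tau> \<equiv> interior (mon 0 0 0 k) (interior (mon k 0 0 0) \<sigma>)"
  shows "lie_sum (mon 0 2 0 0) \<tau> = 0" "lie_sum (mon 0 0 2 0) \<tau> = 0"
    "lie_sum (mon 0 1 1 0) \<tau> = 0" "lie_sum (mon 1 0 0 1) \<tau> = 0"
proof -
  have lin: "multilinear \<sigma>" using \<sigma> by (simp add: relative_cochains_iff form_def)
  have inv: "lie_sum q \<sigma> = 0" if "q \<in> homogeneous 2" for q
    using \<sigma> that by (simp add: relative_cochains_iff)
  have stable: "lie_sum q \<tau> = 0"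
    if q: "q \<in> homogeneous 2" and br: "bracket q (mon k 0 0 0) = (- r) *\<^sub>R mon k 0 0 0"
      "bracket q (mon 0 0 0 k) = r *\<^sub>R mon 0 0 0 k" for q r
  proof -
    let ?\<sigma>1 = "interior (mon k 0 0 0) \<sigma>"
    have 1: "lie_sum q ?\<sigma>1 = r *\<^sub>R ?\<sigma>1"
      using lie_sum_interior_stable[OF inv[OF q], of "mon k 0 0 0"]
      unfolding br interior_linear(2)[OF lin] by simp
    have "interior (bracket q (mon 0 0 0 k)) ?\<sigma>1 + lie_sum q \<tau> = interior (mon 0 0 0 k) (lie_sum q ?\<sigma>1)"
      by (simp add: interior_lie_sum \<tau>_def)
    moreover have "interior (bracket q (mon 0 0 0 k)) ?\<sigma>1 = r *\<^sub>R \<tau>"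
      unfolding br interior_linear(2)[OF multilinear_interior[OF lin]] \<tau>_def ..
    moreover have "interior (mon 0 0 0 k) (lie_sum q ?\<sigma>1) = r *\<^sub>R \<tau>"
      unfolding 1 by (simp add: \<tau>_def interior_def scaleR_fun_def)
    ultimately show ?thesis by simp
  qed
  show "lie_sum (mon 0 2 0 0) \<tau> = 0" "lie_sum (mon 0 0 2 0) \<tau> = 0" "lie_sum (mon 0 1 1 0) \<tau> = 0"
    using k by (intro stable[of _ 0] mon_homogeneous; simp add: bracket_mon)+
  show "lie_sum (mon 1 0 0 1) \<tau> = 0"
    using k by (intro stable[of _ "real k"] mon_homogeneous) (simp_all add: bracket_mon)
qed

lemma alternating_swap:
  assumes "alternating \<sigma>"
  shows "\<sigma> (f # g # fs) = - \<sigma> (g # f # fs)" "\<sigma> (a # f # g # fs) = - \<sigma> (a # g # f # fs)"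
    "\<sigma> (a # b # f # g # fs) = - \<sigma> (a # b # g # f # fs)"
  using alternatingD[OF assms, of "[]" f g fs] alternatingD[OF assms, of "[a]" f g fs]
    alternatingD[OF assms, of "[a, b]" f g fs] by simp_all

lemma alternating_repeat:
  assumes "alternating \<sigma>"
  shows "\<sigma> (f # f # fs) = 0" "\<sigma> (a # f # f # fs) = 0" "\<sigma> (f # b # f # fs) = 0"
    "\<sigma> (a # f # b # f # fs) = 0" "\<sigma> (f # a # b # f # fs) = 0"
proof -
  have 1: "\<sigma> (f # f # fs) = 0" for f fs
    using alternating_swap(1)[OF assms, of f f fs] by linarith
  have 2: "\<sigma> (a # f # f # fs) = 0" for a f fs
    using alternating_swap(2)[OF assms, of a f f fs] by linarith
  have 3: "\<sigma> (f # b # f # fs) = 0" for f b fs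
    using alternating_swap(1)[OF assms, of f b "f # fs"] 2[of b f fs] by linarith
  have 4: "\<sigma> (a # f # b # f # fs) = 0" for a f b fs
    using alternating_swap(3)[OF assms, of a f b f fs] alternating_swap(2)[OF assms, of a f f "b # fs"]
    by linarith
  show "\<sigma> (f # f # fs) = 0" "\<sigma> (a # f # f # fs) = 0" "\<sigma> (f # b # f # fs) = 0"
    "\<sigma> (a # f # b # f # fs) = 0" by (rule 1 2 3 4)+
  show "\<sigma> (f # a # b # f # fs) = 0"
    using alternating_swap(1)[OF assms, of f a "b # f # fs"] 4[of a f b fs] by linarith
qed

lemma relative_cochains_eq_0I:
  assumes "\<And>\<sigma>. \<sigma> \<in> relative_cochains m w \<Longrightarrow> \<sigma> = 0"
  shows "relative_cochains m w = {0}"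
proof (intro equalityI subsetI)
  fix \<sigma> assume "\<sigma> \<in> relative_cochains m w"
  then have "\<sigma> = 0" by (rule assms)
  then show "\<sigma> \<in> {0}" by (simp only: singleton_iff)
next
  fix \<sigma> :: cochain assume "\<sigma> \<in> {0}"
  then have "\<sigma> = 0" by (simp only: singleton_iff)
  then show "\<sigma> \<in> relative_cochains m w"
    by (simp only: subspace_0[OF subspace_relative_cochains])
qed

lemma relative_cochains_0_4: "relative_cochains 0 4 = {0}"
proof -
  have "\<sigma> = 0" if "\<sigma> \<in> relative_cochains 0 4" for \<sigma>
    using that by (rule relative_cochain_eqI) simp
  then show ?thesis by (rule relative_cochains_eq_0I)
qed

text \<open>
  The form is determined by its value at \<open>x\<^sub>1\<^sup>6\<close>, which has nonzero weight for \<open>x\<^sub>1 x\<^sub>4\<close>.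
\<close>

lemma relative_cochains_1_4: "relative_cochains 1 4 = {0}"
proof -
  have "\<sigma> = 0" if \<sigma>: "\<sigma> \<in> relative_cochains 1 4" for \<sigma>
  proof (rule relative_cochain_eqI[OF \<sigma>])
    have lin: "multilinear \<sigma>" using \<sigma> by (simp add: relative_cochains_iff form_def)
    have "lie_sum (mon 1 0 0 1) \<sigma> [mon 6 0 0 0] = 0"
      by (rule relative_cochain_invariant[OF \<sigma>]) simp
    then have "\<sigma> [mon 6 0 0 0] = 0"
      by (simp add: lie_sum_Cons bracket_mon multilinear_simps[OF lin])
    then have *: "\<sigma> [f] = 0" if "f \<in> homogeneous 6" for f
      using that by - (rule relative_cochain_first_power[OF \<sigma>, of 6 "[]"], simp_all)
    fix as :: "(4 \<Rightarrow>\<^sub>0 nat) list"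
    assume "length as = 1" "sum_list (map mdeg as) = 4 + 2 * 1"
    then obtain a where "as = [a]" "mdeg a = 6" by (auto simp: length_Suc_conv)
    then show "\<sigma> (map monom as) = 0" using *[of "monom a"] monom_homogeneous[of a] by simp
  qed
  then show ?thesis by (rule relative_cochains_eq_0I)
qed

text \<open>
  On \<open>S\<^sub>3 \<and> S\<^sub>5\<close> the value at \<open>x\<^sub>1\<^sup>3, x\<^sub>4\<^sup>5\<close> has nonzero weight for \<open>x\<^sub>1 x\<^sub>4\<close>.  On \<open>\<Lambda>\<^sup>2 S\<^sub>4\<close> moving factors
  from \<open>x\<^sub>1\<close> to \<open>x\<^sub>4\<close> leads from \<open>x\<^sub>1\<^sup>4, x\<^sub>4\<^sup>4\<close> to the repeated argument \<open>x\<^sub>1\<^sup>2 x\<^sub>4\<^sup>2\<close>.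
\<close>

lemma relative_cochains_2_4: "relative_cochains 2 4 = {0}"
proof -
  have "\<sigma> = 0" if \<sigma>: "\<sigma> \<in> relative_cochains 2 4" for \<sigma>
  proof (rule relative_cochain_eqI[OF \<sigma>])
    have lin: "multilinear \<sigma>" and alt: "alternating \<sigma>"
      using \<sigma> by (simp_all add: relative_cochains_iff form_def)
    note simps = numeral_2_eq_2[symmetric] lie_sum_Cons interior_def bracket_mon multilinear_simps[OF lin]
    have "lie_sum (mon 1 0 0 1) \<sigma> [mon 3 0 0 0, mon 0 0 0 5] = 0"
      by (rule relative_cochain_invariant[OF \<sigma>]) simp
    then have "\<sigma> [mon 3 0 0 0, mon 0 0 0 5] = 0" by (simp add: simps)
    then have 35: "\<sigma> [f, g] = 0" if "f \<in> homogeneous 3" "g \<in> homogeneous 5" for f g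
      using that by - (rule relative_cochain_first_two_powers[OF \<sigma>, of 3 5 "[]"], simp_all)
    have 1: "lie_sum (mon 0 0 0 2) \<sigma> [mon 4 0 0 0, mon 1 0 0 3] = 0"
      "lie_sum (mon 0 0 0 2) \<sigma> [mon 3 0 0 1, mon 2 0 0 2] = 0"
      by (rule relative_cochain_invariant[OF \<sigma>]; simp)+
    have "\<sigma> [mon 4 0 0 0, mon 0 0 0 4] = 0"
      using 1 by (simp add: simps alternating_repeat[OF alt])
    then have 44: "\<sigma> [f, g] = 0" if "f \<in> homogeneous 4" "g \<in> homogeneous 4" for f g
      using that by - (rule relative_cochain_first_two_powers[OF \<sigma>, of 4 4 "[]"], simp_all)
    fix as :: "(4 \<Rightarrow>\<^sub>0 nat) list"
    assume as: "length as = 2" "\<forall>a\<in>set as. 3 \<le> mdeg a" "sum_list (map mdeg as) = 4 + 2 * 2"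
    then obtain a b where ab: "as = [a, b]" by (auto simp: length_Suc_conv numeral_2_eq_2)
    then have "3 \<le> mdeg a" "3 \<le> mdeg b" "mdeg a + mdeg b = 8" using as by simp_all
    then consider "mdeg a = 3 \<and> mdeg b = 5" | "mdeg a = 4 \<and> mdeg b = 4" | "mdeg a = 5 \<and> mdeg b = 3"
      by linarith
    then show "\<sigma> (map monom as) = 0"
    proof cases
      case 1
      then show ?thesis using 35[of "monom a" "monom b"] monom_homogeneous[of a] monom_homogeneous[of b]
        by (simp add: ab)
    next
      case 2
      then show ?thesis using 44[of "monom a" "monom b"] monom_homogeneous[of a] monom_homogeneous[of b]
        by (simp add: ab)
    next
      case 3
      then show ?thesis
        using 35[of "monom b" "monom a"] monom_homogeneous[of a] monom_homogeneous[of b]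
          alternating_swap(1)[OF alt, of "monom a" "monom b" "[]"] by (simp add: ab)
    qed
  qed
  then show ?thesis by (rule relative_cochains_eq_0I)
qed

text \<open>
  The residual form in the one remaining quartic has weight zero, which leaves \<open>x\<^sub>1\<^sup>2 x\<^sub>4\<^sup>2\<close>,
  \<open>x\<^sub>1 x\<^sub>2 x\<^sub>3 x\<^sub>4\<close> and \<open>x\<^sub>2\<^sup>2 x\<^sub>3\<^sup>2\<close>, and the last two are brackets with \<open>x\<^sub>2\<^sup>2\<close>.
\<close>

lemma relative_cochain_3_4_eq_0:
  assumes \<sigma>: "\<sigma> \<in> relative_cochains 3 4"
    and zero: "\<sigma> [mon 3 0 0 0, mon 0 0 0 3, mon 2 0 0 2] = 0"
  shows "\<sigma> = 0"
proof (rule relative_cochain_eqI[OF \<sigma>])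
  have lin: "multilinear \<sigma>" and alt: "alternating \<sigma>"
    using \<sigma> by (simp_all add: relative_cochains_iff form_def)
  define \<tau> where "\<tau> = interior (mon 0 0 0 3) (interior (mon 3 0 0 0) \<sigma>)"
  have lin': "multilinear \<tau>" unfolding \<tau>_def by (intro multilinear_interior lin)
  note inv = relative_cochain_residual_invariance[OF \<sigma>, of 3, folded \<tau>_def, simplified]
  note simps = numeral_2_eq_2[symmetric] lie_sum_Cons bracket_mon multilinear_simps[OF lin']
  have mon: "\<tau> [mon a b c d] = 0" if deg: "a + b + c + d = 4" for a b c d
  proof -
    have "lie_sum (mon 1 0 0 1) \<tau> [mon a b c d] = 0" "lie_sum (mon 0 1 1 0) \<tau> [mon a b c d] = 0"
      using inv by simp_all
    moreover have "bracket (mon 1 0 0 1) (mon a b c d) = (real d - real a) *\<^sub>R mon a b c d"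
      "bracket (mon 0 1 1 0) (mon a b c d) = (real c - real b) *\<^sub>R mon a b c d"
      using that by (simp_all add: bracket_mon)
    ultimately have w: "(real d - real a) * \<tau> [mon a b c d] = 0" "(real c - real b) * \<tau> [mon a b c d] = 0"
      by (simp_all only: lie_sum_Cons lie_sum_Nil multilinear_simps[OF lin'] add_0_right)
    have 1: "\<tau> [mon 1 1 1 1] = 0" "\<tau> [mon 0 2 2 0] = 0"
    proof -
      have "lie_sum (mon 0 2 0 0) \<tau> [mon 1 0 2 1] = 0" "lie_sum (mon 0 2 0 0) \<tau> [mon 0 1 3 0] = 0"
        using inv by simp_all
      then show "\<tau> [mon 1 1 1 1] = 0" "\<tau> [mon 0 2 2 0] = 0" by (simp_all add: simps)
    qed
    have 2: "\<tau> [mon 2 0 0 2] = 0" using zero by (simp add: \<tau>_def interior_def)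
    show ?thesis
    proof (cases "d = a \<and> c = b")
      case True
      then consider "a = 2 \<and> b = 0" | "a = 1 \<and> b = 1" | "a = 0 \<and> b = 2" using deg by linarith
      then show ?thesis using True 1 2 by cases simp_all
    qed (use w in auto)
  qed
  have "homogeneous 4 \<subseteq> annihilator \<tau> []"
    by (rule homogeneous_subset_if_monomials[OF subspace_annihilator[OF lin']])
      (simp add: annihilator_def mon)
  then have "\<sigma> [mon 3 0 0 0, mon 0 0 0 3, h] = 0" if "h \<in> homogeneous 4" for h
    using that by (auto simp: annihilator_def \<tau>_def interior_def)
  then have 334: "\<sigma> [f, g, h] = 0" if "f \<in> homogeneous 3" "g \<in> homogeneous 3" "h \<in> homogeneous 4" for f g h
    using that
    by - (rule relative_cochain_first_two_powers[OF \<sigma>, of 3 3 "[4]"], auto simp: list_all2_Cons2)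
  fix as :: "(4 \<Rightarrow>\<^sub>0 nat) list"
  assume as: "length as = 3" "\<forall>a\<in>set as. 3 \<le> mdeg a" "sum_list (map mdeg as) = 4 + 2 * 3"
  then obtain a b c where abc: "as = [a, b, c]" by (auto simp: length_Suc_conv numeral_3_eq_3)
  then have "3 \<le> mdeg a" "3 \<le> mdeg b" "3 \<le> mdeg c" "mdeg a + mdeg b + mdeg c = 10" using as by simp_all
  then consider "mdeg a = 3 \<and> mdeg b = 3 \<and> mdeg c = 4" | "mdeg a = 3 \<and> mdeg b = 4 \<and> mdeg c = 3"
    | "mdeg a = 4 \<and> mdeg b = 3 \<and> mdeg c = 3"
    by linarith
  then show "\<sigma> (map monom as) = 0"
  proof cases
    case 1
    then show ?thesis using 334[of "monom a" "monom b" "monom c"] monom_homogeneous[of a]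
        monom_homogeneous[of b] monom_homogeneous[of c] by (simp add: abc)
  next
    case 2
    then show ?thesis using 334[of "monom a" "monom c" "monom b"] monom_homogeneous[of a]
        monom_homogeneous[of b] monom_homogeneous[of c]
        alternating_swap(2)[OF alt, of "monom a" "monom b" "monom c" "[]"] by (simp add: abc)
  next
    case 3
    then show ?thesis using 334[of "monom b" "monom c" "monom a"] monom_homogeneous[of a]
        monom_homogeneous[of b] monom_homogeneous[of c]
        alternating_swap(1)[OF alt, of "monom a" "monom b" "[monom c]"]
        alternating_swap(2)[OF alt, of "monom b" "monom a" "monom c" "[]"] by (simp add: abc)
  qed
qed

text \<open>
  Of the five values that the residual form leaves over, two are linear combinations of the others.
  These relations come from \<open>x\<^sub>1 x\<^sub>3\<close> and \<open>x\<^sub>1\<^sup>2\<close>, which fix \<open>x\<^sub>1\<^sup>3\<close> but not \<open>x\<^sub>4\<^sup>3\<close>.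
\<close>

lemma relative_cochain_4_4_relations:
  assumes \<sigma>: "\<sigma> \<in> relative_cochains 4 4"
  defines "v \<equiv> \<lambda>f g. \<sigma> [mon 3 0 0 0, mon 0 0 0 3, f, g]"
  shows "v (mon 1 2 0 0) (mon 0 0 2 1) = v (mon 2 1 0 0) (mon 0 0 1 2)"
    and "v (mon 2 0 0 1) (mon 1 0 0 2) = v (mon 2 1 0 0) (mon 0 0 1 2) + 4 * v (mon 1 1 0 1) (mon 1 0 1 1)"
proof -
  have lin: "multilinear \<sigma>" and alt: "alternating \<sigma>"
    using \<sigma> by (simp_all add: relative_cochains_iff form_def)
  define \<tau> where "\<tau> = interior (mon 0 0 0 3) (interior (mon 3 0 0 0) \<sigma>)"
  have lin': "multilinear \<tau>" unfolding \<tau>_def by (intro multilinear_interior lin)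
  note inv = relative_cochain_residual_invariance[OF \<sigma>, of 3, folded \<tau>_def, simplified]
  note simps = numeral_2_eq_2[symmetric] lie_sum_Cons interior_def bracket_mon multilinear_simps[OF lin]
  have "lie_sum (mon 1 0 1 0) \<sigma> [mon 3 0 0 0, mon 0 0 0 3, mon 1 2 0 0, mon 0 0 1 2] = 0"
    by (rule relative_cochain_invariant[OF \<sigma>]) simp
  then show "v (mon 1 2 0 0) (mon 0 0 2 1) = v (mon 2 1 0 0) (mon 0 0 1 2)"
    by (simp add: simps v_def alternating_repeat[OF alt])
  \<comment> \<open>Both equations contain the value at \<open>x\<^sub>1\<^sup>3, x\<^sub>3 x\<^sub>4\<^sup>2, x\<^sub>1 x\<^sub>2 x\<^sub>4, x\<^sub>1 x\<^sub>4\<^sup>2\<close>, which is then eliminated.\<close>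
  have 1: "lie_sum (mon 1 0 1 0) \<sigma> [mon 3 0 0 0, mon 0 0 0 3, mon 1 1 0 1, mon 1 0 0 2] = 0"
    "lie_sum (mon 2 0 0 0) \<sigma> [mon 3 0 0 0, mon 0 0 0 3, mon 1 1 0 1, mon 0 0 1 2] = 0"
    by (rule relative_cochain_invariant[OF \<sigma>]; simp)+
  have "lie_sum (mon 0 0 2 0) \<tau> [mon 1 1 1 0, mon 1 0 0 2] = 0"
    "lie_sum (mon 0 2 0 0) \<tau> [mon 1 0 2 0, mon 1 0 0 2] = 0"
    using inv by simp_all
  then have 2: "v (mon 1 1 1 0) (mon 1 0 0 2) = 0"
    by (simp add: numeral_2_eq_2[symmetric] lie_sum_Cons interior_def bracket_mon multilinear_simps[OF lin'])
      (simp add: v_def \<tau>_def interior_def)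
  have 3: "\<sigma> [mon 3 0 0 0, mon 1 0 0 2, mon 1 1 0 1, mon 0 0 1 2] =
      - \<sigma> [mon 3 0 0 0, mon 0 0 1 2, mon 1 1 0 1, mon 1 0 0 2]"
    "\<sigma> [mon 3 0 0 0, mon 0 0 0 3, mon 2 0 0 1, mon 1 0 0 2] = v (mon 2 0 0 1) (mon 1 0 0 2)"
    using alternating_swap(2)[OF alt, of "mon 3 0 0 0" "mon 1 0 0 2" "mon 1 1 0 1" "[mon 0 0 1 2]"]
      alternating_swap(3)[OF alt, of "mon 3 0 0 0" "mon 1 1 0 1" "mon 1 0 0 2" "mon 0 0 1 2" "[]"]
      alternating_swap(2)[OF alt, of "mon 3 0 0 0" "mon 1 1 0 1" "mon 0 0 1 2" "[mon 1 0 0 2]"]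
    by (simp_all add: v_def)
  show "v (mon 2 0 0 1) (mon 1 0 0 2) = v (mon 2 1 0 0) (mon 0 0 1 2) + 4 * v (mon 1 1 0 1) (mon 1 0 1 1)"
    using 1 2 3 by (simp add: simps v_def)
qed

definition cubic_exponents :: "(nat \<times> nat \<times> nat \<times> nat) set"
  where "cubic_exponents = {(3,0,0,0), (0,3,0,0), (0,0,3,0), (0,0,0,3),
    (2,1,0,0), (2,0,1,0), (2,0,0,1), (1,2,0,0), (0,2,1,0), (0,2,0,1),
    (1,0,2,0), (0,1,2,0), (0,0,2,1), (1,0,0,2), (0,1,0,2), (0,0,1,2),
    (1,1,1,0), (1,1,0,1), (1,0,1,1), (0,1,1,1)}"

lemma in_cubic_exponents:
  assumes "a + b + c + d = 3"
  shows "(a, b, c, d) \<in> cubic_exponents"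
proof -
  have "a = 0 \<or> a = 1 \<or> a = 2 \<or> a = 3" "b = 0 \<or> b = 1 \<or> b = 2 \<or> b = 3" "c = 0 \<or> c = 1 \<or> c = 2 \<or> c = 3"
    using assms by linarith+
  then show ?thesis unfolding cubic_exponents_def using assms by (elim disjE) simp_all
qed

text \<open>
  Let \<open>\<tau>\<close> be the residual form, evaluated at two cubic monomials.  Invariance under \<open>x\<^sub>1 x\<^sub>4\<close> and \<open>x\<^sub>2 x\<^sub>3\<close>
  leaves the pairs of total weight zero.  For fixed exponents of \<open>x\<^sub>1\<close> and \<open>x\<^sub>4\<close>, invariance under \<open>x\<^sub>2\<^sup>2\<close>
  and \<open>x\<^sub>3\<^sup>2\<close> pairs binary forms in \<open>x\<^sub>2, x\<^sub>3\<close> of equal degree only, and then one value determines all.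
  The five pairs that remain reduce to three by \<open>relative_cochain_4_4_relations\<close>.
\<close>

lemma relative_cochain_4_4_eq_0:
  assumes \<sigma>: "\<sigma> \<in> relative_cochains 4 4"
    and zero: "\<sigma> [mon 3 0 0 0, mon 0 0 0 3, mon 2 0 0 1, mon 1 0 0 2] = 0"
      "\<sigma> [mon 3 0 0 0, mon 0 0 0 3, mon 2 1 0 0, mon 0 0 1 2] = 0"
      "\<sigma> [mon 3 0 0 0, mon 0 0 0 3, mon 0 3 0 0, mon 0 0 3 0] = 0"
  shows "\<sigma> = 0"
proof (rule relative_cochain_eqI[OF \<sigma>])
  have lin: "multilinear \<sigma>" and alt: "alternating \<sigma>"
    using \<sigma> by (simp_all add: relative_cochains_iff form_def)
  define \<tau> where "\<tau> = interior (mon 0 0 0 3) (interior (mon 3 0 0 0) \<sigma>)"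
  have lin': "multilinear \<tau>" unfolding \<tau>_def by (intro multilinear_interior lin)
  have alt': "alternating \<tau>" unfolding \<tau>_def by (intro alternating_interior alt)
  note inv = relative_cochain_residual_invariance[OF \<sigma>, of 3, folded \<tau>_def, simplified]
  note simps = numeral_2_eq_2[symmetric] lie_sum_Cons interior_def bracket_mon multilinear_simps[OF lin']
  note rel = relative_cochain_4_4_relations[OF \<sigma>]
  have five: "\<tau> [mon 2 0 0 1, mon 1 0 0 2] = 0" "\<tau> [mon 2 1 0 0, mon 0 0 1 2] = 0"
    "\<tau> [mon 1 1 0 1, mon 1 0 1 1] = 0" "\<tau> [mon 1 2 0 0, mon 0 0 2 1] = 0" "\<tau> [mon 0 3 0 0, mon 0 0 3 0] = 0"
    using zero rel by (simp_all add: \<tau>_def interior_def)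
  have x1: "\<tau> [mon 3 0 0 0, g] = 0" for g
    using alternating_repeat(3)[OF alt, of "mon 3 0 0 0" "mon 0 0 0 3" "[g]"] by (simp add: \<tau>_def interior_def)
  have "lie_sum (mon 0 2 0 0) \<tau> fs = 0" "lie_sum (mon 0 0 2 0) \<tau> fs = 0" for fs
    using inv by simp_all
  \<comment> \<open>One equation for each of the eight pairs in the next fact; later ones use the values found before.\<close>
  note eqs = this(1)[of "[mon 2 0 0 1, mon 0 0 2 1]"] this(1)[of "[mon 1 0 0 2, mon 1 0 2 0]"]
    this(1)[of "[mon 2 0 1 0, mon 0 0 1 2]"] this(1)[of "[mon 1 1 1 0, mon 0 0 2 1]"]
    this(1)[of "[mon 1 0 2 0, mon 0 1 1 1]"] this(1)[of "[mon 1 1 0 1, mon 0 0 3 0]"]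
    this(2)[of "[mon 1 0 1 1, mon 0 3 0 0]"] this(1)[of "[mon 0 2 1 0, mon 0 0 3 0]"]
  have rest: "\<tau> [mon 2 0 0 1, mon 0 1 1 1] = 0" "\<tau> [mon 1 0 0 2, mon 1 1 1 0] = 0"
    "\<tau> [mon 2 0 1 0, mon 0 1 0 2] = 0" "\<tau> [mon 1 1 1 0, mon 0 1 1 1] = 0"
    "\<tau> [mon 1 0 2 0, mon 0 2 0 1] = 0" "\<tau> [mon 1 1 0 1, mon 0 1 2 0] = 0"
    "\<tau> [mon 1 0 1 1, mon 0 2 1 0] = 0" "\<tau> [mon 0 2 1 0, mon 0 1 2 0] = 0"
    using eqs five by (simp_all add: simps)
  have x1': "\<tau> [g, mon 3 0 0 0] = 0" for g
    using x1 alternating_swap(1)[OF alt', of g "mon 3 0 0 0" "[]"] by simp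
  have swap: "\<tau> [f, g] = 0" if "\<tau> [g, f] = 0" for f g
    using that alternating_swap(1)[OF alt', of f g "[]"] by simp
  note all = five rest five[THEN swap] rest[THEN swap] x1 x1'
  have mon: "\<tau> [mon a b c d, mon a' b' c' d'] = 0"
    if deg: "a + b + c + d = 3" "a' + b' + c' + d' = 3" for a b c d a' b' c' d'
  proof -
    have "lie_sum (mon 1 0 0 1) \<tau> [mon a b c d, mon a' b' c' d'] = 0"
      "lie_sum (mon 0 1 1 0) \<tau> [mon a b c d, mon a' b' c' d'] = 0"
      using inv by simp_all
    moreover have
      "bracket (mon 1 0 0 1) (mon a b c d) = (real d - real a) *\<^sub>R mon a b c d"
      "bracket (mon 1 0 0 1) (mon a' b' c' d') = (real d' - real a') *\<^sub>R mon a' b' c' d'"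
      "bracket (mon 0 1 1 0) (mon a b c d) = (real c - real b) *\<^sub>R mon a b c d"
      "bracket (mon 0 1 1 0) (mon a' b' c' d') = (real c' - real b') *\<^sub>R mon a' b' c' d'"
      using deg by (simp_all add: bracket_mon)
    ultimately have w: "(real d - real a + (real d' - real a')) * \<tau> [mon a b c d, mon a' b' c' d'] = 0"
      "(real c - real b + (real c' - real b')) * \<tau> [mon a b c d, mon a' b' c' d'] = 0"
      by (simp_all only: lie_sum_Cons lie_sum_Nil interior_def multilinear_simps[OF lin'] add_0_right distrib_right)
    show ?thesis
    proof (cases "d + d' = a + a' \<and> c + c' = b + b'")
      case True
      have "\<forall>(a, b, c, d)\<in>cubic_exponents. \<forall>(a', b', c', d')\<in>cubic_exponents.
          d + d' = a + a' \<longrightarrow> c + c' = b + b' \<longrightarrow> \<tau> [mon a b c d, mon a' b' c' d'] = 0"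
        by (simp add: cubic_exponents_def all[unfolded One_nat_def] numeral_2_eq_2[symmetric])
      then show ?thesis
        using in_cubic_exponents[OF deg(1)] in_cubic_exponents[OF deg(2)] True by fastforce
    next
      case False
      then have "real d - real a + (real d' - real a') \<noteq> 0 \<or> real c - real b + (real c' - real b') \<noteq> 0"
        by linarith
      then show ?thesis using w by auto
    qed
  qed
  have "\<tau> [mon a b c d, g] = 0" if "a + b + c + d = 3" "g \<in> homogeneous 3" for a b c d g
  proof -
    have "homogeneous 3 \<subseteq> annihilator (interior (mon a b c d) \<tau>) []"
      by (rule homogeneous_subset_if_monomials[OF subspace_annihilator[OF multilinear_interior[OF lin']]])
        (simp add: annihilator_def interior_def mon that(1))
    then show ?thesis using that(2) by (auto simp: annihilator_def interior_def)
  qed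
  then have "homogeneous 3 \<subseteq> annihilator \<tau> [3]"
    by - (rule homogeneous_subset_if_monomials[OF subspace_annihilator[OF lin']],
        auto simp: annihilator_def list_all2_Cons2)
  then have "\<sigma> [mon 3 0 0 0, mon 0 0 0 3, f, g] = 0" if "f \<in> homogeneous 3" "g \<in> homogeneous 3" for f g
    using that by (auto simp: annihilator_def \<tau>_def interior_def list_all2_Cons2)
  then have *: "\<sigma> [f, g, h, k] = 0"
    if "f \<in> homogeneous 3" "g \<in> homogeneous 3" "h \<in> homogeneous 3" "k \<in> homogeneous 3" for f g h k
    using that
    by - (rule relative_cochain_first_two_powers[OF \<sigma>, of 3 3 "[3, 3]"], auto simp: list_all2_Cons2)
  fix as :: "(4 \<Rightarrow>\<^sub>0 nat) list"
  assume as: "length as = 4" "\<forall>a\<in>set as. 3 \<le> mdeg a" "sum_list (map mdeg as) = 4 + 2 * 4"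
  then obtain a b c d where abcd: "as = [a, b, c, d]" by (auto simp: length_Suc_conv eval_nat_numeral)
  then have "mdeg a = 3 \<and> mdeg b = 3 \<and> mdeg c = 3 \<and> mdeg d = 3" using as by simp
  then show "\<sigma> (map monom as) = 0"
    using *[of "monom a" "monom b" "monom c" "monom d"] monom_homogeneous[of a] monom_homogeneous[of b]
      monom_homogeneous[of c] monom_homogeneous[of d] by (simp add: abcd)
qed

section \<open>Transvectants and the Omega process\<close>

text \<open>
  Contraction with the Poisson tensor, so that \<open>{f, g}\<close> is the contraction of \<open>\<partial>\<^sub>i f\<close> with \<open>\<partial>\<^sub>j g\<close>, and with the
  volume form, so that the contraction of \<open>F\<close> is a sum over all permutations with sign.
\<close>

definition symplectic_sum :: "(4 \<Rightarrow> 4 \<Rightarrow> real) \<Rightarrow> real"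
  where "symplectic_sum F = F 1 4 + F 2 3 - F 3 2 - F 4 1"

definition volume_sum :: "(4 \<Rightarrow> 4 \<Rightarrow> 4 \<Rightarrow> 4 \<Rightarrow> real) \<Rightarrow> real"
  where "volume_sum F =
    F 1 2 3 4 - F 1 2 4 3 - F 1 3 2 4 + F 1 3 4 2 + F 1 4 2 3 - F 1 4 3 2
    - F 2 1 3 4 + F 2 1 4 3 + F 2 3 1 4 - F 2 3 4 1 - F 2 4 1 3 + F 2 4 3 1
    + F 3 1 2 4 - F 3 1 4 2 - F 3 2 1 4 + F 3 2 4 1 + F 3 4 1 2 - F 3 4 2 1
    - F 4 1 2 3 + F 4 1 3 2 + F 4 2 1 3 - F 4 2 3 1 - F 4 3 1 2 + F 4 3 2 1"

definition constant_term :: "poly4 \<Rightarrow> real"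
  where "constant_term p = Poly_Mapping.lookup p 0"

text \<open>
  Contraction of three polynomials along the graph with \<open>a\<close> edges between the first and the second,
  \<open>b\<close> between the first and the third and \<open>c\<close> between the second and the third vertex.  An edge
  differentiates both its ends, and what is left is evaluated at the origin, so only polynomials
  whose degree is the valency of their vertex contribute.
\<close>

fun transvectant :: "nat \<Rightarrow> nat \<Rightarrow> nat \<Rightarrow> poly4 \<Rightarrow> poly4 \<Rightarrow> poly4 \<Rightarrow> real"
  where
    "transvectant (Suc a) b c f g h =
      symplectic_sum (\<lambda>i j. transvectant a b c (partial_deriv i f) (partial_deriv j g) h)"
  | "transvectant 0 (Suc b) c f g h =
      symplectic_sum (\<lambda>i j. transvectant 0 b c (partial_deriv i f) g (partial_deriv j h))"
  | "transvectant 0 0 (Suc c) f g h =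
      symplectic_sum (\<lambda>i j. transvectant 0 0 c f (partial_deriv i g) (partial_deriv j h))"
  | "transvectant 0 0 0 f g h = constant_term f * constant_term g * constant_term h"

text \<open>
  The \<open>n\<close>-th power of Cayley's Omega process, the determinant of partial derivatives acting on four
  arguments, again evaluated at the origin.
\<close>

fun omega :: "nat \<Rightarrow> poly4 \<Rightarrow> poly4 \<Rightarrow> poly4 \<Rightarrow> poly4 \<Rightarrow> real"
  where
    "omega (Suc n) f g h k = volume_sum (\<lambda>i j r s.
      omega n (partial_deriv i f) (partial_deriv j g) (partial_deriv r h) (partial_deriv s k))"
  | "omega 0 f g h k = constant_term f * constant_term g * constant_term h * constant_term k"

lemma symplectic_sum_linear:
  "symplectic_sum (\<lambda>i j. F i j + G i j) = symplectic_sum F + symplectic_sum G"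
  "symplectic_sum (\<lambda>i j. r * F i j) = r * symplectic_sum F"
  by (simp_all add: symplectic_sum_def algebra_simps)

lemma volume_sum_linear:
  "volume_sum (\<lambda>i j r s. F i j r s + G i j r s) = volume_sum F + volume_sum G"
  "volume_sum (\<lambda>i j r s. c * F i j r s) = c * volume_sum F"
  by (simp_all add: volume_sum_def distrib_left right_diff_distrib)

lemma linear_symplectic_sum:
  "(\<And>i j. linear (\<lambda>f. F f i j)) \<Longrightarrow> linear (\<lambda>f. symplectic_sum (F f))"
  unfolding symplectic_sum_def by (intro linear_compose_add linear_compose_sub)

lemma linear_volume_sum:
  "(\<And>i j r s. linear (\<lambda>f. F f i j r s)) \<Longrightarrow> linear (\<lambda>f. volume_sum (F f))"
  unfolding volume_sum_def by (intro linear_compose_add linear_compose_sub)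

lemma linear_partial_deriv: "linear (partial_deriv i)"
  by (rule linearI) simp_all

lemma linear_constant_term: "linear constant_term"
  by (rule linearI) (simp_all add: constant_term_def lookup_add)

lemma linear_transvectant_1:
  fixes f g h :: poly4
  shows "linear (\<lambda>f. transvectant a b c f g h)"
proof (induction a b c f g h rule: transvectant.induct)
  case (1 a b c f g h)
  show ?case unfolding transvectant.simps
    using linear_compose[OF linear_partial_deriv 1] by (intro linear_symplectic_sum) (simp add: o_def)
next
  case (2 b c f g h)
  show ?case unfolding transvectant.simps
    using linear_compose[OF linear_partial_deriv 2] by (intro linear_symplectic_sum) (simp add: o_def)
next
  case (3 c f g h)
  show ?case unfolding transvectant.simps
    using 3 by (intro linear_symplectic_sum)
next
  case (4 f g h)
  show ?case
    by (rule linearI) (simp_all add: linear_add[OF linear_constant_term] linear_scale[OF linear_constant_term] algebra_simps)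
qed

lemma linear_transvectant_2:
  fixes f g h :: poly4
  shows "linear (\<lambda>g. transvectant a b c f g h)"
proof (induction a b c f g h rule: transvectant.induct)
  case (1 a b c f g h)
  show ?case unfolding transvectant.simps
    using linear_compose[OF linear_partial_deriv 1] by (intro linear_symplectic_sum) (simp add: o_def)
next
  case (2 b c f g h)
  show ?case unfolding transvectant.simps
    using 2 by (intro linear_symplectic_sum)
next
  case (3 c f g h)
  show ?case unfolding transvectant.simps
    using linear_compose[OF linear_partial_deriv 3] by (intro linear_symplectic_sum) (simp add: o_def)
next
  case (4 f g h)
  show ?case
    by (rule linearI) (simp_all add: linear_add[OF linear_constant_term] linear_scale[OF linear_constant_term] algebra_simps)
qed

lemma linear_transvectant_3:
  fixes f g h :: poly4
  shows "linear (\<lambda>h. transvectant a b c f g h)"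
proof (induction a b c f g h rule: transvectant.induct)
  case (1 a b c f g h)
  show ?case unfolding transvectant.simps
    using 1 by (intro linear_symplectic_sum)
next
  case (2 b c f g h)
  show ?case unfolding transvectant.simps
    using linear_compose[OF linear_partial_deriv 2] by (intro linear_symplectic_sum) (simp add: o_def)
next
  case (3 c f g h)
  show ?case unfolding transvectant.simps
    using linear_compose[OF linear_partial_deriv 3] by (intro linear_symplectic_sum) (simp add: o_def)
next
  case (4 f g h)
  show ?case
    by (rule linearI) (simp_all add: linear_add[OF linear_constant_term] linear_scale[OF linear_constant_term] algebra_simps)
qed

lemmas linear_transvectant = linear_transvectant_1 linear_transvectant_2 linear_transvectant_3

lemma linear_omega:
  "linear (\<lambda>f. omega n f g h k)" "linear (\<lambda>g. omega n f g h k)"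
  "linear (\<lambda>h. omega n f g h k)" "linear (\<lambda>k. omega n f g h k)"
proof -
  note l = linear_add[OF linear_constant_term] linear_scale[OF linear_constant_term]
  show "linear (\<lambda>f. omega n f g h k)"
  proof (induction n arbitrary: g h k)
    case 0
    show ?case by (rule linearI) (simp_all add: l algebra_simps)
  next
    case (Suc n)
    show ?case unfolding omega.simps
      using linear_compose[OF linear_partial_deriv Suc] by (intro linear_volume_sum) (simp add: o_def)
  qed
  show "linear (\<lambda>g. omega n f g h k)"
  proof (induction n arbitrary: f h k)
    case 0
    show ?case by (rule linearI) (simp_all add: l algebra_simps)
  next
    case (Suc n)
    show ?case unfolding omega.simps
      using linear_compose[OF linear_partial_deriv Suc] by (intro linear_volume_sum) (simp add: o_def)
  qed
  show "linear (\<lambda>h. omega n f g h k)"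
  proof (induction n arbitrary: f g k)
    case 0
    show ?case by (rule linearI) (simp_all add: l algebra_simps)
  next
    case (Suc n)
    show ?case unfolding omega.simps
      using linear_compose[OF linear_partial_deriv Suc] by (intro linear_volume_sum) (simp add: o_def)
  qed
  show "linear (\<lambda>k. omega n f g h k)"
  proof (induction n arbitrary: f g h)
    case 0
    show ?case by (rule linearI) (simp_all add: l algebra_simps)
  next
    case (Suc n)
    show ?case unfolding omega.simps
      using linear_compose[OF linear_partial_deriv Suc] by (intro linear_volume_sum) (simp add: o_def)
  qed
qed

lemma transvectant_simps [simp]:
  "transvectant a b c (f + f') g h = transvectant a b c f g h + transvectant a b c f' g h"
  "transvectant a b c f (g + g') h = transvectant a b c f g h + transvectant a b c f g' h"
  "transvectant a b c f g (h + h') = transvectant a b c f g h + transvectant a b c f g h'"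
  "transvectant a b c (r *\<^sub>R f) g h = r * transvectant a b c f g h"
  "transvectant a b c f (r *\<^sub>R g) h = r * transvectant a b c f g h"
  "transvectant a b c f g (r *\<^sub>R h) = r * transvectant a b c f g h"
  "transvectant a b c 0 g h = 0" "transvectant a b c f 0 h = 0" "transvectant a b c f g 0 = 0"
  using linear_add[OF linear_transvectant_1] linear_scale[OF linear_transvectant_1] linear_0[OF linear_transvectant_1]
    linear_add[OF linear_transvectant_2] linear_scale[OF linear_transvectant_2] linear_0[OF linear_transvectant_2]
    linear_add[OF linear_transvectant_3] linear_scale[OF linear_transvectant_3] linear_0[OF linear_transvectant_3]
  by simp_all

lemma omega_simps [simp]:
  "omega n (f + f') g h k = omega n f g h k + omega n f' g h k"
  "omega n f (g + g') h k = omega n f g h k + omega n f g' h k"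
  "omega n f g (h + h') k = omega n f g h k + omega n f g h' k"
  "omega n f g h (k + k') = omega n f g h k + omega n f g h k'"
  "omega n 0 g h k = 0" "omega n f 0 h k = 0" "omega n f g 0 k = 0" "omega n f g h 0 = 0"
  using linear_add[OF linear_omega(1)] linear_0[OF linear_omega(1)]
    linear_add[OF linear_omega(2)] linear_0[OF linear_omega(2)]
    linear_add[OF linear_omega(3)] linear_0[OF linear_omega(3)]
    linear_add[OF linear_omega(4)] linear_0[OF linear_omega(4)]
  by simp_all

lemma homogeneous_poly_0_eq:
  assumes "homogeneous_poly 0 p"
  shows "p = Poly_Mapping.single 0 (constant_term p)"
proof (rule poly_mapping_eqI)
  fix a
  show "Poly_Mapping.lookup p a = Poly_Mapping.lookup (Poly_Mapping.single 0 (constant_term p)) a"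
  proof (cases "a = 0")
    case False
    have "mdeg a \<noteq> 0"
    proof
      assume "mdeg a = 0"
      moreover obtain w x y z where "a = expo w x y z" by (rule expo_exhaust)
      ultimately have "a = expo 0 0 0 0" by simp
      then show False using False by (simp add: expo_def)
    qed
    then have "a \<notin> Poly_Mapping.keys p" using assms by (auto simp: homogeneous_poly_def)
    then show ?thesis using False by (simp add: lookup_single in_keys_iff)
  qed (simp add: constant_term_def)
qed

lemma constant_term_homogeneous:
  assumes "homogeneous_poly l p" "l \<noteq> 0"
  shows "constant_term p = 0"
proof -
  have "(0 :: 4 \<Rightarrow>\<^sub>0 nat) \<notin> Poly_Mapping.keys p"
    using assms by (auto simp: homogeneous_poly_def mdeg_def)
  then show ?thesis by (simp add: constant_term_def in_keys_iff)
qed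

lemma constant_term_mult: "constant_term (p * q) = constant_term p * constant_term q"
proof (induction p rule: poly_induct)
  case (single a c)
  show ?case
  proof (induction q rule: poly_induct)
    case (single b d)
    have "a + b = 0 \<longleftrightarrow> a = 0 \<and> b = 0"
      by (auto simp: poly_mapping_eq_iff lookup_add fun_eq_iff)
    then show ?case by (auto simp: constant_term_def mult_single lookup_single when_def)
  next
    case (add p q)
    then show ?case by (simp add: linear_add[OF linear_constant_term] distrib_left)
  qed
next
  case (add p q)
  then show ?case by (simp add: linear_add[OF linear_constant_term] distrib_right)
qed

definition hessian :: "poly4 \<Rightarrow> 4 \<Rightarrow> 4 \<Rightarrow> real"
  where "hessian q i j = constant_term (partial_deriv i (partial_deriv j q))"

lemma hessian_commute: "hessian q i j = hessian q j i"
  by (simp add: hessian_def partial_deriv_commute)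

text \<open>
  For quadratic \<open>q\<close> the bracket with \<open>\<partial>\<^sub>i q\<close> is a constant coefficient vector field.  Its matrix is the
  Hessian with its columns permuted and two of them negated, and its trace vanishes because the
  Hessian is symmetric.
\<close>

lemma poisson_partial_deriv_quadratic:
  assumes "homogeneous_poly 2 q"
  shows "poisson (partial_deriv i q) f =
    hessian q i 1 *\<^sub>R partial_deriv 4 f + hessian q i 2 *\<^sub>R partial_deriv 3 f
    + (- hessian q i 3) *\<^sub>R partial_deriv 2 f + (- hessian q i 4) *\<^sub>R partial_deriv 1 f"
proof -
  have "partial_deriv j (partial_deriv i q) = Poly_Mapping.single 0 (hessian q i j)" for j
    using homogeneous_poly_0_eq[of "partial_deriv j (partial_deriv i q)"]
      homogeneous_poly_partial_deriv[OF homogeneous_poly_partial_deriv[OF assms], of j i]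
    by (simp add: hessian_commute[of q i j]) (simp add: hessian_def)
  then show ?thesis by (simp add: poisson_def scaleR_eq_mult[symmetric])
qed

lemma constant_term_poisson_quadratic:
  assumes "homogeneous_poly 2 q"
  shows "constant_term (poisson q f) = 0"
proof -
  have "constant_term (partial_deriv i q) = 0" for i
    using constant_term_homogeneous[OF homogeneous_poly_partial_deriv[OF assms]] by simp
  then show ?thesis
    by (simp add: poisson_def linear_add[OF linear_constant_term] linear_diff[OF linear_constant_term]
        constant_term_mult)
qed

text \<open>
  The matrices of the brackets with \<open>\<partial>\<^sub>i q\<close> lie in the symplectic Lie algebra because the Hessian is
  symmetric, and the Poisson tensor is invariant under it.
\<close>

lemma symplectic_sum_invariant:
  assumes q: "homogeneous_poly 2 q" and "\<And>g. linear (\<lambda>f. T f g)" "\<And>f. linear (T f)"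
  shows "symplectic_sum (\<lambda>i j. T (poisson (partial_deriv i q) f) (partial_deriv j g)) +
    symplectic_sum (\<lambda>i j. T (partial_deriv i f) (poisson (partial_deriv j q) g)) = 0"
  unfolding symplectic_sum_def poisson_partial_deriv_quadratic[OF q]
    linear_add[OF assms(2)] linear_scale[OF assms(2)] linear_add[OF assms(3)] linear_scale[OF assms(3)]
    hessian_commute[of q 2 1] hessian_commute[of q 3 1] hessian_commute[of q 4 1]
    hessian_commute[of q 3 2] hessian_commute[of q 4 2] hessian_commute[of q 4 3]
  by (simp add: algebra_simps)

text \<open>
  Passing \<open>{q, _}\<close> through the derivatives on an edge gives the same expression with one edge less,
  which vanishes by induction, and the terms with \<open>\<partial>\<^sub>i q\<close>, which cancel on that edge.  At the origin
  \<open>{q, f}\<close> vanishes because \<open>q\<close> has a critical point there.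
\<close>

lemma transvectant_invariant:
  assumes q: "homogeneous_poly 2 q"
  shows "transvectant a b c (poisson q f) g h + transvectant a b c f (poisson q g) h
    + transvectant a b c f g (poisson q h) = 0"
proof (induction a b c f g h rule: transvectant.induct)
  case (1 a b c f g h)
  have "symplectic_sum (\<lambda>i j. transvectant a b c (poisson q (partial_deriv i f)) (partial_deriv j g) h
      + transvectant a b c (partial_deriv i f) (poisson q (partial_deriv j g)) h
      + transvectant a b c (partial_deriv i f) (partial_deriv j g) (poisson q h)) = 0"
    unfolding 1 by (simp add: symplectic_sum_def)
  then show ?case
    using symplectic_sum_invariant[OF q, of "\<lambda>f g. transvectant a b c f g h" f g] linear_transvectant
    by (simp add: partial_deriv_poisson symplectic_sum_linear)
next
  case (2 b c f g h)
  have "symplectic_sum (\<lambda>i j. transvectant 0 b c (poisson q (partial_deriv i f)) g (partial_deriv j h)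
      + transvectant 0 b c (partial_deriv i f) (poisson q g) (partial_deriv j h)
      + transvectant 0 b c (partial_deriv i f) g (poisson q (partial_deriv j h))) = 0"
    unfolding 2 by (simp add: symplectic_sum_def)
  then show ?case
    using symplectic_sum_invariant[OF q, of "\<lambda>f h. transvectant 0 b c f g h" f h] linear_transvectant
    by (simp add: partial_deriv_poisson symplectic_sum_linear)
next
  case (3 c f g h)
  have "symplectic_sum (\<lambda>i j. transvectant 0 0 c (poisson q f) (partial_deriv i g) (partial_deriv j h)
      + transvectant 0 0 c f (poisson q (partial_deriv i g)) (partial_deriv j h)
      + transvectant 0 0 c f (partial_deriv i g) (poisson q (partial_deriv j h))) = 0"
    unfolding 3 by (simp add: symplectic_sum_def)
  then show ?case
    using symplectic_sum_invariant[OF q, of "\<lambda>g h. transvectant 0 0 c f g h" g h] linear_transvectant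
    by (simp add: partial_deriv_poisson symplectic_sum_linear)
next
  case (4 f g h)
  show ?case by (simp add: constant_term_poisson_quadratic[OF q])
qed

definition substitute :: "4 \<Rightarrow> 4 \<Rightarrow> (4 \<Rightarrow> 4 \<Rightarrow> 4 \<Rightarrow> 4 \<Rightarrow> real) \<Rightarrow> 4 \<Rightarrow> 4 \<Rightarrow> 4 \<Rightarrow> 4 \<Rightarrow> real"
  where "substitute p m F i j r s =
    (if i = p then F m j r s else 0) + (if j = p then F i m r s else 0)
    + (if r = p then F i j m s else 0) + (if s = p then F i j r m else 0)"

text \<open>
  Replacing the index \<open>p\<close> by \<open>m\<close> is the derivative of the determinant along an elementary matrix:
  for \<open>p \<noteq> m\<close> the index \<open>m\<close> occurs twice and the terms cancel in pairs.
\<close>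

lemma volume_sum_substitute: "volume_sum (substitute p m F) = (if p = m then volume_sum F else 0)"
  using four_cases[of p] four_cases[of m]
  by (elim disjE) (simp_all add: volume_sum_def substitute_def)

lemma volume_sum_sum: "volume_sum (\<lambda>i j r s. \<Sum>x\<in>X. G x i j r s) = (\<Sum>x\<in>X. volume_sum (G x))"
  by (simp add: volume_sum_def sum.distrib sum_subtractf)

lemma volume_sum_trace:
  assumes "(\<Sum>m\<in>UNIV. A m m) = 0"
  shows "volume_sum (\<lambda>i j r s. (\<Sum>m\<in>UNIV. A i m * F m j r s) + (\<Sum>m\<in>UNIV. A j m * F i m r s)
    + (\<Sum>m\<in>UNIV. A r m * F i j m s) + (\<Sum>m\<in>UNIV. A s m * F i j r m)) = 0"
proof -
  have delta: "(\<Sum>m\<in>UNIV. A i m * G m) = (\<Sum>p\<in>UNIV. \<Sum>m\<in>UNIV. A p m * (if i = p then G m else 0))" for i and G :: "4 \<Rightarrow> real"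
  proof -
    have "(\<Sum>p\<in>UNIV. \<Sum>m\<in>UNIV. A p m * (if i = p then G m else 0)) =
        (\<Sum>p\<in>UNIV. if i = p then \<Sum>m\<in>UNIV. A p m * G m else 0)"
      by (intro sum.cong) auto
    also have "\<dots> = (\<Sum>m\<in>UNIV. A i m * G m)" by simp
    finally show ?thesis by (rule sym)
  qed
  have "(\<Sum>m\<in>UNIV. A i m * F m j r s) + (\<Sum>m\<in>UNIV. A j m * F i m r s)
      + (\<Sum>m\<in>UNIV. A r m * F i j m s) + (\<Sum>m\<in>UNIV. A s m * F i j r m) =
    (\<Sum>p\<in>UNIV. \<Sum>m\<in>UNIV. A p m * substitute p m F i j r s)" for i j r s
    by (simp only: delta[of i "\<lambda>m. F m j r s"] delta[of j "\<lambda>m. F i m r s"]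
        delta[of r "\<lambda>m. F i j m s"] delta[of s "\<lambda>m. F i j r m"] substitute_def distrib_left sum.distrib)
  then have "volume_sum (\<lambda>i j r s. (\<Sum>m\<in>UNIV. A i m * F m j r s) + (\<Sum>m\<in>UNIV. A j m * F i m r s)
      + (\<Sum>m\<in>UNIV. A r m * F i j m s) + (\<Sum>m\<in>UNIV. A s m * F i j r m)) =
    (\<Sum>p\<in>UNIV. \<Sum>m\<in>UNIV. A p m * volume_sum (substitute p m F))"
    by (simp only: volume_sum_sum volume_sum_linear)
  also have "\<dots> = (\<Sum>p\<in>UNIV. A p p * volume_sum F)"
    by (simp add: volume_sum_substitute if_distrib[of "(*) _"] cong: if_cong)
  also have "\<dots> = 0" using assms by (simp flip: sum_distrib_right)
  finally show ?thesis .
qed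

lemma volume_sum_swap:
  "volume_sum (\<lambda>i j r s. F j i r s) = - volume_sum F"
  "volume_sum (\<lambda>i j r s. F i r j s) = - volume_sum F"
  "volume_sum (\<lambda>i j r s. F i j s r) = - volume_sum F"
  by (simp_all add: volume_sum_def)

text \<open>
  Each of the \<open>n\<close> determinants changes its sign.
\<close>

lemma omega_swap:
  "omega n g f h k = (- 1) ^ n * omega n f g h k"
  "omega n f h g k = (- 1) ^ n * omega n f g h k"
  "omega n f g k h = (- 1) ^ n * omega n f g h k"
proof -
  show "omega n g f h k = (- 1) ^ n * omega n f g h k"
  proof (induction n arbitrary: f g h k)
    case (Suc n)
    let ?F = "\<lambda>i j r s. omega n (partial_deriv i f) (partial_deriv j g) (partial_deriv r h) (partial_deriv s k)"
    have "omega (Suc n) g f h k = volume_sum (\<lambda>i j r s. (- 1) ^ n * omega n (partial_deriv j f) (partial_deriv i g) (partial_deriv r h) (partial_deriv s k))"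
      unfolding omega.simps by (subst Suc) (rule refl)
    also have "\<dots> = (- 1) ^ n * - volume_sum ?F"
      unfolding volume_sum_linear volume_sum_swap(1)[of ?F] ..
    finally show ?case by simp
  qed simp
  show "omega n f h g k = (- 1) ^ n * omega n f g h k"
  proof (induction n arbitrary: f g h k)
    case (Suc n)
    let ?F = "\<lambda>i j r s. omega n (partial_deriv i f) (partial_deriv j g) (partial_deriv r h) (partial_deriv s k)"
    have "omega (Suc n) f h g k = volume_sum (\<lambda>i j r s. (- 1) ^ n * omega n (partial_deriv i f) (partial_deriv r g) (partial_deriv j h) (partial_deriv s k))"
      unfolding omega.simps by (subst Suc) (rule refl)
    also have "\<dots> = (- 1) ^ n * - volume_sum ?F"
      unfolding volume_sum_linear volume_sum_swap(2)[of ?F] ..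
    finally show ?case by simp
  qed simp
  show "omega n f g k h = (- 1) ^ n * omega n f g h k"
  proof (induction n arbitrary: f g h k)
    case (Suc n)
    let ?F = "\<lambda>i j r s. omega n (partial_deriv i f) (partial_deriv j g) (partial_deriv r h) (partial_deriv s k)"
    have "omega (Suc n) f g k h = volume_sum (\<lambda>i j r s. (- 1) ^ n * omega n (partial_deriv i f) (partial_deriv j g) (partial_deriv s h) (partial_deriv r k))"
      unfolding omega.simps by (subst Suc) (rule refl)
    also have "\<dots> = (- 1) ^ n * - volume_sum ?F"
      unfolding volume_sum_linear volume_sum_swap(3)[of ?F] ..
    finally show ?case by simp
  qed simp
qed

lemma volume_sum_invariant:
  assumes q: "homogeneous_poly 2 q"
    and T: "\<And>g h k. linear (\<lambda>f. T f g h k)" "\<And>f h k. linear (\<lambda>g. T f g h k)"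
      "\<And>f g k. linear (\<lambda>h. T f g h k)" "\<And>f g h. linear (\<lambda>k. T f g h k)"
  shows "volume_sum (\<lambda>i j r s.
      T (poisson (partial_deriv i q) f) (partial_deriv j g) (partial_deriv r h) (partial_deriv s k)
    + T (partial_deriv i f) (poisson (partial_deriv j q) g) (partial_deriv r h) (partial_deriv s k)
    + T (partial_deriv i f) (partial_deriv j g) (poisson (partial_deriv r q) h) (partial_deriv s k)
    + T (partial_deriv i f) (partial_deriv j g) (partial_deriv r h) (poisson (partial_deriv s q) k)) = 0"
proof -
  define A where "A i m = (if m = 1 then - hessian q i 4 else if m = 2 then - hessian q i 3
      else if m = 3 then hessian q i 2 else hessian q i 1)" for i m :: 4
  have "poisson (partial_deriv i q) f = (\<Sum>m\<in>UNIV. A i m *\<^sub>R partial_deriv m f)" for i f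
    unfolding poisson_partial_deriv_quadratic[OF q] UNIV_four by (simp add: A_def)
  moreover have "(\<Sum>m\<in>UNIV. A m m) = 0"
    unfolding UNIV_four by (simp add: A_def hessian_commute[of q 4 1] hessian_commute[of q 3 2])
  ultimately show ?thesis
    using volume_sum_trace[of A "\<lambda>i j r s. T (partial_deriv i f) (partial_deriv j g) (partial_deriv r h) (partial_deriv s k)"]
    by (simp only: linear_sum[OF T(1)] linear_sum[OF T(2)] linear_sum[OF T(3)] linear_sum[OF T(4)]
        linear_scale[OF T(1)] linear_scale[OF T(2)] linear_scale[OF T(3)] linear_scale[OF T(4)] real_scaleR_def)
qed

text \<open>
  As for \<open>transvectant_invariant\<close>, with the trace-free matrix of \<open>poisson_partial_deriv_quadratic\<close>
  acting on the volume form.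
\<close>

lemma omega_invariant:
  assumes q: "homogeneous_poly 2 q"
  shows "omega n (poisson q f) g h k + omega n f (poisson q g) h k
    + omega n f g (poisson q h) k + omega n f g h (poisson q k) = 0"
proof (induction n arbitrary: f g h k)
  case 0
  show ?case by (simp add: constant_term_poisson_quadratic[OF q])
next
  case (Suc n)
  have "volume_sum (\<lambda>i j r s.
      omega n (poisson q (partial_deriv i f)) (partial_deriv j g) (partial_deriv r h) (partial_deriv s k)
    + omega n (partial_deriv i f) (poisson q (partial_deriv j g)) (partial_deriv r h) (partial_deriv s k)
    + omega n (partial_deriv i f) (partial_deriv j g) (poisson q (partial_deriv r h)) (partial_deriv s k)
    + omega n (partial_deriv i f) (partial_deriv j g) (partial_deriv r h) (poisson q (partial_deriv s k))) = 0"
    unfolding Suc by (simp add: volume_sum_def)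
  then show ?case
    using volume_sum_invariant[OF q linear_omega, of n f g h k]
    by (simp add: partial_deriv_poisson volume_sum_linear)
qed

lemma transvectant_degree:
  "homogeneous_poly l f \<Longrightarrow> l \<noteq> a + b \<Longrightarrow> transvectant a b c f g h = 0"
  "homogeneous_poly l g \<Longrightarrow> l \<noteq> a + c \<Longrightarrow> transvectant a b c f g h = 0"
  "homogeneous_poly l h \<Longrightarrow> l \<noteq> b + c \<Longrightarrow> transvectant a b c f g h = 0"
proof -
  have D: "partial_deriv i p = 0 \<or> (0 < l \<and> homogeneous_poly (l - 1) (partial_deriv i p))"
    if "homogeneous_poly l p" for i l p
  proof (cases l)
    case 0
    then show ?thesis using that homogeneous_poly_0_partial_deriv by simp
  next
    case (Suc k)
    then show ?thesis using homogeneous_poly_partial_deriv[OF that, of i] by simp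
  qed
  show "homogeneous_poly l f \<Longrightarrow> l \<noteq> a + b \<Longrightarrow> transvectant a b c f g h = 0"
  proof (induction a b c f g h arbitrary: l rule: transvectant.induct)
    case (1 a b c f g h)
    have "transvectant a b c (partial_deriv i f) (partial_deriv j g) h = 0" for i j
      using D[OF 1(2), of i] 1(1)[of "l - 1" i j] 1(3) by auto
    then show ?case by (simp add: symplectic_sum_def)
  next
    case (2 b c f g h)
    have "transvectant 0 b c (partial_deriv i f) g (partial_deriv j h) = 0" for i j
      using D[OF 2(2), of i] 2(1)[of "l - 1" i j] 2(3) by auto
    then show ?case by (simp add: symplectic_sum_def)
  next
    case (3 c f g h)
    have "transvectant 0 0 c f (partial_deriv i g) (partial_deriv j h) = 0" for i j
      using 3 by auto
    then show ?case by (simp add: symplectic_sum_def)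
  next
    case (4 f g h)
    then show ?case by (simp add: constant_term_homogeneous)
  qed
  show "homogeneous_poly l g \<Longrightarrow> l \<noteq> a + c \<Longrightarrow> transvectant a b c f g h = 0"
  proof (induction a b c f g h arbitrary: l rule: transvectant.induct)
    case (1 a b c f g h)
    have "transvectant a b c (partial_deriv i f) (partial_deriv j g) h = 0" for i j
      using D[OF 1(2), of j] 1(1)[of "l - 1" j i] 1(3) by auto
    then show ?case by (simp add: symplectic_sum_def)
  next
    case (2 b c f g h)
    have "transvectant 0 b c (partial_deriv i f) g (partial_deriv j h) = 0" for i j
      using 2 by auto
    then show ?case by (simp add: symplectic_sum_def)
  next
    case (3 c f g h)
    have "transvectant 0 0 c f (partial_deriv i g) (partial_deriv j h) = 0" for i j
      using D[OF 3(2), of i] 3(1)[of "l - 1" i j] 3(3) by auto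
    then show ?case by (simp add: symplectic_sum_def)
  next
    case (4 f g h)
    then show ?case by (simp add: constant_term_homogeneous)
  qed
  show "homogeneous_poly l h \<Longrightarrow> l \<noteq> b + c \<Longrightarrow> transvectant a b c f g h = 0"
  proof (induction a b c f g h arbitrary: l rule: transvectant.induct)
    case (1 a b c f g h)
    have "transvectant a b c (partial_deriv i f) (partial_deriv j g) h = 0" for i j
      using 1 by auto
    then show ?case by (simp add: symplectic_sum_def)
  next
    case (2 b c f g h)
    have "transvectant 0 b c (partial_deriv i f) g (partial_deriv j h) = 0" for i j
      using D[OF 2(2), of j] 2(1)[of "l - 1" j i] 2(3) by auto
    then show ?case by (simp add: symplectic_sum_def)
  next
    case (3 c f g h)
    have "transvectant 0 0 c f (partial_deriv i g) (partial_deriv j h) = 0" for i j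
      using D[OF 3(2), of j] 3(1)[of "l - 1" j i] 3(3) by auto
    then show ?case by (simp add: symplectic_sum_def)
  next
    case (4 f g h)
    then show ?case by (simp add: constant_term_homogeneous)
  qed
qed

lemma omega_degree:
  "homogeneous_poly l f \<Longrightarrow> l \<noteq> n \<Longrightarrow> omega n f g h k = 0"
proof (induction n arbitrary: l f g h k)
  case 0
  then show ?case by (simp add: constant_term_homogeneous)
next
  case (Suc n)
  have "omega n (partial_deriv i f) (partial_deriv j g) (partial_deriv r h) (partial_deriv s k) = 0" for i j r s
  proof (cases l)
    case 0
    then show ?thesis using Suc.prems homogeneous_poly_0_partial_deriv by simp
  next
    case (Suc m)
    then have "homogeneous_poly m (partial_deriv i f)" "m \<noteq> n"
      using Suc.prems homogeneous_poly_partial_deriv[OF Suc.prems(1), of i] by simp_all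
    then show ?thesis by (rule Suc.IH)
  qed
  then show ?case by (simp add: volume_sum_def)
qed

section \<open>The invariant forms of weight four\<close>

declare transvectant.simps [simp del] omega.simps [simp del]

lemma alternating_multilinearI:
  assumes "alternating \<sigma>" "\<And>fs. linear (\<lambda>f. \<sigma> (f # fs))"
  shows "multilinear \<sigma>"
  unfolding multilinear_def
proof (intro allI)
  fix us vs
  have "\<sigma> (us @ f # vs) = (- 1) ^ length us * \<sigma> (f # us @ vs)" for f
    by (simp add: alternating_move[OF assms(1), of f us vs] flip: mult.assoc power_add)
  then show "linear (\<lambda>f. \<sigma> (us @ f # vs))"
    using linear_compose_scale_right[OF assms(2)[of "us @ vs"], of "(- 1) ^ length us"] by simp
qed

definition ternary_form :: "(ham \<Rightarrow> ham \<Rightarrow> ham \<Rightarrow> real) \<Rightarrow> cochain"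
  where "ternary_form F fs = (case fs of [f, g, h] \<Rightarrow> F f g h | _ \<Rightarrow> 0)"

definition quaternary_form :: "(ham \<Rightarrow> ham \<Rightarrow> ham \<Rightarrow> ham \<Rightarrow> real) \<Rightarrow> cochain"
  where "quaternary_form F fs = (case fs of [f, g, h, k] \<Rightarrow> F f g h k | _ \<Rightarrow> 0)"

lemma ternary_form_simp [simp]: "ternary_form F [f, g, h] = F f g h"
  by (simp add: ternary_form_def)

lemma quaternary_form_simp [simp]: "quaternary_form F [f, g, h, k] = F f g h k"
  by (simp add: quaternary_form_def)

lemma ternary_form_eq_0: "length fs \<noteq> 3 \<Longrightarrow> ternary_form F fs = 0"
  by (auto simp: ternary_form_def split: list.split)

lemma quaternary_form_eq_0: "length fs \<noteq> 4 \<Longrightarrow> quaternary_form F fs = 0"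
  by (auto simp: quaternary_form_def split: list.split)

lemma length_3_exhaust: "length fs = 3 \<Longrightarrow> \<exists>f g h. fs = [f, g, h]"
  by (auto simp: length_Suc_conv numeral_3_eq_3)

lemma length_4_exhaust: "length fs = 4 \<Longrightarrow> \<exists>f g h k. fs = [f, g, h, k]"
  by (auto simp: length_Suc_conv eval_nat_numeral)

lemma alternating_ternary_form:
  assumes "\<And>f g h. F g f h = - F f g h" "\<And>f g h. F f h g = - F f g h"
  shows "alternating (ternary_form F)"
proof -
  have "ternary_form F (us @ f # g # vs) = - ternary_form F (us @ g # f # vs)" for us f g vs
  proof (cases "length (us @ f # g # vs) = 3")
    case True
    then consider h where "us = []" "vs = [h]" | h where "us = [h]" "vs = []"
      by (cases us) (auto simp: length_Suc_conv numeral_3_eq_3)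
    then show ?thesis
    proof cases
      case 1
      then show ?thesis using assms(1)[of f g h] by simp
    next
      case 2
      then show ?thesis using assms(2)[of h f g] by simp
    qed
  next
    case False
    then show ?thesis by (simp add: ternary_form_eq_0)
  qed
  then show ?thesis unfolding alternating_def by blast
qed

lemma alternating_quaternary_form:
  assumes "\<And>f g h k. F g f h k = - F f g h k" "\<And>f g h k. F f h g k = - F f g h k"
    "\<And>f g h k. F f g k h = - F f g h k"
  shows "alternating (quaternary_form F)"
proof -
  have "quaternary_form F (us @ f # g # vs) = - quaternary_form F (us @ g # f # vs)" for us f g vs
  proof (cases "length (us @ f # g # vs) = 4")
    case True
    then consider h k where "us = []" "vs = [h, k]" | h k where "us = [h]" "vs = [k]"
      | h k where "us = [h, k]" "vs = []"
      by (cases us; cases "tl us") (auto simp: length_Suc_conv eval_nat_numeral)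
    then show ?thesis
    proof cases
      case (1 h k)
      then show ?thesis using assms(1)[of f g h k] by simp
    next
      case (2 h k)
      then show ?thesis using assms(2)[of h f g k] by simp
    next
      case (3 h k)
      then show ?thesis using assms(3)[of h k f g] by simp
    qed
  next
    case False
    then show ?thesis by (simp add: quaternary_form_eq_0)
  qed
  then show ?thesis unfolding alternating_def by blast
qed

text \<open>
  By alternation it is enough to have linearity and the restriction to cubics in the first argument.
  Four cubics have total degree \<open>12\<close>, which is weight \<open>4\<close>.
\<close>

lemma quaternary_form_relative:
  assumes lin: "\<And>g h k. linear (\<lambda>f. F f g h k)"
    and swap: "\<And>f g h k. F g f h k = - F f g h k" "\<And>f g h k. F f h g k = - F f g h k"
      "\<And>f g h k. F f g k h = - F f g h k"
    and cubic: "\<And>l f g h k. f \<in> homogeneous l \<Longrightarrow> l \<noteq> 3 \<Longrightarrow> F f g h k = 0"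
    and inv: "\<And>q f g h k. q \<in> homogeneous 2 \<Longrightarrow>
      F (bracket q f) g h k + F f (bracket q g) h k + F f g (bracket q h) k + F f g h (bracket q k) = 0"
  shows "quaternary_form F \<in> relative_cochains 4 4"
proof -
  let ?\<sigma> = "quaternary_form F"
  have alt: "alternating ?\<sigma>" using swap by (rule alternating_quaternary_form)
  have head: "?\<sigma> (f # fs) = 0" if "f \<in> homogeneous l" "l \<noteq> 3" for f l fs
  proof (cases "length (f # fs) = 4")
    case True
    then obtain g h k where "fs = [g, h, k]" using length_4_exhaust by blast
    then show ?thesis using cubic[OF that] by simp
  next
    case False
    then show ?thesis by (rule quaternary_form_eq_0)
  qed
  have "linear (\<lambda>f. ?\<sigma> (f # fs))" for fs
  proof (cases "length fs = 3")
    case True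
    then obtain g h k where "fs = [g, h, k]" using length_3_exhaust by blast
    then show ?thesis using lin by simp
  next
    case False
    then have "(\<lambda>f. ?\<sigma> (f # fs)) = (\<lambda>f. 0)" by (intro ext quaternary_form_eq_0) simp
    then show ?thesis by (simp add: linear_zero)
  qed
  then have "multilinear ?\<sigma>" by (rule alternating_multilinearI[OF alt])
  moreover have "graded 12 ?\<sigma>"
    unfolding graded_def
  proof (intro allI impI)
    fix fs ls
    assume fs: "list_all2 (\<lambda>f l. f \<in> homogeneous l) fs ls" and sum: "int (sum_list ls) \<noteq> 12"
    show "?\<sigma> fs = 0"
    proof (cases "length fs = 4")
      case True
      then have "length ls = 4" using list_all2_lengthD[OF fs] by simp
      then obtain i where i: "i < length ls" "ls ! i \<noteq> 3"
      proof -
        obtain a b c d where "ls = [a, b, c, d]" using \<open>length ls = 4\<close> length_4_exhaust by blast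
        then have "ls ! 0 \<noteq> 3 \<or> ls ! 1 \<noteq> 3 \<or> ls ! 2 \<noteq> 3 \<or> ls ! 3 \<noteq> 3" using sum by auto
        then show thesis
          using that[of 0] that[of 1] that[of 2] that[of 3] \<open>length ls = 4\<close> by auto
      qed
      then have "i < length fs" using \<open>length ls = 4\<close> True by simp
      have "fs ! i \<in> homogeneous (ls ! i)" by (rule list_all2_nthD[OF fs \<open>i < length fs\<close>])
      then have "?\<sigma> (fs ! i # take i fs @ drop (Suc i) fs) = 0" using i(2) by (rule head)
      then have "?\<sigma> (take i fs @ fs ! i # drop (Suc i) fs) = 0"
        by (simp add: alternating_move[OF alt])
      then show ?thesis by (simp add: id_take_nth_drop[OF \<open>i < length fs\<close>, symmetric])
    next
      case False
      then show ?thesis by (rule quaternary_form_eq_0)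
    qed
  qed
  ultimately have "form 4 (int (4 + 2 * 4)) ?\<sigma>"
    using alt by (simp add: form_def quaternary_form_eq_0)
  moreover have "interior q ?\<sigma> = 0" if "q \<in> homogeneous 2" for q
    using head[OF that] by (simp add: interior_def fun_eq_iff)
  moreover have "lie_sum q ?\<sigma> = 0" if q: "q \<in> homogeneous 2" for q
  proof
    fix fs
    show "lie_sum q ?\<sigma> fs = (0 :: cochain) fs"
    proof (cases "length fs = 4")
      case True
      then obtain f g h k where fs: "fs = [f, g, h, k]" using length_4_exhaust by blast
      show ?thesis using inv[OF q, of f g h k] unfolding fs by (simp add: lie_sum_Cons) (simp add: interior_def)
    next
      case False
      then show ?thesis by (simp add: lie_sum_def quaternary_form_eq_0)
    qed
  qed
  ultimately show ?thesis unfolding relative_cochains_iff by blast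
qed

lemma poisson_one: "poisson q 1 = 0"
proof -
  have "partial_deriv i 1 = 0" for i
    using partial_deriv_single[of i 0 1] by simp
  then show ?thesis by (simp add: poisson_def)
qed

text \<open>
  The invariant form on cubics; it is alternating since the number of edges is odd.  The third vertex
  of the graph is isolated, so the constant \<open>1\<close> may be put there.
\<close>

definition cubic_pairing :: "ham \<Rightarrow> ham \<Rightarrow> real"
  where "cubic_pairing f g = transvectant 3 0 0 (potential f) (potential g) 1"

lemma transvectant_swap: "transvectant a 0 0 g f h = (- 1) ^ a * transvectant a 0 0 f g h"
proof (induction a arbitrary: f g)
  case (Suc a)
  let ?F = "\<lambda>i j. transvectant a 0 0 (partial_deriv i f) (partial_deriv j g) h"
  have "transvectant (Suc a) 0 0 g f h = symplectic_sum (\<lambda>i j. (- 1) ^ a * ?F j i)"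
    unfolding transvectant.simps by (subst Suc) (rule refl)
  also have "\<dots> = (- 1) ^ a * - symplectic_sum ?F"
    unfolding symplectic_sum_linear by (simp add: symplectic_sum_def)
  finally show ?case by (simp add: transvectant.simps(1)[of a 0 0 f g h])
qed (simp add: transvectant.simps)

lemma cubic_pairing_antisym: "cubic_pairing g f = - cubic_pairing f g"
  unfolding cubic_pairing_def by (subst transvectant_swap) simp

lemma linear_cubic_pairing: "linear (\<lambda>f. cubic_pairing f g)"
  unfolding cubic_pairing_def using linear_compose[OF linear_potential linear_transvectant_1] by (simp add: o_def)

lemma cubic_pairing_degree: "f \<in> homogeneous l \<Longrightarrow> l \<noteq> 3 \<Longrightarrow> cubic_pairing f g = 0"
  unfolding cubic_pairing_def homogeneous_iff by (rule transvectant_degree) simp_all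

lemma cubic_pairing_invariant:
  "q \<in> homogeneous 2 \<Longrightarrow> cubic_pairing (bracket q f) g = - cubic_pairing f (bracket q g)"
  using transvectant_invariant[of "potential q" 3 0 0 "potential f" "potential g" 1]
  by (simp add: cubic_pairing_def homogeneous_iff bracket.rep_eq poisson_one)

text \<open>
  Half the wedge square of the symplectic form on cubics.  The sum over the three ways to split four
  arguments into pairs is the expansion of a Pfaffian, hence alternating.
\<close>

definition pairing_square :: cochain
  where "pairing_square = quaternary_form (\<lambda>f g h k. cubic_pairing f g * cubic_pairing h k
    - cubic_pairing f h * cubic_pairing g k + cubic_pairing f k * cubic_pairing g h)"

lemma pairing_square_relative: "pairing_square \<in> relative_cochains 4 4"
  unfolding pairing_square_def
proof (rule quaternary_form_relative)
  note anti = cubic_pairing_antisym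
  fix f g h k
  show "linear (\<lambda>f. cubic_pairing f g * cubic_pairing h k - cubic_pairing f h * cubic_pairing g k
      + cubic_pairing f k * cubic_pairing g h)"
    using linear_add[OF linear_cubic_pairing] linear_scale[OF linear_cubic_pairing]
    by (intro linearI) (simp_all add: algebra_simps)
  show "cubic_pairing g f * cubic_pairing h k - cubic_pairing g h * cubic_pairing f k + cubic_pairing g k * cubic_pairing f h
    = - (cubic_pairing f g * cubic_pairing h k - cubic_pairing f h * cubic_pairing g k + cubic_pairing f k * cubic_pairing g h)"
    unfolding anti[of g f] by (simp add: algebra_simps)
  show "cubic_pairing f h * cubic_pairing g k - cubic_pairing f g * cubic_pairing h k + cubic_pairing f k * cubic_pairing h g
    = - (cubic_pairing f g * cubic_pairing h k - cubic_pairing f h * cubic_pairing g k + cubic_pairing f k * cubic_pairing g h)"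
    unfolding anti[of h g] by (simp add: algebra_simps)
  show "cubic_pairing f g * cubic_pairing k h - cubic_pairing f k * cubic_pairing g h + cubic_pairing f h * cubic_pairing g k
    = - (cubic_pairing f g * cubic_pairing h k - cubic_pairing f h * cubic_pairing g k + cubic_pairing f k * cubic_pairing g h)"
    unfolding anti[of k h] by (simp add: algebra_simps)
  show "cubic_pairing f g * cubic_pairing h k - cubic_pairing f h * cubic_pairing g k + cubic_pairing f k * cubic_pairing g h = 0"
    if "f \<in> homogeneous l" "l \<noteq> 3" for l
    using cubic_pairing_degree[OF that] by simp
  fix q assume q: "q \<in> homogeneous 2"
  note inv = cubic_pairing_invariant[OF q]
  show "(cubic_pairing (bracket q f) g * cubic_pairing h k - cubic_pairing (bracket q f) h * cubic_pairing g k
      + cubic_pairing (bracket q f) k * cubic_pairing g h) +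
    (cubic_pairing f (bracket q g) * cubic_pairing h k - cubic_pairing f h * cubic_pairing (bracket q g) k
      + cubic_pairing f k * cubic_pairing (bracket q g) h) +
    (cubic_pairing f g * cubic_pairing (bracket q h) k - cubic_pairing f (bracket q h) * cubic_pairing g k
      + cubic_pairing f k * cubic_pairing g (bracket q h)) +
    (cubic_pairing f g * cubic_pairing h (bracket q k) - cubic_pairing f h * cubic_pairing g (bracket q k)
      + cubic_pairing f (bracket q k) * cubic_pairing g h) = 0"
    unfolding inv by (simp add: algebra_simps)
qed

text \<open>
  Alternating because \<open>3\<close> is odd.
\<close>

definition omega_form :: cochain
  where "omega_form = quaternary_form (\<lambda>f g h k. omega 3 (potential f) (potential g) (potential h) (potential k))"

lemma omega_form_relative: "omega_form \<in> relative_cochains 4 4"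
  unfolding omega_form_def
proof (rule quaternary_form_relative)
  fix f g h k
  show "linear (\<lambda>f. omega 3 (potential f) (potential g) (potential h) (potential k))"
    using linear_compose[OF linear_potential linear_omega(1)] by (simp add: o_def)
  show "omega 3 (potential g) (potential f) (potential h) (potential k) =
      - omega 3 (potential f) (potential g) (potential h) (potential k)"
    by (subst omega_swap(1)) simp
  show "omega 3 (potential f) (potential h) (potential g) (potential k) =
      - omega 3 (potential f) (potential g) (potential h) (potential k)"
    by (subst omega_swap(2)) simp
  show "omega 3 (potential f) (potential g) (potential k) (potential h) =
      - omega 3 (potential f) (potential g) (potential h) (potential k)"
    by (subst omega_swap(3)) simp
  show "omega 3 (potential f) (potential g) (potential h) (potential k) = 0" if "f \<in> homogeneous l" "l \<noteq> 3" for l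
    using that omega_degree by (simp add: homogeneous_iff)
  fix q assume "q \<in> homogeneous 2"
  then show "omega 3 (potential (bracket q f)) (potential g) (potential h) (potential k)
      + omega 3 (potential f) (potential (bracket q g)) (potential h) (potential k)
      + omega 3 (potential f) (potential g) (potential (bracket q h)) (potential k)
      + omega 3 (potential f) (potential g) (potential h) (potential (bracket q k)) = 0"
    using omega_invariant[of "potential q" 3] by (simp add: homogeneous_iff bracket.rep_eq)
qed

text \<open>
  The valencies of this graph are \<open>3, 3, 4\<close>.  Antisymmetrising gives the invariant \<open>3\<close>-cochain below.
\<close>

definition graph_122 :: "ham \<Rightarrow> ham \<Rightarrow> ham \<Rightarrow> real"
  where "graph_122 f g h = transvectant 1 2 2 (potential f) (potential g) (potential h)"

definition degree3_generator :: cochain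
  where "degree3_generator = ternary_form (\<lambda>f g h. graph_122 f g h - graph_122 g f h + graph_122 g h f
    - graph_122 h g f + graph_122 h f g - graph_122 f h g)"

lemma linear_graph_122:
  "linear (\<lambda>f. graph_122 f g h)" "linear (\<lambda>g. graph_122 f g h)" "linear (\<lambda>h. graph_122 f g h)"
  unfolding graph_122_def
  using linear_compose[OF linear_potential linear_transvectant_1] linear_compose[OF linear_potential linear_transvectant_2]
    linear_compose[OF linear_potential linear_transvectant_3]
  by (simp_all add: o_def)

lemma graph_122_degree:
  assumes "f \<in> homogeneous a" "g \<in> homogeneous b" "h \<in> homogeneous c" "a \<noteq> 3 \<or> b \<noteq> 3 \<or> c \<noteq> 4"
  shows "graph_122 f g h = 0"
  unfolding graph_122_def
  using transvectant_degree(1)[of a "potential f" 1 2] transvectant_degree(2)[of b "potential g" 1 2]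
    transvectant_degree(3)[of c "potential h" 2 2] assms
  by (auto simp: homogeneous_iff)

lemma graph_122_quadratic:
  assumes "q \<in> homogeneous 2"
  shows "graph_122 q g h = 0" "graph_122 f q h = 0" "graph_122 f g q = 0"
  unfolding graph_122_def using assms transvectant_degree[of 2 "potential q"] by (simp_all add: homogeneous_iff)

lemma graph_122_invariant:
  "q \<in> homogeneous 2 \<Longrightarrow>
    graph_122 (bracket q f) g h = - graph_122 f (bracket q g) h - graph_122 f g (bracket q h)"
  using transvectant_invariant[of "potential q" 1 2 2 "potential f" "potential g" "potential h"]
  by (simp add: graph_122_def homogeneous_iff bracket.rep_eq)

lemma degree3_generator_relative: "degree3_generator \<in> relative_cochains 3 4"
proof -
  have alt: "alternating degree3_generator"
    unfolding degree3_generator_def by (rule alternating_ternary_form) simp_all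
  have "linear (\<lambda>f. degree3_generator (f # fs))" for fs
  proof (cases "length fs = 2")
    case True
    then obtain g h where fs: "fs = [g, h]" by (auto simp: length_Suc_conv numeral_2_eq_2)
    show ?thesis
      unfolding fs degree3_generator_def ternary_form_simp
      by (intro linear_compose_add linear_compose_sub linear_graph_122)
  next
    case False
    then have "(\<lambda>f. degree3_generator (f # fs)) = (\<lambda>f. 0)" unfolding degree3_generator_def by (intro ext ternary_form_eq_0) simp
    then show ?thesis by (simp add: linear_zero)
  qed
  then have "multilinear degree3_generator" by (rule alternating_multilinearI[OF alt])
  moreover have "graded 10 degree3_generator"
    unfolding graded_def
  proof (intro allI impI)
    fix fs ls
    assume fs: "list_all2 (\<lambda>f l. f \<in> homogeneous l) fs ls" and sum: "int (sum_list ls) \<noteq> 10"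
    show "degree3_generator fs = 0"
    proof (cases "length fs = 3")
      case True
      then obtain f g h where f: "fs = [f, g, h]" using length_3_exhaust by blast
      then obtain a b c where l: "ls = [a, b, c]"
        and hom: "f \<in> homogeneous a" "g \<in> homogeneous b" "h \<in> homogeneous c"
        using fs by (auto simp: list_all2_Cons1)
      have "a + b + c \<noteq> 10" using sum l by simp
      then have ne: "a \<noteq> 3 \<or> b \<noteq> 3 \<or> c \<noteq> 4" "a \<noteq> 3 \<or> b \<noteq> 4 \<or> c \<noteq> 3" "a \<noteq> 4 \<or> b \<noteq> 3 \<or> c \<noteq> 3"
        by auto
      have g1: "graph_122 f g h = 0"
        by (rule graph_122_degree[OF hom(1) hom(2) hom(3)]) (use ne in blast)
      have g2: "graph_122 g f h = 0"
        by (rule graph_122_degree[OF hom(2) hom(1) hom(3)]) (use ne in blast)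
      have g3: "graph_122 g h f = 0"
        by (rule graph_122_degree[OF hom(2) hom(3) hom(1)]) (use ne in blast)
      have g4: "graph_122 h g f = 0"
        by (rule graph_122_degree[OF hom(3) hom(2) hom(1)]) (use ne in blast)
      have g5: "graph_122 h f g = 0"
        by (rule graph_122_degree[OF hom(3) hom(1) hom(2)]) (use ne in blast)
      have g6: "graph_122 f h g = 0"
        by (rule graph_122_degree[OF hom(1) hom(3) hom(2)]) (use ne in blast)
      show ?thesis unfolding f degree3_generator_def by (simp add: g1 g2 g3 g4 g5 g6)
    next
      case False
      then show ?thesis unfolding degree3_generator_def by (rule ternary_form_eq_0)
    qed
  qed
  ultimately have "form 3 (int (4 + 2 * 3)) degree3_generator"
    using alt ternary_form_eq_0 by (simp add: form_def) (simp add: degree3_generator_def)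
  moreover have "interior q degree3_generator = 0" if q: "q \<in> homogeneous 2" for q
  proof
    fix fs
    show "interior q degree3_generator fs = (0 :: cochain) fs"
    proof (cases "length (q # fs) = 3")
      case True
      then obtain g h where "fs = [g, h]" using length_3_exhaust by blast
      then show ?thesis by (simp add: interior_def degree3_generator_def graph_122_quadratic[OF q])
    next
      case False
      then show ?thesis using ternary_form_eq_0[OF False] by (simp add: interior_def degree3_generator_def)
    qed
  qed
  moreover have "lie_sum q degree3_generator = 0" if q: "q \<in> homogeneous 2" for q
  proof
    fix fs
    show "lie_sum q degree3_generator fs = (0 :: cochain) fs"
    proof (cases "length fs = 3")
      case True
      then obtain f g h where fs: "fs = [f, g, h]" using length_3_exhaust by blast
      note inv = graph_122_invariant[OF q]
      have "lie_sum q degree3_generator fs = degree3_generator [bracket q f, g, h] + degree3_generator [f, bracket q g, h] + degree3_generator [f, g, bracket q h]"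
        unfolding fs by (simp add: lie_sum_Cons) (simp add: interior_def)
      also have "\<dots> = 0" unfolding degree3_generator_def ternary_form_simp inv by simp
      finally show ?thesis by simp
    next
      case False
      then show ?thesis by (simp add: lie_sum_def degree3_generator_def ternary_form_eq_0)
    qed
  qed
  ultimately show ?thesis unfolding relative_cochains_iff by blast
qed

section \<open>Evaluation on monomials\<close>

lemma constant_term_expo [simp]:
  "constant_term (Poly_Mapping.single (expo a b c d) r) = (if a + b + c + d = 0 then r else 0)"
proof (cases "a + b + c + d = 0")
  case True
  then have "expo a b c d = 0" by (simp add: expo_def)
  then show ?thesis using True by (simp add: constant_term_def)
next
  case False
  have "homogeneous_poly (a + b + c + d) (Poly_Mapping.single (expo a b c d) r)"
    by (simp add: homogeneous_poly_def)
  then have "constant_term (Poly_Mapping.single (expo a b c d) r) = 0"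
    using False by (rule constant_term_homogeneous)
  then show ?thesis using False by (simp only: if_False)
qed

lemma constant_term_zero [simp]: "constant_term 0 = 0"
  by (simp add: constant_term_def)

lemma constant_term_one [simp]: "constant_term 1 = 1"
  by (simp add: constant_term_def lookup_one)

lemma transvectant_numeral:
  "transvectant (numeral n) b c f g h = symplectic_sum (\<lambda>i j.
    transvectant (pred_numeral n) b c (partial_deriv i f) (partial_deriv j g) h)"
  "transvectant 0 (numeral n) c f g h = symplectic_sum (\<lambda>i j.
    transvectant 0 (pred_numeral n) c (partial_deriv i f) g (partial_deriv j h))"
  "transvectant 0 0 (numeral n) f g h = symplectic_sum (\<lambda>i j.
    transvectant 0 0 (pred_numeral n) f (partial_deriv i g) (partial_deriv j h))"
  unfolding numeral_eq_Suc by (rule transvectant.simps)+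

lemma omega_numeral:
  "omega (numeral n) f g h k = volume_sum (\<lambda>i j r s. omega (pred_numeral n)
    (partial_deriv i f) (partial_deriv j g) (partial_deriv r h) (partial_deriv s k))"
  unfolding numeral_eq_Suc by (rule omega.simps)

text \<open>
  In the evaluation rules each edge appears as its four terms.  Most of them vanish on monomials, so
  the sums stay short.
\<close>

lemmas transvectant_expand = transvectant.simps[unfolded symplectic_sum_def]
  transvectant_numeral[unfolded symplectic_sum_def]

lemma cubic_pairing_mon:
  "cubic_pairing (mon 3 0 0 0) (mon 0 0 0 3) = 36"
  "cubic_pairing (mon 3 0 0 0) (mon 2 0 0 1) = 0" "cubic_pairing (mon 3 0 0 0) (mon 1 0 0 2) = 0"
  "cubic_pairing (mon 3 0 0 0) (mon 2 1 0 0) = 0" "cubic_pairing (mon 3 0 0 0) (mon 0 0 1 2) = 0"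
  "cubic_pairing (mon 2 0 0 1) (mon 1 0 0 2) = - 12" "cubic_pairing (mon 2 1 0 0) (mon 0 0 1 2) = 12"
  by (simp_all add: cubic_pairing_def transvectant_expand)

lemma pairing_square_values:
  "pairing_square [mon 3 0 0 0, mon 0 0 0 3, mon 2 0 0 1, mon 1 0 0 2] = - 432"
  "pairing_square [mon 3 0 0 0, mon 0 0 0 3, mon 2 1 0 0, mon 0 0 1 2] = 432"
  unfolding pairing_square_def quaternary_form_simp cubic_pairing_mon by simp_all

text \<open>
  Each of the three determinants uses every variable once, so a nonzero value needs each variable to
  occur three times in the product of the arguments.
\<close>

lemma omega_form_values:
  "omega_form [mon 3 0 0 0, mon 0 0 0 3, mon 2 0 0 1, mon 1 0 0 2] = 0"
  "omega_form [mon 3 0 0 0, mon 0 0 0 3, mon 2 1 0 0, mon 0 0 1 2] = 0"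
  "omega_form [mon 3 0 0 0, mon 0 0 0 3, mon 0 3 0 0, mon 0 0 3 0] = 1296"
proof -
  note step3 = omega_numeral[of "num.Bit1 num.One", unfolded volume_sum_def]
  note step2 = omega_numeral[of "num.Bit0 num.One", unfolded volume_sum_def]
  note step1 = omega.simps[unfolded volume_sum_def]
  show "omega_form [mon 3 0 0 0, mon 0 0 0 3, mon 2 0 0 1, mon 1 0 0 2] = 0"
    by (simp add: omega_form_def step3)
  show "omega_form [mon 3 0 0 0, mon 0 0 0 3, mon 2 1 0 0, mon 0 0 1 2] = 0"
    by (simp add: omega_form_def step3) (simp add: step2)
  show "omega_form [mon 3 0 0 0, mon 0 0 0 3, mon 0 3 0 0, mon 0 0 3 0] = 1296"
    by (simp add: omega_form_def step3) (simp add: step2, simp add: step1)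
qed

lemma coboundary_quadruple:
  assumes "alternating \<sigma>"
  shows "coboundary \<sigma> [f, g, h, k] =
    - \<sigma> [bracket f g, h, k] - \<sigma> [g, bracket f h, k] - \<sigma> [g, h, bracket f k]
    + \<sigma> [f, bracket g h, k] + \<sigma> [f, h, bracket g k] - \<sigma> [f, g, bracket h k]"
proof -
  note a1 = alternating_interior[OF assms]
  note a2 = alternating_interior[OF a1]
  note a3 = alternating_interior[OF a2]
  have "coboundary \<sigma> [f, g, h, k] = - lie_sum f \<sigma> [g, h, k] + lie_sum g (interior f \<sigma>) [h, k]
      - lie_sum h (interior g (interior f \<sigma>)) [k]"
    by (simp add: coboundary_Cons[OF assms] coboundary_Cons[OF a1] coboundary_Cons[OF a2] coboundary_Cons[OF a3])
  then show ?thesis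
    by (simp only: lie_sum_Cons lie_sum_Nil interior_def)
qed

lemma degree3_generator_eq:
  "degree3_generator [f, g, h] = graph_122 f g h - graph_122 g f h + graph_122 g h f
    - graph_122 h g f + graph_122 h f g - graph_122 f h g"
  by (simp add: degree3_generator_def)

text \<open>
  Comparison with \<open>pairing_square_values\<close> shows that the two forms are linearly independent.
\<close>

lemma coboundary_degree3_generator_values:
  "coboundary degree3_generator [mon 3 0 0 0, mon 0 0 0 3, mon 2 0 0 1, mon 1 0 0 2] = - 8640"
  "coboundary degree3_generator [mon 3 0 0 0, mon 0 0 0 3, mon 2 1 0 0, mon 0 0 1 2] = 576"
proof -
  have alt: "alternating degree3_generator" and lin: "multilinear degree3_generator"
    using degree3_generator_relative by (simp_all add: relative_cochains_iff form_def)
  note eval = degree3_generator_eq graph_122_def transvectant_expand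
  show "coboundary degree3_generator [mon 3 0 0 0, mon 0 0 0 3, mon 2 0 0 1, mon 1 0 0 2] = - 8640"
    unfolding coboundary_quadruple[OF alt]
    by (simp add: bracket_mon multilinear_simps[OF lin]) (simp add: eval)
  show "coboundary degree3_generator [mon 3 0 0 0, mon 0 0 0 3, mon 2 1 0 0, mon 0 0 1 2] = 576"
    unfolding coboundary_quadruple[OF alt]
    by (simp add: bracket_mon multilinear_simps[OF lin]) (simp add: eval)
qed

section \<open>Dimensions\<close>

lemma has_dim_0: "has_dim {0} 0"
  unfolding has_dim_def by (intro exI[of _ "{}"]) (simp add: independent_empty)

lemma has_quotient_dim_0: "has_quotient_dim {0} {0} 0"
  unfolding has_quotient_dim_def
  by (intro conjI exI[of _ "{}"]) (auto simp: subspace_def)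

lemma has_dim_1:
  fixes v :: "'a :: real_vector"
  assumes "subspace V" "v \<in> V" "v \<noteq> 0" "\<And>x. x \<in> V \<Longrightarrow> \<exists>c. x = c *\<^sub>R v"
  shows "has_dim V 1"
  unfolding has_dim_def
proof (intro exI[of _ "{v}"] conjI)
  show "independent {v}" using assms(3) by (simp add: independent_insert)
  show "span {v} = V"
    using assms(4) span_minimal[of "{v}" V] assms(1,2) by (auto simp: span_singleton)
qed simp_all

text \<open>
  A three-dimensional space with basis \<open>u, v, w\<close>, where \<open>u\<close> will span the coboundaries.
\<close>

locale three_coordinates =
  fixes V :: "'a :: real_vector set" and u v w :: 'a
  assumes subspace: "subspace V" and mem: "u \<in> V" "v \<in> V" "w \<in> V"
    and indep: "\<And>a b c. a *\<^sub>R u + b *\<^sub>R v + c *\<^sub>R w = 0 \<Longrightarrow> a = 0 \<and> b = 0 \<and> c = 0"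
    and gen: "\<And>x. x \<in> V \<Longrightarrow> \<exists>a b c. x = a *\<^sub>R u + b *\<^sub>R v + c *\<^sub>R w"
begin

lemma distinct: "u \<noteq> v" "u \<noteq> w" "v \<noteq> w"
  using indep[of 1 "- 1" 0] indep[of 1 0 "- 1"] indep[of 0 1 "- 1"] by auto

lemma has_dim_3: "has_dim V 3"
  unfolding has_dim_def
proof (intro exI[of _ "{u, v, w}"] conjI)
  show "independent {u, v, w}"
  proof
    assume "dependent {u, v, w}"
    then obtain r where r: "\<exists>x\<in>{u, v, w}. r x \<noteq> 0" "(\<Sum>x\<in>{u, v, w}. r x *\<^sub>R x) = 0"
      by (subst (asm) dependent_finite) auto
    then have "r u *\<^sub>R u + r v *\<^sub>R v + r w *\<^sub>R w = 0" using distinct by (simp add: add.assoc)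
    then show False using indep r(1) by blast
  qed
  have "x \<in> span {u, v, w}" if x: "x \<in> V" for x
  proof -
    obtain a b c where abc: "x = a *\<^sub>R u + b *\<^sub>R v + c *\<^sub>R w" using gen[OF x] by blast
    show ?thesis unfolding abc by (intro span_add span_scale span_base) simp_all
  qed
  then show "span {u, v, w} = V" using span_minimal[of "{u, v, w}" V] subspace mem by auto
qed (use distinct in simp_all)

lemma has_quotient_dim_2: "has_quotient_dim V (range (\<lambda>a. a *\<^sub>R u)) 2"
  unfolding has_quotient_dim_def
proof (intro conjI exI[of _ "{v, w}"] ballI)
  show "subspace (range (\<lambda>a. a *\<^sub>R u))" using subspace_span[of "{u}"] by (simp add: span_singleton)
  show "range (\<lambda>a. a *\<^sub>R u) \<subseteq> V" using subspace_scale[OF subspace mem(1)] by auto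
  fix x assume "x \<in> V"
  then obtain a b c where x: "x = a *\<^sub>R u + b *\<^sub>R v + c *\<^sub>R w" using gen by blast
  show "\<exists>!r. (\<forall>h. h \<notin> {v, w} \<longrightarrow> r h = 0) \<and> x - (\<Sum>h\<in>{v, w}. r h *\<^sub>R h) \<in> range (\<lambda>a. a *\<^sub>R u)"
  proof (rule ex1I[of _ "(\<lambda>h. 0)(v := b, w := c)"])
    show "(\<forall>h. h \<notin> {v, w} \<longrightarrow> ((\<lambda>h. 0)(v := b, w := c)) h = 0) \<and>
        x - (\<Sum>h\<in>{v, w}. ((\<lambda>h. 0)(v := b, w := c)) h *\<^sub>R h) \<in> range (\<lambda>a. a *\<^sub>R u)"
      using distinct by (auto simp: x)
    fix r assume r: "(\<forall>h. h \<notin> {v, w} \<longrightarrow> r h = 0) \<and> x - (\<Sum>h\<in>{v, w}. r h *\<^sub>R h) \<in> range (\<lambda>a. a *\<^sub>R u)"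
    then obtain t where "x - (r v *\<^sub>R v + r w *\<^sub>R w) = t *\<^sub>R u" using distinct by auto
    then have "(a - t) *\<^sub>R u + (b - r v) *\<^sub>R v + (c - r w) *\<^sub>R w = 0" by (simp add: x algebra_simps)
    then have "r v = b" "r w = c" using indep by fastforce+
    then show "r = (\<lambda>h. 0)(v := b, w := c)" using r by (auto simp: fun_eq_iff)
  qed
qed (use subspace mem distinct in simp_all)

end

lemma coboundary_degree3_generator_nonzero: "coboundary degree3_generator \<noteq> 0"
proof
  assume "coboundary degree3_generator = 0"
  then show False using coboundary_degree3_generator_values(2) by simp
qed

text \<open>
  A form with nonzero coboundary is nonzero, so by \<open>relative_cochain_3_4_eq_0\<close> its value at
  \<open>x\<^sub>1\<^sup>3, x\<^sub>4\<^sup>3, x\<^sub>1\<^sup>2 x\<^sub>4\<^sup>2\<close> is nonzero and serves as a coordinate.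
\<close>

lemma relative_cochains_3_4: "relative_cochains 3 4 = range (\<lambda>c. c *\<^sub>R degree3_generator)"
proof (intro equalityI subsetI)
  fix \<sigma> assume \<sigma>: "\<sigma> \<in> relative_cochains 3 4"
  let ?v = "\<lambda>\<tau> :: cochain. \<tau> [mon 3 0 0 0, mon 0 0 0 3, mon 2 0 0 2]"
  have "?v degree3_generator \<noteq> 0"
    using relative_cochain_3_4_eq_0[OF degree3_generator_relative] coboundary_degree3_generator_nonzero by auto
  then have "?v (\<sigma> - (?v \<sigma> / ?v degree3_generator) *\<^sub>R degree3_generator) = 0" by (simp add: scaleR_fun_def)
  moreover have "\<sigma> - (?v \<sigma> / ?v degree3_generator) *\<^sub>R degree3_generator \<in> relative_cochains 3 4"
    by (intro subspace_diff[OF subspace_relative_cochains] subspace_scale[OF subspace_relative_cochains] \<sigma> degree3_generator_relative)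
  ultimately have "\<sigma> - (?v \<sigma> / ?v degree3_generator) *\<^sub>R degree3_generator = 0" by (intro relative_cochain_3_4_eq_0)
  then have "\<sigma> = (?v \<sigma> / ?v degree3_generator) *\<^sub>R degree3_generator" by (rule eq_iff_diff_eq_0[THEN iffD2])
  then show "\<sigma> \<in> range (\<lambda>c. c *\<^sub>R degree3_generator)" by (rule range_eqI)
next
  fix \<sigma> assume "\<sigma> \<in> range (\<lambda>c. c *\<^sub>R degree3_generator)"
  then show "\<sigma> \<in> relative_cochains 3 4"
    using subspace_scale[OF subspace_relative_cochains degree3_generator_relative] by auto
qed

text \<open>
  The three evaluations of \<open>relative_cochain_4_4_eq_0\<close> are coordinates.  The Omega form vanishes under
  the first two, so the matrix of values is block triangular, with a diagonal block of size two for
  the other forms.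
\<close>

lemma three_coordinates_4_4:
  "three_coordinates (relative_cochains 4 4) (coboundary degree3_generator) pairing_square omega_form"
proof
  let ?A1 = "[mon 3 0 0 0, mon 0 0 0 3, mon 2 0 0 1, mon 1 0 0 2]"
  let ?A2 = "[mon 3 0 0 0, mon 0 0 0 3, mon 2 1 0 0, mon 0 0 1 2]"
  let ?A3 = "[mon 3 0 0 0, mon 0 0 0 3, mon 0 3 0 0, mon 0 0 3 0]"
  let ?comb = "\<lambda>a b c. a *\<^sub>R coboundary degree3_generator + b *\<^sub>R pairing_square + c *\<^sub>R omega_form"
  have vals: "?comb a b c ?A1 = - 8640 * a - 432 * b" "?comb a b c ?A2 = 576 * a + 432 * b"
    "?comb a b c ?A3 = a * coboundary degree3_generator ?A3 + b * pairing_square ?A3 + 1296 * c" for a b c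
    unfolding plus_fun_def scaleR_fun_def coboundary_degree3_generator_values pairing_square_values omega_form_values
    by simp_all
  show "subspace (relative_cochains 4 4)" by (rule subspace_relative_cochains)
  show mem: "coboundary degree3_generator \<in> relative_cochains 4 4" "pairing_square \<in> relative_cochains 4 4"
    "omega_form \<in> relative_cochains 4 4"
    using coboundary_relative_cochain[OF degree3_generator_relative] pairing_square_relative omega_form_relative
    by simp_all
  show "a = 0 \<and> b = 0 \<and> c = 0" if "?comb a b c = 0" for a b c
  proof -
    have eqs: "- 8640 * a - 432 * b = 0" "576 * a + 432 * b = 0"
      "a * coboundary degree3_generator ?A3 + b * pairing_square ?A3 + 1296 * c = 0"
      using fun_cong[OF that, of ?A1] fun_cong[OF that, of ?A2] fun_cong[OF that, of ?A3]
      unfolding vals by (simp_all only: zero_fun_def)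
    have ab: "a = 0" "b = 0" using eqs(1,2) by linarith+
    then have "c = 0" using eqs(3) by simp
    with ab show ?thesis by simp
  qed
  show "\<exists>a b c. \<sigma> = ?comb a b c" if \<sigma>: "\<sigma> \<in> relative_cochains 4 4" for \<sigma>
  proof -
    \<comment> \<open>\<open>a\<close> and \<open>b\<close> solve the system for the first two values, and \<open>c\<close> adjusts the third.\<close>
    define a where "a = - (\<sigma> ?A1 + \<sigma> ?A2) / 8064"
    define b where "b = (\<sigma> ?A2 - 576 * a) / 432"
    define c where "c = (\<sigma> ?A3 - a * coboundary degree3_generator ?A3 - b * pairing_square ?A3) / 1296"
    let ?\<tau> = "\<sigma> - ?comb a b c"
    have abc: "8064 * a = - (\<sigma> ?A1 + \<sigma> ?A2)" "432 * b = \<sigma> ?A2 - 576 * a"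
      "1296 * c = \<sigma> ?A3 - a * coboundary degree3_generator ?A3 - b * pairing_square ?A3"
    proof -
      show "8064 * a = - (\<sigma> ?A1 + \<sigma> ?A2)" unfolding a_def by simp
      show "432 * b = \<sigma> ?A2 - 576 * a" unfolding b_def by simp
      show "1296 * c = \<sigma> ?A3 - a * coboundary degree3_generator ?A3 - b * pairing_square ?A3" unfolding c_def by simp
    qed
    have \<tau>: "?\<tau> fs = \<sigma> fs - ?comb a b c fs" for fs by (simp only: fun_diff_def)
    have "?\<tau> \<in> relative_cochains 4 4"
      by (intro subspace_diff[OF subspace_relative_cochains] subspace_add[OF subspace_relative_cochains]
          subspace_scale[OF subspace_relative_cochains] \<sigma> mem)
    moreover have "?\<tau> ?A1 = 0" unfolding \<tau> vals using abc(1,2) by linarith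
    moreover have "?\<tau> ?A2 = 0" unfolding \<tau> vals using abc(2) by linarith
    moreover have "?\<tau> ?A3 = 0" unfolding \<tau> vals using abc(3) by linarith
    ultimately have "?\<tau> = 0" by (rule relative_cochain_4_4_eq_0)
    then show ?thesis by (intro exI) (rule eq_iff_diff_eq_0[THEN iffD2])
  qed
qed

text \<open>
  The coboundary is a relative \<open>5\<close>-cochain of weight \<open>4\<close>, hence zero.
\<close>

lemma relative_cocycles_4_4: "relative_cocycles 4 4 = relative_cochains 4 4"
proof -
  have "coboundary \<sigma> = 0" if "\<sigma> \<in> relative_cochains 4 4" for \<sigma>
    using coboundary_relative_cochain[OF that] by (rule relative_cochain_eq_0_if_degree_exceeds_weight) simp
  then show ?thesis unfolding relative_cocycles_def by blast
qed

lemma relative_coboundaries_4_4: "relative_coboundaries 4 4 = range (\<lambda>c. c *\<^sub>R coboundary degree3_generator)"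
proof -
  have "relative_coboundaries 4 4 = coboundary ` relative_cochains 3 4"
    by (simp add: relative_coboundaries_def numeral_eq_Suc)
  then show ?thesis by (simp add: relative_cochains_3_4 image_image coboundary_scaleR)
qed

lemma relative_cocycles_trivial:
  assumes "relative_cochains m w = {0}"
  shows "relative_cocycles m w = {0}"
  unfolding relative_cocycles_def assms by auto

lemma relative_cocycles_3_4: "relative_cocycles 3 4 = {0}"
proof (intro equalityI subsetI)
  fix \<sigma> assume "\<sigma> \<in> relative_cocycles 3 4"
  then obtain c where \<sigma>: "\<sigma> = c *\<^sub>R degree3_generator" and "coboundary \<sigma> = 0"
    unfolding relative_cocycles_def relative_cochains_3_4 by blast
  then have "c *\<^sub>R coboundary degree3_generator = 0" by (simp only: coboundary_scaleR)
  then have "c = 0" using coboundary_degree3_generator_nonzero by (simp only: scaleR_eq_0_iff simp_thms)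
  then show "\<sigma> \<in> {0}" by (simp only: \<sigma> scaleR_zero_left singleton_iff)
next
  fix \<sigma> :: cochain assume "\<sigma> \<in> {0}"
  then have "\<sigma> = 0" by (simp only: singleton_iff)
  then show "\<sigma> \<in> relative_cocycles 3 4"
    using subspace_0[OF subspace_relative_cochains] unfolding relative_cocycles_def by simp
qed

lemma relative_coboundaries_trivial:
  assumes "relative_cochains m w = {0}"
  shows "relative_coboundaries (Suc m) w = {0}"
  unfolding relative_coboundaries_def by (simp add: assms)

theorem theorem1:
  "has_dim (relative_cochains 0 4) 0 \<and>
   has_dim (relative_cochains 1 4) 0 \<and>
   has_dim (relative_cochains 2 4) 0 \<and>
   has_dim (relative_cochains 3 4) 1 \<and>
   has_dim (relative_cochains 4 4) 3 \<and>
   has_betti_number 0 4 0 \<and>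
   has_betti_number 1 4 0 \<and>
   has_betti_number 2 4 0 \<and>
   has_betti_number 3 4 0 \<and>
   has_betti_number 4 4 2"
proof -
  have "has_betti_number 0 4 0"
    using relative_cocycles_trivial[OF relative_cochains_0_4] has_quotient_dim_0
    by (simp add: has_betti_number_def relative_coboundaries_def)
  moreover have "has_betti_number 1 4 0" "has_betti_number 2 4 0" "has_betti_number 3 4 0"
    using relative_cocycles_trivial[OF relative_cochains_1_4] relative_cocycles_trivial[OF relative_cochains_2_4]
      relative_cocycles_3_4 relative_coboundaries_trivial[OF relative_cochains_0_4]
      relative_coboundaries_trivial[OF relative_cochains_1_4] relative_coboundaries_trivial[OF relative_cochains_2_4]
      has_quotient_dim_0[where 'a = cochain]
    by (simp_all add: has_betti_number_def numeral_2_eq_2 numeral_3_eq_3)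
  moreover have "has_betti_number 4 4 2"
    unfolding has_betti_number_def relative_cocycles_4_4 relative_coboundaries_4_4
    by (rule three_coordinates.has_quotient_dim_2[OF three_coordinates_4_4])
  moreover have "has_dim (relative_cochains 3 4) 1"
  proof (rule has_dim_1[OF subspace_relative_cochains degree3_generator_relative])
    show "degree3_generator \<noteq> 0" using coboundary_degree3_generator_nonzero by auto
    show "\<exists>c. \<sigma> = c *\<^sub>R degree3_generator" if "\<sigma> \<in> relative_cochains 3 4" for \<sigma>
      using that unfolding relative_cochains_3_4 by blast
  qed
  moreover have "has_dim (relative_cochains 4 4) 3"
    by (rule three_coordinates.has_dim_3[OF three_coordinates_4_4])
  ultimately show ?thesis
    using has_dim_0[where 'a = cochain]
    unfolding relative_cochains_0_4 relative_cochains_1_4 relative_cochains_2_4 by blast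
qed

end
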